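(* Let $\gamma\in(0,1)$, $\gamma_1=\gamma_2=\gamma$, let $1<p\leq q$, $(f(v),g(u))=(|v|^p,|u|^q)$, and let $u_0,v_0\in C_0(\mathbb{R}^N)$ with $u_0,v_0\ge0$. If $$Z_0:=\int_{\mathbb{R}^N}(u_0(x)+v_0(x))\chi(x)\,dx>2^{\frac p{p-1}},$$ then the mild solution of the system blows up in finite time, and its blow-up time $\bar t_{**}$ satisfies $$\bar t_{**}\leq\Big[\frac{\ln\big(1-2^pZ_0^{1-p}\big)}{2(1-p)}\,\Gamma(\gamma+1)\Big]^{1/\gamma}.$$
   Context: $\chi(x)=\Big(\int_{\mathbb{R}^N}e^{-\sqrt{N^2+|y|^2}}dy\Big)^{-1}e^{-\sqrt{N^2+|x|^2}}$, so $\int_{\mathbb{R}^N}\chi=1$. The system is ${}^{C}D_{0|t}^{\gamma}u-\Delta u=|v|^p$, ${}^{C}D_{0|t}^{\gamma}v-\Delta v=|u|^q$ for $t>0$, $x\in\mathbb{R}^N$, $u(0)=u_0$, $v(0)=v_0$, where ${}^{C}D^{\gamma}_{0|t}w(t)=\frac{1}{\Gamma(1-\gamma)}\int_0^t(t-s)^{-\gamma}\partial_sw(s)\,ds$. $C_0(\mathbb{R}^N)$ is the space of continuous functions vanishing at infinity. A mild solution is $(u,v)\in C([0,T];C_0\times C_0)$ with $u(t)=P_{\gamma}(t)u_0+\int_0^t(t-\tau)^{\gamma-1}S_{\gamma}(t-\tau)|v(\tau)|^p\,d\tau$, $v(t)=P_{\gamma}(t)v_0+\int_0^t(t-\tau)^{\gamma-1}S_{\gamma}(t-\tau)|u(\tau)|^q\,d\tau$,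 where $P_\gamma(t)w=\int_0^\infty\phi_\gamma(\theta)T(t^\gamma\theta)w\,d\theta$, $S_\gamma(t)w=\gamma\int_0^\infty\theta\phi_\gamma(\theta)T(t^\gamma\theta)w\,d\theta$, $T(t)$ the heat semigroup on $\mathbb{R}^N$, $\phi_\gamma(z)=\sum_{k\ge0}\frac{(-z)^k}{k!\Gamma(-\gamma k+1-\gamma)}$. Standing fact: the mild solution exists on a maximal interval $[0,T_{\max})$, and if $T_{\max}<\infty$ then $\|u(t)\|_\infty+\|v(t)\|_\infty\to\infty$ as $t\to T_{\max}$; blow-up in finite time means $T_{\max}<\infty$, and the blow-up time is $T_{\max}$. *)

theory Defs
  imports "HOL-Analysis.Analysis"
begin

definition heat_kernel :: "real \<Rightarrow> 'a::euclidean_space \<Rightarrow> real" where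
  "heat_kernel t x = (4 * pi * t) powr (- real DIM('a) / 2) * exp (- ((norm x) ^ 2) / (4 * t))"

definition heat_sg :: "real \<Rightarrow> ('a::euclidean_space \<Rightarrow> real) \<Rightarrow> 'a \<Rightarrow> real" where
  "heat_sg t w x = (if t = 0 then w x else (\<integral> y. heat_kernel t (x - y) * w y \<partial>lborel))"

text \<open>Mainardi (Wright type) function; 1/Gamma is written with rGamma
  (which is 0 at the poles of Gamma, as in the usual convention).\<close>
definition mainardi :: "real \<Rightarrow> real \<Rightarrow> real" where
  "mainardi \<gamma> z = (\<Sum>k. (- z) ^ k / fact k * rGamma (- \<gamma> * real k + 1 - \<gamma>))"

definition P_op :: "real \<Rightarrow> real \<Rightarrow> ('a::euclidean_space \<Rightarrow> real) \<Rightarrow> 'a \<Rightarrow> real" where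
  "P_op \<gamma> t w x = (LINT \<theta>:{0<..}|lborel. mainardi \<gamma> \<theta> * heat_sg (t powr \<gamma> * \<theta>) w x)"

definition S_op :: "real \<Rightarrow> real \<Rightarrow> ('a::euclidean_space \<Rightarrow> real) \<Rightarrow> 'a \<Rightarrow> real" where
  "S_op \<gamma> t w x = \<gamma> * (LINT \<theta>:{0<..}|lborel. \<theta> * mainardi \<gamma> \<theta> * heat_sg (t powr \<gamma> * \<theta>) w x)"

definition C0 :: "('a::euclidean_space \<Rightarrow> real) set" where
  "C0 = {w. continuous_on UNIV w \<and> (w \<longlongrightarrow> 0) at_infinity}"

text \<open>Mild solution on [0,T] of the system with nonlinearities |v|^p, |u|^q:
  (u,v) \<in> C([0,T]; C0 \<times> C0) (continuity in the sup norm = uniform convergence)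
  and the Duhamel formulas hold.\<close>
definition mild_solution ::
  "real \<Rightarrow> real \<Rightarrow> real \<Rightarrow> ('a::euclidean_space \<Rightarrow> real) \<Rightarrow> ('a \<Rightarrow> real) \<Rightarrow> real
    \<Rightarrow> (real \<Rightarrow> 'a \<Rightarrow> real) \<Rightarrow> (real \<Rightarrow> 'a \<Rightarrow> real) \<Rightarrow> bool" where
  "mild_solution \<gamma> p q u0 v0 T u v \<longleftrightarrow>
     (\<forall>t\<in>{0..T}. u t \<in> C0 \<and> v t \<in> C0) \<and>
     (\<forall>t\<in>{0..T}. uniform_limit UNIV u (u t) (at t within {0..T}) \<and>
                   uniform_limit UNIV v (v t) (at t within {0..T})) \<and>
     (\<forall>t\<in>{0..T}. \<forall>x.
        u t x = P_op \<gamma> t u0 x +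
          (LINT \<tau>:{0..t}|lborel. (t - \<tau>) powr (\<gamma> - 1) *
              S_op \<gamma> (t - \<tau>) (\<lambda>y. \<bar>v \<tau> y\<bar> powr p) x) \<and>
        v t x = P_op \<gamma> t v0 x +
          (LINT \<tau>:{0..t}|lborel. (t - \<tau>) powr (\<gamma> - 1) *
              S_op \<gamma> (t - \<tau>) (\<lambda>y. \<bar>u \<tau> y\<bar> powr q) x))"

definition T_max ::
  "real \<Rightarrow> real \<Rightarrow> real \<Rightarrow> ('a::euclidean_space \<Rightarrow> real) \<Rightarrow> ('a \<Rightarrow> real) \<Rightarrow> ereal" where
  "T_max \<gamma> p q u0 v0 = (SUP T\<in>{T. T \<ge> 0 \<and> (\<exists>u v. mild_solution \<gamma> p q u0 v0 T u v)}. ereal T)"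

definition chi :: "'a::euclidean_space \<Rightarrow> real" where
  "chi x = exp (- sqrt ((real DIM('a))^2 + (norm x)^2)) /
           (\<integral> y. exp (- sqrt ((real DIM('a))^2 + (norm (y::'a))^2)) \<partial>lborel)"

end

(* Testing the system with chi turns it into a scalar inequality for Z(t) = INT (u + v) chi.
   Convexity of exp(- sqrt(.)) gives T(s) chi >= exp(-s) chi for the heat semigroup, and the
   Mainardi function is nonnegative with explicit moments, so Z dominates the solution of the
   linear fractional equation with zeroth order term -Z.  Applying the positive operator
   I + I^gamma removes the Mittag-Leffler kernels and leaves, by Jensen's inequality,
   Z >= Z0 + I^gamma(2^(1-p) Z^p - Z - 1), where -1 >= -Z because Z >= 2.  Rearranging the
   kernel shows that y(t^gamma / Gamma(gamma + 1)) is a subsolution of this inequality when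
   y' = 2^(1-p) y^p - 2 y, and the blow-up time of y is explicit.

   Nonnegativity of the Mainardi function comes from complete monotonicity: the function
   t |-> t^(-gamma) M(theta t^(-gamma)) has Laplace transform l^(gamma-1) exp(- theta l^gamma),
   which is read off a Hankel type contour integral, and Post's inversion argument transfers the
   sign.  With the sign known, the moments of M follow from the Laplace transform by Tonelli. *)

theory Submission
  imports Defs "HOL-Complex_Analysis.Complex_Analysis" "HOL-Probability.Probability"
    "HOL-Real_Asymp.Real_Asymp"
begin

section \<open>Integrals along horizontal lines\<close>

text \<open>Two obstacles shape the argument. The Caputo derivative has no usable chain rule, so the
  comparison is made on the integral inequality: the fractional integral of F(w) is compared with an
  ordinary integral against \<open>frac_kernel \<gamma> s\<close>, which the fundamental theorem
  evaluates. And \<open>mainardi\<close> is an alternating power series, which shows neither sign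
  nor integrability; both are extracted from the contour integral.

  The constants: of the two terms -y in the equation for y, one is the decay exp(-s) of the tested
  heat semigroup, the other the price of lowering the exponent q to p. The threshold 2^(p/(p-1)) is
  the positive zero of 2^(1-p) y^p - 2 y, so y increases from any start above it; it exceeds 2,
  which is why Z >= 2 maintains itself. The equation is of Bernoulli type, linear in y^(1-p), and
  blow-up occurs where this power reaches 0.

  Estimates against \<open>chi\<close> are made with values in [0, infinity], before
  \<open>chi\<close> is known to be integrable; its integrability is read off from Z0 being
  nonzero.\<close>

lemma has_bochner_integral_exp_Gamma:
  assumes s: "s > (0::real)"
  shows "has_bochner_integral lborel (\<lambda>x. exp (s * x - exp x)) (Gamma s)"
proof -
  let ?f = "\<lambda>t::real. t powr (s - 1) / exp t"
  have fi: "(?f has_integral Gamma s) {0<..}"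
  proof -
    have "((\<lambda>t. if t \<in> {0<..} then ?f t else 0) has_integral Gamma s) {0..}"
      by (rule has_integral_spike [of "{0}", OF _ _ Gamma_integral_real[OF s]]) auto
    thus ?thesis by (subst (asm) has_integral_restrict) auto
  qed
  have "?f absolutely_integrable_on {0<..} \<and> integral {0<..} ?f = Gamma s"
    using fi by (auto intro!: nonnegative_absolutely_integrable_1 simp: has_integral_iff)
  moreover have "range exp = {0::real<..}"
    by (auto simp: image_iff) (metis exp_ln)
  ultimately have "(\<lambda>x. \<bar>exp x\<bar> * ?f (exp x)) absolutely_integrable_on UNIV \<and>
           integral UNIV (\<lambda>x. \<bar>exp x\<bar> * ?f (exp x)) = Gamma s"
    by (subst has_absolute_integral_change_of_variables_1')
       (auto intro!: derivative_eq_intros inj_onI)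
  moreover have "(\<lambda>x. \<bar>exp x\<bar> * ?f (exp x)) = (\<lambda>x. exp (s * x - exp x))"
    by (rule ext) (simp add: powr_def exp_diff [symmetric] exp_add [symmetric] algebra_simps del: exp_diff)
  ultimately have *: "(\<lambda>x. exp (s * x - exp x)) absolutely_integrable_on UNIV"
           "integral UNIV (\<lambda>x. exp (s * x - exp x)) = Gamma s" by auto
  hence "integrable lebesgue (\<lambda>x. exp (s * x - exp x))"
    by (simp add: set_integrable_def)
  hence "integrable lborel (\<lambda>x. exp (s * x - exp x))"
    by (subst (asm) integrable_completion) auto
  moreover from this have "(LINT x|lborel. exp (s * x - exp x)) = Gamma s"
    using integral_lborel[of "\<lambda>x. exp (s * x - exp x)"] *(2) by simp
  ultimately show ?thesis by (simp add: has_bochner_integral_iff)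
qed

lemma has_bochner_integral_exp_Gamma_scaled:
  assumes s: "s > (0::real)" and a: "a > 0" and b: "b > 0"
  shows "has_bochner_integral lborel (\<lambda>x. exp (s * x - a * exp (b * x)))
           (Gamma (s / b) * a powr (- (s / b)) / b)"
proof -
  have "has_bochner_integral lborel (\<lambda>x. exp (s / b * (ln a + b * x) - exp (ln a + b * x))) (Gamma (s / b) /\<^sub>R \<bar>b\<bar>)"
    using has_bochner_integral_exp_Gamma[of "s / b"] s b
    by (subst lborel_has_bochner_integral_real_affine_iff[symmetric]) auto
  hence "has_bochner_integral lborel (\<lambda>x. a powr (- (s / b)) * exp (s / b * (ln a + b * x) - exp (ln a + b * x)))
      (a powr (- (s / b)) * (Gamma (s / b) /\<^sub>R \<bar>b\<bar>))"
    by (rule has_bochner_integral_mult_right)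
  moreover have "a powr (- (s / b)) * exp (s / b * (ln a + b * x) - exp (ln a + b * x))
      = exp (s * x - a * exp (b * x))" for x
      using a b by (simp add: powr_def exp_add[symmetric] ring_distribs) (simp add: exp_add)
  ultimately show ?thesis using b by (simp add: field_simps)
qed

lemma contour_integral_linepath_same_Im:
  assumes "a < b"
  shows   "contour_integral (linepath (Complex a c) (Complex b c)) f =
           integral {a..b} (\<lambda>x. f (Complex x c))"
proof -
  have "contour_integral (linepath (Complex a c) (Complex b c)) f =
         of_real (b - a) * integral {0..1} (\<lambda>x. f (linepath (Complex a c) (Complex b c) x))"
    by (simp add: contour_integral_integral Complex_eq)
  also have "integral {0..1} (\<lambda>x. f (linepath (Complex a c) (Complex b c) x)) =
             integral {0..(b - a) / (b - a)} (\<lambda>x. f (Complex (a + (b - a) * x) c))"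
    using \<open>a < b\<close> by (simp add: linepath_def Complex_eq scaleR_conv_of_real algebra_simps)
  also have "{0..(b - a) / (b - a)} = (\<lambda>x. x / (b - a)) ` {0..b - a}"
    using \<open>a < b\<close> by simp
  also have "integral \<dots> (\<lambda>x. f (Complex (a + (b - a) * x) c)) =
             integral {a-a..b-a} (\<lambda>x. f (Complex (x + a) c)) / of_real (b - a)"
    using \<open>a < b\<close> by (subst integral_stretch_real) (auto simp: scaleR_conv_of_real add_ac)
  also have "\<dots> = integral {a..b} (\<lambda>x. f (Complex x c)) / of_real (b - a)"
    by (subst integral_shift_real_ivl) (rule refl)
  finally show ?thesis
    using \<open>a < b\<close> by simp
qed

text \<open>Cauchy's formula on the rectangles [-n,n] x [a,b] with n to infinity; the majorant
  \<open>B\<close> kills the vertical sides. The bound \<open>fB\<close> spares the abscissa of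
  \<open>z\<close>, so \<open>B\<close> may be singular there. Writing the integrand as g w / (w -
  z) covers a simple pole as well as no pole at all, where g vanishes at \<open>z\<close>.\<close>

lemma cauchy_strip:
  fixes f g :: "complex \<Rightarrow> complex" and z :: complex
  assumes S: "convex S" "open S" "{w. a \<le> Im w \<and> Im w \<le> b} \<subseteq> S"
    and g: "g holomorphic_on S"
    and z: "a < Im z" "Im z < b"
    and f: "\<And>w. w \<in> S \<Longrightarrow> w \<noteq> z \<Longrightarrow> f w = g w / (w - z)"
    and lima: "integrable lborel (\<lambda>r. f (Complex r a))"
    and limb: "integrable lborel (\<lambda>r. f (Complex r b))"
    and B: "(B \<longlongrightarrow> 0) at_top" "(B \<longlongrightarrow> 0) at_bot"
    and fB: "\<And>w. a \<le> Im w \<Longrightarrow> Im w \<le> b \<Longrightarrow> Re w \<noteq> Re z \<Longrightarrow> norm (f w) \<le> B (Re w)"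
  shows "(LINT r|lborel. f (Complex r a)) - (LINT r|lborel. f (Complex r b)) = 2 * pi * \<i> * g z"
proof -
  have ab: "a < b" using z by simp
  have hol: "f holomorphic_on (S - {z})"
  proof -
    have "(\<lambda>w. g w / (w - z)) holomorphic_on (S - {z})"
      by (intro holomorphic_intros holomorphic_on_subset[OF g]) auto
    thus ?thesis by (rule holomorphic_transform) (use f in auto)
  qed
  define I where "I = (\<lambda>c n. integral {-real n..real n} (\<lambda>r. f (Complex r c)))"
  define V where "V = (\<lambda>x. \<i> * integral {a..b} (\<lambda>y. f (Complex x y)))"
  have lim: "(\<lambda>n. I c n) \<longlonglongrightarrow> (LINT r|lborel. f (Complex r c))"
    if int: "integrable lborel (\<lambda>r. f (Complex r c))" for c
  proof -
    have "I c n = (LINT r:{-real n..real n}|lborel. f (Complex r c))" for n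
      unfolding I_def
      by (rule set_borel_integral_eq_integral(2)[symmetric])
         (use int in \<open>auto simp: set_integrable_def intro!: integrable_mult_indicator\<close>)
    moreover have "(\<lambda>n. LINT r|lborel. indicat_real {-real n..real n} r *\<^sub>R f (Complex r c)) \<longlonglongrightarrow> (LINT r|lborel. f (Complex r c))"
    proof (rule integral_dominated_convergence[where w = "\<lambda>r. norm (f (Complex r c))"])
      show "AE x in lborel. (\<lambda>n. indicat_real {- real n..real n} x *\<^sub>R f (Complex x c)) \<longlonglongrightarrow> f (Complex x c)"
      proof (rule AE_I2)
        fix x :: real
        have "\<forall>\<^sub>F n in sequentially. \<bar>x\<bar> \<le> real n"
          by real_asymp
        hence "\<forall>\<^sub>F n in sequentially. indicat_real {- real n..real n} x *\<^sub>R f (Complex x c) = f (Complex x c)"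
          by eventually_elim (auto simp: indicator_def)
        thus "(\<lambda>n. indicat_real {- real n..real n} x *\<^sub>R f (Complex x c)) \<longlonglongrightarrow> f (Complex x c)"
          by (rule tendsto_eventually)
      qed
    qed (use int in \<open>auto simp: indicator_def\<close>)
    ultimately show ?thesis by (simp add: set_lebesgue_integral_def)
  qed
  have V: "norm (V x) \<le> B x * (b - a)" if x: "x \<noteq> Re z" for x
  proof -
    have "norm (integral (cbox a b) (\<lambda>y. f (Complex x y))) \<le> B x * measure lborel (cbox a b)"
    proof (rule Henstock_Kurzweil_Integration.integrable_bound)
      show "0 \<le> B x"
        using order_trans[OF norm_ge_zero fB[of "Complex x a"]] ab x by (auto simp: complex_eq_iff)
      have "continuous_on (cbox a b) (\<lambda>y. f (Complex x y))"
        unfolding Complex_eq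
        by (intro continuous_on_compose2[OF holomorphic_on_imp_continuous_on[OF hol]] continuous_intros)
           (use S x in \<open>auto simp: Complex_eq\<close>)
      thus "(\<lambda>y. f (Complex x y)) integrable_on cbox a b" by (rule integrable_continuous)
      show "norm (f (Complex x y)) \<le> B x" if "y \<in> cbox a b" for y
        using that x by (intro order_trans[OF fB]) (auto simp: complex_eq_iff)
    qed
    thus ?thesis using ab by (simp add: V_def norm_mult)
  qed
  have eq: "\<forall>\<^sub>F n in sequentially. I a n + V (real n) - I b n - V (- real n) = 2 * pi * \<i> * g z"
  proof -
    have "\<forall>\<^sub>F n in sequentially. real n > \<bar>Re z\<bar> + 1" by real_asymp
    thus ?thesis
    proof eventually_elim
      fix n assume n: "real n > \<bar>Re z\<bar> + 1"
      define a1 a2 a3 a4 where "a1 = Complex (- real n) a" and "a2 = Complex n a" and "a3 = Complex n b" and "a4 = Complex (- real n) b"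
      have rp: "rectpath a1 a3 = linepath a1 a2 +++ linepath a2 a3 +++ linepath a3 a4 +++ linepath a4 a1"
        by (simp add: rectpath_def Let_def a1_def a2_def a3_def a4_def)
      have zb: "z \<in> box a1 a3" using n z by (auto simp: in_box_complex_iff a1_def a3_def)
      have sub: "path_image (rectpath a1 a3) \<subseteq> S - {z}"
      proof -
        have "cbox a1 a3 \<subseteq> S" using S(3) by (auto simp: in_cbox_complex_iff a1_def a3_def)
        thus ?thesis using zb ab n
          by (subst path_image_rectpath_cbox_minus_box) (auto simp: a1_def a3_def)
      qed
      have "((\<lambda>w. g w / (w - z)) has_contour_integral (2 * pi * \<i> * winding_number (rectpath a1 a3) z * g z)) (rectpath a1 a3)"
        using S g z sub by (intro Cauchy_integral_formula_convex_simple) (auto simp: interior_open)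
      hence "((\<lambda>w. g w / (w - z)) has_contour_integral (2 * pi * \<i> * g z)) (rectpath a1 a3)"
        using winding_number_rectpath[OF zb] by simp
      hence "(f has_contour_integral (2 * pi * \<i> * g z)) (rectpath a1 a3)"
        by (rule has_contour_integral_eq) (rule f[symmetric], use sub in auto)
      hence *: "contour_integral (rectpath a1 a3) f = 2 * pi * \<i> * g z"
        by (rule contour_integral_unique)
      have ci: "f contour_integrable_on (linepath p q)" if "path_image (linepath p q) \<subseteq> path_image (rectpath a1 a3)" for p q
        using hol sub that
        by (intro contour_integrable_continuous_linepath)
           (auto intro: continuous_on_subset[OF holomorphic_on_imp_continuous_on[OF hol]])
      have pi: "path_image (rectpath a1 a3) = path_image (linepath a1 a2) \<union> path_image (linepath a2 a3) \<union> path_image (linepath a3 a4) \<union> path_image (linepath a4 a1)"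
        by (simp add: rp path_image_join Un_assoc)
      have "contour_integral (rectpath a1 a3) f = contour_integral (linepath a1 a2) f + contour_integral (linepath a2 a3) f
         + contour_integral (linepath a3 a4) f + contour_integral (linepath a4 a1) f"
        unfolding rp using ci pi by (subst contour_integral_join, (auto intro!: contour_integrable_joinI)[4])+ simp
      also have "contour_integral (linepath a1 a2) f = I a n"
        unfolding a1_def a2_def I_def using n by (intro contour_integral_linepath_same_Im) auto
      also have "contour_integral (linepath a3 a4) f = - contour_integral (linepath a4 a3) f"
        by (rule contour_integral_reverse_linepath)
           (use pi sub in \<open>auto intro!: continuous_on_subset[OF holomorphic_on_imp_continuous_on[OF hol]] simp: closed_segment_commute\<close>)
      also have "contour_integral (linepath a4 a3) f = I b n"
        unfolding a4_def a3_def I_def using n by (intro contour_integral_linepath_same_Im) auto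
      also have "contour_integral (linepath a2 a3) f = V n"
        unfolding a2_def a3_def V_def using ab by (intro contour_integral_linepath_same_Re) auto
      also have "contour_integral (linepath a4 a1) f = - contour_integral (linepath a1 a4) f"
        by (rule contour_integral_reverse_linepath)
           (use pi sub in \<open>auto intro!: continuous_on_subset[OF holomorphic_on_imp_continuous_on[OF hol]] simp: closed_segment_commute\<close>)
      also have "contour_integral (linepath a1 a4) f = V (-n)"
        unfolding a1_def a4_def V_def using ab by (intro contour_integral_linepath_same_Re) auto
      finally show "I a n + V (real n) - I b n - V (- real n) = 2 * pi * \<i> * g z"
        using * by simp
    qed
  qed
  have V1: "(\<lambda>n. V (real n)) \<longlonglongrightarrow> 0"
  proof (rule Lim_null_comparison)
    have "\<forall>\<^sub>F n in sequentially. real n > Re z" by real_asymp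
    thus "\<forall>\<^sub>F n in sequentially. norm (V (real n)) \<le> B (real n) * (b - a)"
      by eventually_elim (auto intro: V)
    show "(\<lambda>n. B (real n) * (b - a)) \<longlonglongrightarrow> 0"
      by (intro tendsto_mult_left_zero filterlim_compose[OF B(1)] filterlim_real_sequentially)
  qed
  have V2: "(\<lambda>n. V (- real n)) \<longlonglongrightarrow> 0"
  proof (rule Lim_null_comparison)
    have "\<forall>\<^sub>F n in sequentially. - real n < Re z" by real_asymp
    thus "\<forall>\<^sub>F n in sequentially. norm (V (- real n)) \<le> B (- real n) * (b - a)"
      by eventually_elim (auto intro: V)
    show "(\<lambda>n. B (- real n) * (b - a)) \<longlonglongrightarrow> 0"
      by (intro tendsto_mult_left_zero filterlim_compose[OF B(2)])
         (simp add: filterlim_uminus_at_bot filterlim_real_sequentially)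
  qed
  have "(\<lambda>n. I a n + V (real n) - I b n - V (- real n)) \<longlonglongrightarrow>
     (LINT r|lborel. f (Complex r a)) + 0 - (LINT r|lborel. f (Complex r b)) - 0"
    by (intro tendsto_intros lim lima limb V1 V2)
  moreover have "(\<lambda>n. I a n + V (real n) - I b n - V (- real n)) \<longlonglongrightarrow> 2 * pi * \<i> * g z"
    using eq by (rule tendsto_eventually)
  ultimately show ?thesis using LIMSEQ_unique by fastforce
qed

section \<open>The Mainardi function as a contour integral\<close>

text \<open>The integrand of the Hankel integral \<open>\<integral> exp (t z - \<theta> z\<^sup>\<gamma>) z\<^sup>\<gamma>\<^sup>-\<^sup>1 dz\<close> after the substitution
  \<open>z = exp w\<close>, which makes it entire and turns rays into horizontal lines.\<close>

definition wright_kernel :: "real \<Rightarrow> real \<Rightarrow> real \<Rightarrow> complex \<Rightarrow> complex" where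
  "wright_kernel \<gamma> t \<theta> w = exp (\<gamma> * w + t * exp w - \<theta> * exp (\<gamma> * w))"

lemma exp_Complex: "exp (Complex a b) = complex_of_real (exp a) * cis b"
  by (simp add: exp_eq_polar)

lemma norm_wright_kernel:
  "norm (wright_kernel \<gamma> t \<theta> w) =
     exp (\<gamma> * Re w + t * exp (Re w) * cos (Im w) - \<theta> * exp (\<gamma> * Re w) * cos (\<gamma> * Im w))"
  by (simp add: wright_kernel_def Re_exp)

lemma measurable_wright_kernel [measurable]:
  "(\<lambda>(t, w). wright_kernel \<gamma> t \<theta> w) \<in> borel_measurable (borel \<Otimes>\<^sub>M borel)"
  unfolding wright_kernel_def by measurable

lemma measurable_Complex [measurable]: "(\<lambda>r. Complex r b) \<in> borel_measurable borel"
  by (intro borel_measurable_continuous_onI) (auto simp: Complex_eq intro!: continuous_intros)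

text \<open>Since \<gamma> < 1, the larger exponential wins with an arbitrarily small coefficient
  \<open>e\<close>; the two terms cross at \<open>r0\<close>, and to the left of it the constant
  does the work.\<close>

lemma exp_mult_le_exp:
  fixes \<gamma> a e :: real
  assumes "\<gamma> < 1" "a \<ge> 0" "e > 0" "\<gamma> > 0"
  obtains C where "\<And>r. a * exp (\<gamma> * r) \<le> e * exp r + C"
proof (cases "a = 0")
  case True
  thus ?thesis using assms by (intro that[of 0]) auto
next
  case False
  define r0 where "r0 = ln (a / e) / (1 - \<gamma>)"
  have "a * exp (\<gamma> * r) \<le> e * exp r + a * exp (\<gamma> * r0)" for r
  proof (cases "r \<ge> r0")
    case True
    hence "ln (a / e) \<le> (1 - \<gamma>) * r" using assms by (simp add: r0_def field_simps)
    hence "exp (ln (a / e)) \<le> exp ((1 - \<gamma>) * r)" by simp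
    hence "a / e \<le> exp ((1 - \<gamma>) * r)" using assms False by simp
    hence "a \<le> e * exp ((1 - \<gamma>) * r)" using assms by (simp add: field_simps)
    hence "a * exp (\<gamma> * r) \<le> e * exp ((1 - \<gamma>) * r) * exp (\<gamma> * r)" by (intro mult_right_mono) auto
    also have "\<dots> = e * exp r" by (simp add: ring_distribs flip: exp_add)
    finally show ?thesis using assms by (simp add: add_increasing2)
  next
    case F: False
    hence "a * exp (\<gamma> * r) \<le> a * exp (\<gamma> * r0)" using assms by (intro mult_left_mono) auto
    thus ?thesis using assms by (simp add: add_increasing)
  qed
  thus ?thesis using that by blast
qed

lemma integrable_exp_Gamma:
  "s > (0::real) \<Longrightarrow> a > 0 \<Longrightarrow> b > 0 \<Longrightarrow> integrable lborel (\<lambda>x. exp (s * x - a * exp (b * x)))"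
  using has_bochner_integral_exp_Gamma_scaled[of s a b] by (simp add: has_bochner_integral_iff)

text \<open>Half of the decay \<open>e * exp r\<close> absorbs the growing term, the other half
  gives a Gamma integral.\<close>

lemma integrable_exp_Gamma_perturbed:
  fixes \<gamma> a e :: real
  assumes "\<gamma> < 1" "a \<ge> 0" "e > 0" "\<gamma> > 0"
  shows "integrable lborel (\<lambda>r. exp (\<gamma> * r - e * exp r + a * exp (\<gamma> * r)))"
proof -
  obtain C where C: "\<And>r. a * exp (\<gamma> * r) \<le> e / 2 * exp r + C"
    using exp_mult_le_exp[of \<gamma> a "e/2"] assms by auto
  show ?thesis
  proof (rule Bochner_Integration.integrable_bound)
    show "integrable lborel (\<lambda>r. exp C * exp (\<gamma> * r - e / 2 * exp (1 * r)))"
      using assms by (intro integrable_mult_right integrable_exp_Gamma) auto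
    show "AE r in lborel. norm (exp (\<gamma> * r - e * exp r + a * exp (\<gamma> * r))) \<le> norm (exp C * exp (\<gamma> * r - e / 2 * exp (1 * r)))"
      using C by (auto intro!: AE_I2 simp flip: exp_add) (smt (verit) field_sum_of_halves)
  qed auto
qed

text \<open>Euler's reflection formula. It turns the coefficients of \<open>mainardi\<close>,
  reciprocal Gamma values at mostly negative arguments, into sines times convergent Euler integrals,
  that is, into imaginary parts.\<close>

lemma rGamma_one_minus_real:
  fixes x :: real assumes "x > 0"
  shows "rGamma (1 - x) = sin (pi * x) * Gamma x / pi"
proof -
  have "complex_of_real (rGamma x * rGamma (1 - x)) = complex_of_real (sin (pi * x) / pi)"
    using rGamma_reflection_complex[of "of_real x"]
    by (simp add: rGamma_complex_of_real[symmetric] sin_of_real[symmetric])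
  hence "rGamma x * rGamma (1 - x) = sin (pi * x) / pi" by (simp only: of_real_eq_iff)
  moreover have "Gamma x * rGamma x = 1"
    using Gamma_real_pos[OF assms] by (simp add: rGamma_inverse_Gamma)
  ultimately have "Gamma x * (sin (pi * x) / pi) = rGamma (1 - x)"
    by (metis mult.assoc mult.left_neutral)
  thus ?thesis by (simp add: field_simps)
qed

text \<open>The Hankel contour is collapsed onto the negative axis, whose upper side is the line Im
  w = pi. There exp(- \<theta> exp(\<gamma> w)) is expanded and integrated term by term: each term
  is an Euler integral with phase pi \<gamma> (k + 1), whose imaginary part is the k-th coefficient
  by reflection. The third conclusion, convergence of the defining series, serves the continuity of
  \<open>mainardi\<close>.\<close>

lemma mainardi_contour_pi:
  assumes g: "0 < \<gamma>" "\<gamma> < 1"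
  shows "integrable lborel (\<lambda>r. wright_kernel \<gamma> 1 \<theta> (Complex r pi))"
    and "mainardi \<gamma> \<theta> = Im (LINT r|lborel. wright_kernel \<gamma> 1 \<theta> (Complex r pi)) / pi"
    and "summable (\<lambda>k. (- \<theta>) ^ k / fact k * rGamma (- \<gamma> * real k + 1 - \<gamma>))"
proof -
  define T where "T = (\<lambda>k r. complex_of_real ((-\<theta>) ^ k / fact k) * cis (pi * (\<gamma> * (real k + 1))) *
                         complex_of_real (exp (\<gamma> * (real k + 1) * r - exp r)))"
  have gk: "\<gamma> * (real k + 1) > 0" for k using g by simp
  have bT: "has_bochner_integral lborel (T k) (complex_of_real ((-\<theta>) ^ k / fact k) * cis (pi * (\<gamma> * (real k + 1))) * complex_of_real (Gamma (\<gamma> * (real k + 1))))" for k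
    unfolding T_def
    by (intro has_bochner_integral_mult_right has_bochner_integral_of_real has_bochner_integral_exp_Gamma gk)
  have nT: "norm (T k r) = \<bar>\<theta>\<bar> ^ k / fact k * exp (\<gamma> * (real k + 1) * r - exp r)" for k r
    by (simp add: T_def norm_mult norm_power norm_divide)
  have nTs: "(\<lambda>k. norm (T k r)) sums exp (\<gamma> * r - 1 * exp r + \<bar>\<theta>\<bar> * exp (\<gamma> * r))" for r
  proof -
    have "(\<lambda>k. (\<bar>\<theta>\<bar> * exp (\<gamma> * r)) ^ k /\<^sub>R fact k) sums exp (\<bar>\<theta>\<bar> * exp (\<gamma> * r))"
      by (rule exp_converges)
    hence "(\<lambda>k. exp (\<gamma> * r - exp r) * ((\<bar>\<theta>\<bar> * exp (\<gamma> * r)) ^ k /\<^sub>R fact k)) sums (exp (\<gamma> * r - exp r) * exp (\<bar>\<theta>\<bar> * exp (\<gamma> * r)))"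
      by (rule sums_mult)
    moreover have "exp (\<gamma> * r - exp r) * ((\<bar>\<theta>\<bar> * exp (\<gamma> * r)) ^ k /\<^sub>R fact k) = norm (T k r)" for k
    proof -
      have "exp (\<gamma> * (real k + 1) * r - exp r) = exp (\<gamma> * r - exp r) * exp (\<gamma> * r) ^ k"
        by (simp add: exp_of_nat_mult[symmetric] ring_distribs mult_ac flip: exp_add)
      thus ?thesis unfolding nT by (simp add: power_mult_distrib field_simps)
    qed
    moreover have "exp (\<gamma> * r - exp r) * exp (\<bar>\<theta>\<bar> * exp (\<gamma> * r)) = exp (\<gamma> * r - 1 * exp r + \<bar>\<theta>\<bar> * exp (\<gamma> * r))"
      by (simp flip: exp_add)
    ultimately show ?thesis by simp
  qed
  have Ts: "(\<lambda>k. T k r) sums wright_kernel \<gamma> 1 \<theta> (Complex r pi)" for r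
  proof -
    have c1: "complex_of_real \<gamma> * Complex r pi = Complex (\<gamma> * r) (\<gamma> * pi)" by (simp add: complex_eq_iff)
    have c2: "exp (Complex r pi) = - of_real (exp r)" by (simp add: exp_Complex)
    define E where "E = exp (Complex (\<gamma> * r) (\<gamma> * pi))"
    have w: "wright_kernel \<gamma> 1 \<theta> (Complex r pi) = E * of_real (exp (- exp r)) * exp ((- of_real \<theta>) * E)"
      unfolding wright_kernel_def c1 c2 E_def by (simp add: exp_add exp_diff exp_minus exp_of_real field_simps)
    have "(\<lambda>k. ((- of_real \<theta>) * E) ^ k /\<^sub>R fact k) sums exp ((- of_real \<theta>) * E)"
      by (rule exp_converges)
    hence "(\<lambda>k. E * of_real (exp (- exp r)) * (((- of_real \<theta>) * E) ^ k /\<^sub>R fact k)) sums wright_kernel \<gamma> 1 \<theta> (Complex r pi)"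
      unfolding w by (rule sums_mult)
    moreover have "E * of_real (exp (- exp r)) * (((- of_real \<theta>) * E) ^ k /\<^sub>R fact k) = T k r" for k
    proof -
      have "E * E ^ k = exp (Complex (\<gamma> * (real k + 1) * r) (pi * (\<gamma> * (real k + 1))))"
        unfolding E_def exp_of_nat_mult[symmetric] exp_add[symmetric]
        by (rule arg_cong[where f = exp]) (simp add: complex_eq_iff algebra_simps)
      hence EE: "E * E ^ k = of_real (exp (\<gamma> * (real k + 1) * r)) * cis (pi * (\<gamma> * (real k + 1)))"
        by (simp only: exp_Complex)
      have "E * of_real (exp (- exp r)) * (((- of_real \<theta>) * E) ^ k /\<^sub>R fact k)
         = of_real ((-\<theta>) ^ k / fact k) * (E * E ^ k) * of_real (exp (- exp r))"
        by (simp only: power_mult_distrib scaleR_conv_of_real) (simp add: divide_inverse mult_ac)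
      also have "\<dots> = of_real ((-\<theta>) ^ k / fact k) * cis (pi * (\<gamma> * (real k + 1))) * (of_real (exp (\<gamma> * (real k + 1) * r)) * of_real (exp (- exp r)))"
        unfolding EE by (simp only: mult_ac)
      also have "\<dots> = T k r"
        unfolding T_def of_real_mult[symmetric] exp_add[symmetric] by simp
      finally show ?thesis .
    qed
    ultimately show ?thesis by simp
  qed
  have int1: "integrable lborel (\<lambda>r. exp (\<gamma> * r - 1 * exp r + \<bar>\<theta>\<bar> * exp (\<gamma> * r)))"
    using g by (intro integrable_exp_Gamma_perturbed) auto
  have iT: "integrable lborel (T k)" for k using bT by (simp add: has_bochner_integral_iff)
  \<comment> \<open>All partial sums of the L1 norms lie under the integral of the one majorant of
    \<open>nTs\<close>, so the individual norms are never evaluated.\<close>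
  have sum: "summable (\<lambda>k. (LINT r|lborel. norm (T k r)))"
  proof (rule bounded_imp_summable)
    show "(LINT r|lborel. norm (T k r)) \<ge> 0" for k by (rule integral_nonneg_AE) auto
    show "(\<Sum>k\<le>n. (LINT r|lborel. norm (T k r))) \<le> (LINT r|lborel. exp (\<gamma> * r - 1 * exp r + \<bar>\<theta>\<bar> * exp (\<gamma> * r)))" for n
    proof -
      have "(\<Sum>k\<le>n. (LINT r|lborel. norm (T k r))) = (LINT r|lborel. (\<Sum>k\<le>n. norm (T k r)))"
        using iT by (intro Bochner_Integration.integral_sum[symmetric]) auto
      also have "\<dots> \<le> (LINT r|lborel. exp (\<gamma> * r - 1 * exp r + \<bar>\<theta>\<bar> * exp (\<gamma> * r)))"
      proof (rule integral_mono[OF _ int1])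
        show "integrable lborel (\<lambda>r. \<Sum>k\<le>n. norm (T k r))" using iT by auto
        show "(\<Sum>k\<le>n. norm (T k r)) \<le> exp (\<gamma> * r - 1 * exp r + \<bar>\<theta>\<bar> * exp (\<gamma> * r))" for r
          using sum_le_suminf[OF sums_summable[OF nTs[of r]], of "{..n}"] sums_unique[OF nTs[of r]] by auto
      qed
      finally show ?thesis .
    qed
  qed
  have S: "(\<lambda>r. \<Sum>k. T k r) = (\<lambda>r. wright_kernel \<gamma> 1 \<theta> (Complex r pi))"
    using sums_unique[OF Ts] by (intro ext) simp
  have ae: "AE r in lborel. summable (\<lambda>k. norm (T k r))"
    using sums_summable[OF nTs] by (intro AE_I2) blast
  show "integrable lborel (\<lambda>r. wright_kernel \<gamma> 1 \<theta> (Complex r pi))"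
    using integrable_suminf[OF iT ae sum] unfolding S .
  have "(\<lambda>k. LINT r|lborel. T k r) sums (LINT r|lborel. wright_kernel \<gamma> 1 \<theta> (Complex r pi))"
    using sums_integral[OF iT ae sum] unfolding S .
  from sums_divide[OF sums_Im[OF this], of pi]
  have "(\<lambda>k. Im (LINT r|lborel. T k r) / pi) sums (Im (LINT r|lborel. wright_kernel \<gamma> 1 \<theta> (Complex r pi)) / pi)" .
  moreover have "Im (LINT r|lborel. T k r) / pi = (- \<theta>) ^ k / fact k * rGamma (- \<gamma> * real k + 1 - \<gamma>)" for k
  proof -
    have "Im (LINT r|lborel. T k r) / pi = (-\<theta>) ^ k / fact k * (sin (pi * (\<gamma> * (real k + 1))) * Gamma (\<gamma> * (real k + 1)) / pi)"
    proof -
      have im: "Im (complex_of_real A * cis b * complex_of_real G) = A * (sin b * G)" for A b G by simp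
      show ?thesis unfolding has_bochner_integral_integral_eq[OF bT[of k]] im by simp
    qed
    also have "sin (pi * (\<gamma> * (real k + 1))) * Gamma (\<gamma> * (real k + 1)) / pi = rGamma (1 - \<gamma> * (real k + 1))"
      by (rule rGamma_one_minus_real[OF gk, symmetric])
    also have "1 - \<gamma> * (real k + 1) = - \<gamma> * real k + 1 - \<gamma>" by (simp add: algebra_simps)
    finally show ?thesis .
  qed
  ultimately have s: "(\<lambda>k. (- \<theta>) ^ k / fact k * rGamma (- \<gamma> * real k + 1 - \<gamma>)) sums (Im (LINT r|lborel. wright_kernel \<gamma> 1 \<theta> (Complex r pi)) / pi)"
    by simp
  show "mainardi \<gamma> \<theta> = Im (LINT r|lborel. wright_kernel \<gamma> 1 \<theta> (Complex r pi)) / pi"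
    unfolding mainardi_def using sums_unique[OF s] by simp
  show "summable (\<lambda>k. (- \<theta>) ^ k / fact k * rGamma (- \<gamma> * real k + 1 - \<gamma>))"
    using s by (rule sums_summable)
qed

text \<open>In \<theta> this is the density at time t of the inverse \<gamma>-stable subordinator.
  As a function of t it has the explicit Laplace transform of \<open>mainardi_laplace\<close>, which
  is why it, and not \<open>mainardi\<close> itself, carries the positivity argument.\<close>

abbreviation inverse_stable :: "real \<Rightarrow> real \<Rightarrow> real \<Rightarrow> real" where
  "inverse_stable \<gamma> \<theta> t \<equiv> t powr (-\<gamma>) * mainardi \<gamma> (\<theta> * t powr (-\<gamma>))"

text \<open>The kernel is entire, so the line can be lowered from Im w = pi as long as the cosine
  stays negative: Re (exp w) <= - e exp r then dominates the possible growth |\<theta>| exp(\<gamma>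
  r).\<close>

lemma wright_kernel_rotate:
  assumes g: "0 < \<gamma>" "\<gamma> < 1" and a: "0 < \<alpha>" "\<alpha> < pi" "cos \<alpha> < 0"
  shows "(LINT r|lborel. wright_kernel \<gamma> 1 \<theta> (Complex r \<alpha>)) = (LINT r|lborel. wright_kernel \<gamma> 1 \<theta> (Complex r pi))"
proof -
  define e where "e = - cos \<alpha>"
  have e: "e > 0" using a by (simp add: e_def)
  define B where "B = (\<lambda>r. exp (\<gamma> * r - e * exp r + \<bar>\<theta>\<bar> * exp (\<gamma> * r)))"
  \<comment> \<open>A fictitious pole in the middle of the strip: the numerator gets the factor w -
    w0, so the residue is 0.\<close>
  define w0 where "w0 = Complex 0 ((\<alpha> + pi) / 2)"
  have bd: "norm (wright_kernel \<gamma> 1 \<theta> w) \<le> B (Re w)" if w: "\<alpha> \<le> Im w" "Im w \<le> pi" for w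
  proof -
    have "cos (Im w) \<le> cos \<alpha>" using w a by (intro cos_monotone_0_pi_le) auto
    hence 1: "exp (Re w) * cos (Im w) \<le> exp (Re w) * (- e)" by (intro mult_left_mono) (auto simp: e_def)
    have "\<bar>\<theta> * cos (\<gamma> * Im w)\<bar> \<le> \<bar>\<theta>\<bar> * 1" unfolding abs_mult by (intro mult_left_mono) auto
    hence "- (\<theta> * cos (\<gamma> * Im w)) \<le> \<bar>\<theta>\<bar>" by linarith
    hence "- (\<theta> * cos (\<gamma> * Im w)) * exp (\<gamma> * Re w) \<le> \<bar>\<theta>\<bar> * exp (\<gamma> * Re w)" by (intro mult_right_mono) auto
    with 1 show ?thesis by (simp add: norm_wright_kernel B_def algebra_simps)
  qed
  have intB: "integrable lborel B" unfolding B_def using g e by (intro integrable_exp_Gamma_perturbed) auto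
  have "(LINT r|lborel. wright_kernel \<gamma> 1 \<theta> (Complex r \<alpha>)) - (LINT r|lborel. wright_kernel \<gamma> 1 \<theta> (Complex r pi))
    = 2 * pi * \<i> * (\<lambda>w. wright_kernel \<gamma> 1 \<theta> w * (w - w0)) w0"
  proof (rule cauchy_strip[where S = UNIV and B = B and z = w0 and f = "wright_kernel \<gamma> 1 \<theta>"
        and g = "\<lambda>w. wright_kernel \<gamma> 1 \<theta> w * (w - w0)" and a = \<alpha> and b = pi])
    show "(\<lambda>w. wright_kernel \<gamma> 1 \<theta> w * (w - w0)) holomorphic_on UNIV"
      unfolding wright_kernel_def by (intro holomorphic_intros)
    show "integrable lborel (\<lambda>r. wright_kernel \<gamma> 1 \<theta> (Complex r \<alpha>))"
    proof (rule Bochner_Integration.integrable_bound[OF intB])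
      show "AE r in lborel. norm (wright_kernel \<gamma> 1 \<theta> (Complex r \<alpha>)) \<le> norm (B r)"
      proof (rule AE_I2)
        fix r show "norm (wright_kernel \<gamma> 1 \<theta> (Complex r \<alpha>)) \<le> norm (B r)"
          using bd[where w = "Complex r \<alpha>"] a by (simp add: B_def)
      qed
    qed measurable
    show "integrable lborel (\<lambda>r. wright_kernel \<gamma> 1 \<theta> (Complex r pi))"
      by (rule mainardi_contour_pi(1)[OF g])
    show "(B \<longlongrightarrow> 0) at_top" unfolding B_def using g e by real_asymp
    show "(B \<longlongrightarrow> 0) at_bot" unfolding B_def using g e by real_asymp
    show "norm (wright_kernel \<gamma> 1 \<theta> w) \<le> B (Re w)" if "\<alpha> \<le> Im w" "Im w \<le> pi" for w
      using bd that .
    show "\<alpha> < Im w0" "Im w0 < pi" using a by (auto simp: w0_def)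
    show "wright_kernel \<gamma> 1 \<theta> w = wright_kernel \<gamma> 1 \<theta> w * (w - w0) / (w - w0)" if "w \<noteq> w0" for w
      using that by simp
  qed auto
  thus ?thesis by simp
qed

text \<open>Shifting the line by ln t multiplies exp w by t and exp(\<gamma> w) by t^\<gamma>; the
  second factor cancels against the scaling of \<theta>.\<close>

lemma mainardi_scaled_contour:
  assumes g: "0 < \<gamma>" "\<gamma> < 1" and a: "0 < \<alpha>" "\<alpha> < pi" "cos \<alpha> < 0" and t: "t > 0"
  shows "inverse_stable \<gamma> \<theta> t = Im (LINT r|lborel. wright_kernel \<gamma> t \<theta> (Complex r \<alpha>)) / pi"
proof -
  let ?J = "LINT r|lborel. wright_kernel \<gamma> 1 (\<theta> * t powr (-\<gamma>)) (Complex r \<alpha>)"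
  have 1: "wright_kernel \<gamma> 1 (\<theta> * t powr (-\<gamma>)) (Complex (ln t + 1 * r) \<alpha>) = of_real (t powr \<gamma>) * wright_kernel \<gamma> t \<theta> (Complex r \<alpha>)" for r
  proof -
    have e1: "exp (Complex (ln t + 1 * r) \<alpha>) = t * exp (Complex r \<alpha>)"
      using t by (simp add: exp_Complex exp_add)
    have c: "complex_of_real \<gamma> * Complex (ln t + 1 * r) \<alpha> = \<gamma> * ln t + \<gamma> * Complex r \<alpha>"
      by (simp add: complex_eq_iff algebra_simps)
    have e2: "exp (complex_of_real \<gamma> * Complex (ln t + 1 * r) \<alpha>) = (t powr \<gamma>) * exp (\<gamma> * Complex r \<alpha>)"
      unfolding c exp_add using t by (simp add: powr_def exp_of_real[symmetric])
    have e3: "complex_of_real (\<theta> * t powr (-\<gamma>)) * ((t powr \<gamma>) * exp (\<gamma> * Complex r \<alpha>)) = \<theta> * exp (\<gamma> * Complex r \<alpha>)"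
      using t by (simp add: powr_minus field_simps)
    have "wright_kernel \<gamma> 1 (\<theta> * t powr (-\<gamma>)) (Complex (ln t + 1 * r) \<alpha>) = exp (complex_of_real \<gamma> * Complex (ln t + 1 * r) \<alpha>) * exp (t * exp (Complex r \<alpha>) - \<theta> * exp (\<gamma> * Complex r \<alpha>))"
      unfolding wright_kernel_def e1 e2 e3 unfolding e2[symmetric] exp_add[symmetric] by (simp add: algebra_simps)
    also have "\<dots> = of_real (t powr \<gamma>) * wright_kernel \<gamma> t \<theta> (Complex r \<alpha>)"
      unfolding e2 by (simp add: wright_kernel_def exp_add exp_diff exp_minus field_simps)
    finally show ?thesis .
  qed
  have "?J = \<bar>1\<bar> *\<^sub>R (LINT r|lborel. wright_kernel \<gamma> 1 (\<theta> * t powr (-\<gamma>)) (Complex (ln t + 1 * r) \<alpha>))"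
    by (rule lborel_integral_real_affine) auto
  also have "\<dots> = of_real (t powr \<gamma>) * (LINT r|lborel. wright_kernel \<gamma> t \<theta> (Complex r \<alpha>))"
    by (simp only: 1) simp
  finally have J: "?J = of_real (t powr \<gamma>) * (LINT r|lborel. wright_kernel \<gamma> t \<theta> (Complex r \<alpha>))" .
  have "mainardi \<gamma> (\<theta> * t powr (-\<gamma>)) = Im ?J / pi"
    using mainardi_contour_pi(2)[OF g] wright_kernel_rotate[OF g a] by simp
  also have "\<dots> = t powr \<gamma> * Im (LINT r|lborel. wright_kernel \<gamma> t \<theta> (Complex r \<alpha>)) / pi"
    unfolding J by simp
  finally show ?thesis using t by (simp add: powr_minus field_simps)
qed

text \<open>On the ray of argument \<open>\<alpha>\<close> both \<open>exp (t z)\<close> and \<open>exp (- \<theta> z\<^sup>\<gamma>)\<close> are bounded;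
  for \<open>\<gamma> > 1/2\<close> this fails on the negative axis.\<close>

lemma wright_angle:
  fixes \<gamma> :: real
  assumes "0 < \<gamma>" "\<gamma> < 1"
  defines "\<alpha> \<equiv> pi / (1 + \<gamma>)"
  shows "0 < \<alpha>" "\<alpha> < pi" "cos \<alpha> < 0" "cos (\<gamma> * \<alpha>) = - cos \<alpha>"
proof -
  show 1: "0 < \<alpha>" "\<alpha> < pi" using assms by (auto simp: field_simps)
  have "\<alpha> > pi / 2" using assms by (simp add: field_simps)
  thus "cos \<alpha> < 0" using 1 cos_gt_zero[of "\<alpha> - pi / 2"] cos_lt_zero_pi by auto
  have "\<gamma> * \<alpha> = pi - \<alpha>" using assms by (simp add: field_simps)
  thus "cos (\<gamma> * \<alpha>) = - cos \<alpha>" by (simp add: cos_diff)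
qed

text \<open>One bound for two situations. On the line Im w = \<alpha> it is uniform in t >= 0,
  because cos \<alpha> < 0. For t = 0 the first exponential is absent and the bound holds on the
  whole strip |Im w| <= \<alpha>, as the residue computation requires. In both, cos(\<gamma> Im w)
  >= cos(\<gamma> \<alpha>) = - cos \<alpha> > 0.\<close>

lemma norm_wright_kernel_le:
  fixes \<gamma> :: real
  assumes g: "0 < \<gamma>" "\<gamma> < 1" and t: "t \<ge> 0" and th: "\<theta> \<ge> 0"
  defines "\<alpha> \<equiv> pi / (1 + \<gamma>)"
  assumes w: "Im w = \<alpha> \<or> t = 0 \<and> \<bar>Im w\<bar> \<le> \<alpha>"
  shows "norm (wright_kernel \<gamma> t \<theta> w) \<le> exp (\<gamma> * Re w - \<theta> * (- cos \<alpha>) * exp (\<gamma> * Re w))"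
proof -
  note a = wright_angle[OF g, folded \<alpha>_def]
  have "t * exp (Re w) * cos (Im w) \<le> 0"
  proof (cases "t = 0")
    case False
    with w have "cos (Im w) \<le> 0" using a by simp
    thus ?thesis using t by (intro mult_nonneg_nonpos) auto
  qed simp
  moreover have "- cos \<alpha> \<le> cos (\<gamma> * Im w)"
  proof -
    have "cos (\<gamma> * \<alpha>) \<le> cos (\<gamma> * \<bar>Im w\<bar>)"
    proof (rule cos_monotone_0_pi_le)
      show "\<gamma> * \<bar>Im w\<bar> \<le> \<gamma> * \<alpha>" using w g a by (intro mult_left_mono) auto
      show "\<gamma> * \<alpha> \<le> pi" using g by (simp add: \<alpha>_def field_simps)
    qed (use g in auto)
    also have "cos (\<gamma> * \<bar>Im w\<bar>) = cos (\<gamma> * Im w)" by (cases "Im w \<ge> 0") auto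
    finally show ?thesis using a by simp
  qed
  hence "\<theta> * exp (\<gamma> * Re w) * (- cos \<alpha>) \<le> \<theta> * exp (\<gamma> * Re w) * cos (\<gamma> * Im w)"
    using th by (intro mult_left_mono) auto
  ultimately show ?thesis unfolding norm_wright_kernel
    by (simp add: mult_ac)
qed

section \<open>Laplace transform of the Mainardi function in time\<close>

lemma integrable_prod_mult:
  fixes f :: "_ \<Rightarrow> real" and g :: "_ \<Rightarrow> real"
  assumes "integrable lborel f" "integrable lborel g"
  shows "integrable (lborel \<Otimes>\<^sub>M lborel) (\<lambda>(x, y). f x * g y)"
proof (rule lborel_pair.Fubini_integrable)
  have [measurable]: "f \<in> borel_measurable lborel" "g \<in> borel_measurable lborel" using assms by auto
  show "(\<lambda>(x, y). f x * g y) \<in> borel_measurable (lborel \<Otimes>\<^sub>M lborel)" by measurable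
  show "integrable lborel (\<lambda>x. LINT y|lborel. norm (case (x, y) of (x, y) \<Rightarrow> f x * g y))"
    using assms by (simp add: abs_mult)
  show "AE x in lborel. integrable lborel (\<lambda>y. case (x, y) of (x, y) \<Rightarrow> f x * g y)"
    using assms by simp
qed

lemma has_bochner_integral_exp_half_line:
  fixes z :: complex
  assumes z: "Re z > 0"
  shows "has_bochner_integral lborel (\<lambda>t. indicator {0<..} t *\<^sub>R exp (- (of_real t * z))) (1 / z)"
proof -
  have z0: "z \<noteq> 0" using z by auto
  have ei: "einterval 0 \<infinity> = {0<..}" by (auto simp: einterval_def)
  have "(\<lambda>t. exp (- Re z * t)) absolutely_integrable_on {0..}"
    by (intro nonnegative_absolutely_integrable_1 integrable_on_exp_minus_to_infinity z) auto
  hence "integrable lebesgue (\<lambda>t. indicator {0..} t *\<^sub>R exp (- Re z * t))" by (simp add: set_integrable_def)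
  hence ir: "integrable lborel (\<lambda>t. indicator {0..} t *\<^sub>R exp (- Re z * t))"
    by (subst (asm) integrable_completion) auto
  have si: "set_integrable lborel (einterval 0 \<infinity>) (\<lambda>t. exp (- (of_real t * z)))"
    unfolding ei set_integrable_def
    by (rule Bochner_Integration.integrable_bound[OF ir]) (auto simp: indicator_def intro!: AE_I2)
  have "(LBINT t=0..\<infinity>. exp (- (of_real t * z))) = 0 - (- 1 / z)"
  proof (rule interval_integral_FTC_integrable[where F = "\<lambda>t. - exp (- (of_real t * z)) / z"])
    show "((\<lambda>t. - exp (- (complex_of_real t * z)) / z) has_vector_derivative exp (- (complex_of_real t * z))) (at t)" for t
      using z0 by (intro has_vector_derivative_real_field) (auto intro!: derivative_eq_intros)
    show "isCont (\<lambda>t. exp (- (complex_of_real t * z))) t" for t by (intro continuous_intros)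
    show "set_integrable lborel (einterval 0 \<infinity>) (\<lambda>t. exp (- (of_real t * z)))" by fact
    have "((\<lambda>t. - exp (- (complex_of_real t * z)) / z) \<longlongrightarrow> - exp (- (complex_of_real 0 * z)) / z) (at_right 0)"
      by (intro tendsto_intros z0)
    thus "(((\<lambda>t. - exp (- (complex_of_real t * z)) / z) \<circ> real_of_ereal) \<longlongrightarrow> - 1 / z) (at_right 0)"
      by (simp add: zero_ereal_def ereal_tendsto_simps)
    have "((\<lambda>t. exp (- Re z * t) / norm z) \<longlongrightarrow> 0) at_top"
      using z z0 by real_asymp
    moreover have "exp (- Re z * t) / norm z = norm (- exp (- (complex_of_real t * z)) / z)" for t
      by (simp add: norm_divide mult.commute)
    ultimately have "((\<lambda>t. norm (- exp (- (complex_of_real t * z)) / z)) \<longlongrightarrow> 0) at_top"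
      by (simp only:)
    hence "((\<lambda>t. - exp (- (complex_of_real t * z)) / z) \<longlongrightarrow> 0) at_top"
      by (rule tendsto_norm_zero_cancel)
    thus "(((\<lambda>t. - exp (- (complex_of_real t * z)) / z) \<circ> real_of_ereal) \<longlongrightarrow> 0) (at_left \<infinity>)"
      by (simp add: ereal_tendsto_simps)
  qed auto
  thus ?thesis using si
    by (simp add: has_bochner_integral_iff interval_lebesgue_integral_def ei set_integrable_def set_lebesgue_integral_def)
qed

lemma has_bochner_integral_exp_half_line_real:
  fixes m :: real
  assumes "m > 0"
  shows "has_bochner_integral lborel (\<lambda>t. indicator {0<..} t * exp (- m * t)) (1 / m)"
proof -
  have "has_bochner_integral lborel (\<lambda>t. Re (indicator {0<..} t *\<^sub>R exp (- (of_real t * of_real m)))) (Re (1 / complex_of_real m))"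
    using assms by (intro has_bochner_integral_bounded_linear[OF bounded_linear_Re] has_bochner_integral_exp_half_line) auto
  moreover have "Re (indicator {0<..} t *\<^sub>R exp (- (of_real t * of_real m))) = indicator {0<..} t * exp (- m * t)" for t
    by (simp add: Re_exp mult.commute)
  moreover have "Re (1 / complex_of_real m) = 1 / m" by simp
  ultimately show ?thesis by (simp only:)
qed

text \<open>Isolates the pole of the next lemma: in the strip |Im w| < 2 pi the function \<mu> - exp
  w has the single zero ln \<mu>.\<close>

lemma exp_eq_real_strip:
  assumes "exp w = complex_of_real l" "l > 0" "\<bar>Im w\<bar> < 2 * pi"
  shows "w = of_real (ln l)"
proof -
  have "exp w = exp (of_real (ln l))" using assms by (simp add: exp_of_real)
  then obtain n where n: "w = of_real (ln l) + (of_int (2 * n) * pi) * \<i>"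
    unfolding exp_eq by blast
  hence "Im w = 2 * real_of_int n * pi" by simp
  with assms(3) have "\<bar>real_of_int n\<bar> * 2 * pi < 1 * 2 * pi" by (simp add: abs_mult)
  hence "n = 0" by simp
  with n show ?thesis by simp
qed

text \<open>Integrating exp(t exp w - \<mu> t) over t > 0 leaves 1 / (\<mu> - exp w), whose pole ln
  \<mu> lies between the lines Im w = - \<alpha> and Im w = \<alpha>. The integrals over these lines
  are complex conjugates, so their difference is determined by one imaginary part, and the residue
  gives its value.\<close>

lemma wright_line_integral:
  fixes \<gamma> :: real
  assumes g: "0 < \<gamma>" "\<gamma> < 1" and th: "\<theta> > 0" and l: "\<mu> > 0"
  defines "\<alpha> \<equiv> pi / (1 + \<gamma>)"
  shows "Im (LINT r|lborel. wright_kernel \<gamma> 0 \<theta> (Complex r \<alpha>) / (\<mu> - exp (Complex r \<alpha>))) / pi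
     = \<mu> powr (\<gamma> - 1) * exp (- \<theta> * \<mu> powr \<gamma>)"
proof -
  note a = wright_angle[OF g, folded \<alpha>_def]
  define c where "c = - cos \<alpha>"
  have c: "c > 0" using a by (simp add: c_def)
  define f where "f = (\<lambda>w::complex. wright_kernel \<gamma> 0 \<theta> w / (\<mu> - exp w))"
  define S where "S = {w. - (2 * pi) < Im w \<and> Im w < 2 * pi}"
  define z where "z = complex_of_real (ln \<mu>)"
  \<comment> \<open>The quotient (\<mu> - exp w) / (w - z) with its removable singularity filled in.
    It has no zero in \<open>S\<close>, so the integrand is \<open>q w / (w - z)\<close> with
    holomorphic \<open>q\<close>.\<close>
  define D where "D = (\<lambda>w::complex. if w = z then deriv (\<lambda>w::complex. \<mu> - exp w) z else (\<mu> - exp w) / (w - z))"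
  define q where "q = (\<lambda>w. wright_kernel \<gamma> 0 \<theta> w / D w)"
  have ez: "exp z = complex_of_real \<mu>" using l by (simp add: z_def exp_of_real)
  have Dz: "D z = - complex_of_real \<mu>"
  proof -
    have "deriv (\<lambda>w::complex. \<mu> - exp w) z = - exp z" by (intro DERIV_imp_deriv) (auto intro!: derivative_eq_intros)
    thus ?thesis by (simp add: D_def ez)
  qed
  have nz: "\<mu> - exp w \<noteq> 0" if "w \<in> S" "w \<noteq> z" for w :: complex
    using exp_eq_real_strip[of w \<mu>] that l by (auto simp: S_def z_def abs_less_iff)
  have Dnz: "D w \<noteq> 0" if "w \<in> S" for w
    using nz[OF that] Dz l by (cases "w = z") (auto simp: D_def)
  have "(\<lambda>w. if w = z then deriv (\<lambda>w::complex. \<mu> - exp w) z else (\<mu> - exp w) / (w - z) - (\<mu> - exp z) / (w - z)) holomorphic_on UNIV"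
    by (rule pole_theorem) (auto intro!: holomorphic_intros)
  hence "D holomorphic_on UNIV" unfolding D_def ez diff_self div_0 diff_zero .
  hence D: "D holomorphic_on S" by (rule holomorphic_on_subset) auto
  \<comment> \<open>Singular at r = ln \<mu>, the abscissa of the pole; the bound is only used away
    from it.\<close>
  define B where "B = (\<lambda>r. exp (\<gamma> * r - \<theta> * c * exp (\<gamma> * r)) / \<bar>\<mu> - exp r\<bar>)"
  have SS: "S = {w. Im w > - (2 * pi)} \<inter> {w. Im w < 2 * pi}" by (auto simp: S_def)
  have nw: "norm (wright_kernel \<gamma> 0 \<theta> w) \<le> exp (\<gamma> * Re w - \<theta> * c * exp (\<gamma> * Re w))" if "\<bar>Im w\<bar> \<le> \<alpha>" for w
    unfolding c_def \<alpha>_def using norm_wright_kernel_le[OF g, of 0 \<theta> w] th that by (simp add: \<alpha>_def)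
  have int: "integrable lborel (\<lambda>r. f (Complex r b))" if b: "b = \<alpha> \<or> b = - \<alpha>" for b
  proof (rule Bochner_Integration.integrable_bound)
    show "integrable lborel (\<lambda>r. (1 / \<mu>) * exp (\<gamma> * r - (\<theta> * c) * exp (\<gamma> * r)))"
      using g th c by (intro integrable_mult_right integrable_exp_Gamma) auto
    show "AE r in lborel. norm (f (Complex r b)) \<le> norm ((1 / \<mu>) * exp (\<gamma> * r - (\<theta> * c) * exp (\<gamma> * r)))"
    proof (rule AE_I2)
      fix r
      have 1: "norm (wright_kernel \<gamma> 0 \<theta> (Complex r b)) \<le> exp (\<gamma> * r - \<theta> * c * exp (\<gamma> * r))"
        using nw[of "Complex r b"] b a by auto
      \<comment> \<open>Both lines have a negative cosine, so exp w has negative real part and the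
        denominator is at least \<mu> in modulus.\<close>
      have "cos b = - c" using b by (auto simp: c_def)
      hence "\<mu> \<le> Re (\<mu> - exp (Complex r b))" using c by (simp add: Re_exp mult_nonneg_nonpos)
      also have "\<dots> \<le> norm (\<mu> - exp (Complex r b))" by (rule complex_Re_le_cmod)
      finally have "norm (wright_kernel \<gamma> 0 \<theta> (Complex r b)) / norm (\<mu> - exp (Complex r b)) \<le> exp (\<gamma> * r - \<theta> * c * exp (\<gamma> * r)) / \<mu>"
        using 1 l by (intro frac_le) auto
      thus "norm (f (Complex r b)) \<le> norm ((1 / \<mu>) * exp (\<gamma> * r - (\<theta> * c) * exp (\<gamma> * r)))"
        using l by (simp add: f_def norm_divide)
    qed
  qed (simp add: f_def)
  have J: "(LINT r|lborel. f (Complex r (-\<alpha>))) - (LINT r|lborel. f (Complex r \<alpha>)) = 2 * pi * \<i> * q z"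
  proof (rule cauchy_strip[where S = S and B = B and z = z and f = f and g = q])
    show "convex S" unfolding SS by (intro convex_Int convex_halfspace_Im_gt convex_halfspace_Im_lt)
    show "open S" unfolding SS by (intro open_Int open_halfspace_Im_gt open_halfspace_Im_lt)
    show "{w. - \<alpha> \<le> Im w \<and> Im w \<le> \<alpha>} \<subseteq> S" using a by (auto simp: S_def)
    show "q holomorphic_on S" unfolding q_def wright_kernel_def
      by (intro holomorphic_intros D) (use Dnz in auto)
    show "- \<alpha> < Im z" "Im z < \<alpha>" using a by (auto simp: z_def)
    show "f w = q w / (w - z)" if "w \<in> S" "w \<noteq> z" for w
      using that by (simp add: f_def q_def D_def)
    show "integrable lborel (\<lambda>r. f (Complex r (-\<alpha>)))" "integrable lborel (\<lambda>r. f (Complex r \<alpha>))"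
      using int by auto
    show "(B \<longlongrightarrow> 0) at_top" unfolding B_def using g th c l by real_asymp
    show "(B \<longlongrightarrow> 0) at_bot" unfolding B_def using g th c l by real_asymp
    show "norm (f w) \<le> B (Re w)" if w: "- \<alpha> \<le> Im w" "Im w \<le> \<alpha>" "Re w \<noteq> Re z" for w
    proof -
      have 1: "norm (wright_kernel \<gamma> 0 \<theta> w) \<le> exp (\<gamma> * Re w - \<theta> * c * exp (\<gamma> * Re w))"
        using w by (intro nw) auto
      have "\<bar>\<mu> - exp (Re w)\<bar> = \<bar>norm (complex_of_real \<mu>) - norm (exp w)\<bar>" using l by simp
      also have "\<dots> \<le> norm (\<mu> - exp w)" by (rule norm_triangle_ineq3)
      finally have 2: "\<bar>\<mu> - exp (Re w)\<bar> \<le> norm (\<mu> - exp w)" .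
      have "exp (Re w) \<noteq> \<mu>" using w(3) l by (auto simp: z_def)
      hence "\<bar>\<mu> - exp (Re w)\<bar> > 0" by auto
      thus ?thesis unfolding f_def B_def norm_divide using 1 2 by (intro frac_le) auto
    qed
  qed
  have cj: "f (Complex r (-\<alpha>)) = cnj (f (Complex r \<alpha>))" for r
  proof -
    have "Complex r (-\<alpha>) = cnj (Complex r \<alpha>)" by (simp add: complex_eq_iff)
    thus ?thesis by (simp add: f_def wright_kernel_def exp_cnj)
  qed
  have "(LINT r|lborel. f (Complex r (-\<alpha>))) = cnj (LINT r|lborel. f (Complex r \<alpha>))"
    unfolding cj using int by (intro integral_bounded_linear[OF bounded_linear_cnj]) auto
  with J have "cnj (LINT r|lborel. f (Complex r \<alpha>)) - (LINT r|lborel. f (Complex r \<alpha>)) = 2 * pi * \<i> * q z" by simp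
  hence "Im (cnj (LINT r|lborel. f (Complex r \<alpha>)) - (LINT r|lborel. f (Complex r \<alpha>))) = Im (2 * pi * \<i> * q z)" by (rule arg_cong)
  hence "- 2 * Im (LINT r|lborel. f (Complex r \<alpha>)) = Im (2 * pi * \<i> * q z)" by simp
  moreover have "q z = - of_real (\<mu> powr (\<gamma> - 1) * exp (- \<theta> * \<mu> powr \<gamma>))"
  proof -
    have e: "exp (of_real \<gamma> * z) = \<mu> powr \<gamma>" using l by (simp add: z_def powr_def flip: exp_of_real)
    have "wright_kernel \<gamma> 0 \<theta> z = of_real (\<mu> powr \<gamma> * exp (- \<theta> * \<mu> powr \<gamma>))"
      unfolding wright_kernel_def using e by (simp add: exp_diff exp_minus field_simps flip: exp_of_real of_real_mult)
    thus ?thesis using l by (simp add: q_def Dz powr_diff)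
  qed
  ultimately show ?thesis by (simp add: f_def)
qed

lemma isCont_mainardi:
  assumes g: "0 < \<gamma>" "\<gamma> < 1"
  shows "isCont (mainardi \<gamma>) x"
proof -
  define c where "c = (\<lambda>k. (-1) ^ k / fact k * rGamma (- \<gamma> * real k + 1 - \<gamma>))"
  have eq: "(- y) ^ k / fact k * rGamma (- \<gamma> * real k + 1 - \<gamma>) = c k * y ^ k" for k y
    unfolding c_def by (subst power_minus) (simp add: field_simps)
  have "summable (\<lambda>k. c k * y ^ k)" for y
    using mainardi_contour_pi(3)[OF g, of y] unfolding eq .
  hence "isCont (\<lambda>x. \<Sum>k. c k * x ^ k) x" by (rule isCont_powser_converges_everywhere)
  moreover have "mainardi \<gamma> = (\<lambda>x. \<Sum>k. c k * x ^ k)"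
    unfolding mainardi_def eq by simp
  ultimately show ?thesis by simp
qed

lemma measurable_mainardi [measurable]: "mainardi \<gamma> \<in> borel_measurable borel"
  unfolding mainardi_def by measurable

text \<open>The majorant on the line Im w = \<alpha> does not involve t. Boundedness in t is what
  differentiating the Laplace transform and Post's argument ask for.\<close>

lemma mainardi_scaled_bounded:
  assumes g: "0 < \<gamma>" "\<gamma> < 1" and th: "\<theta> > 0"
  obtains C where "\<And>t. t > 0 \<Longrightarrow> \<bar>inverse_stable \<gamma> \<theta> t\<bar> \<le> C"
proof -
  define \<alpha> where "\<alpha> = pi / (1 + \<gamma>)"
  note a = wright_angle[OF g, folded \<alpha>_def]
  define C where "C = (LINT r|lborel. exp (\<gamma> * r - \<theta> * (- cos \<alpha>) * exp (\<gamma> * r)))"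
  have "\<bar>inverse_stable \<gamma> \<theta> t\<bar> \<le> C / pi" if t: "t > 0" for t
  proof -
    have "\<bar>Im (LINT r|lborel. wright_kernel \<gamma> t \<theta> (Complex r \<alpha>))\<bar> \<le> norm (LINT r|lborel. wright_kernel \<gamma> t \<theta> (Complex r \<alpha>))"
      by (rule abs_Im_le_cmod)
    also have "\<dots> \<le> (LINT r|lborel. norm (wright_kernel \<gamma> t \<theta> (Complex r \<alpha>)))"
      by (rule integral_norm_bound)
    also have "\<dots> \<le> C" unfolding C_def
    proof (rule integral_mono')
      show "integrable lborel (\<lambda>r. exp (\<gamma> * r - \<theta> * (- cos \<alpha>) * exp (\<gamma> * r)))"
        using g mult_pos_neg[OF th a(3)] by (intro integrable_exp_Gamma) auto
      show "norm (wright_kernel \<gamma> t \<theta> (Complex r \<alpha>)) \<le> exp (\<gamma> * r - \<theta> * (- cos \<alpha>) * exp (\<gamma> * r))" for r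
        unfolding \<alpha>_def using norm_wright_kernel_le[OF g, of t \<theta> "Complex r \<alpha>"] th t by (simp add: \<alpha>_def)
    qed auto
    finally show ?thesis
      unfolding mainardi_scaled_contour[OF g a(1-3) t] by (simp add: divide_right_mono)
  qed
  thus ?thesis using that by blast
qed

text \<open>Fubini for the contour representation: the t-integral is elementary and the remaining
  line integral is a residue. On Im w = \<alpha> the kernel has a majorant independent of t, so
  exp(- \<mu> t) alone gives integrability in t.\<close>

lemma mainardi_laplace:
  assumes g: "0 < \<gamma>" "\<gamma> < 1" and th: "\<theta> > 0" and l: "\<mu> > 0"
  shows "has_bochner_integral lborel
           (\<lambda>t. indicator {0<..} t *\<^sub>R (exp (- \<mu> * t) * inverse_stable \<gamma> \<theta> t))
           (\<mu> powr (\<gamma> - 1) * exp (- \<theta> * \<mu> powr \<gamma>))"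
proof -
  define \<alpha> where "\<alpha> = pi / (1 + \<gamma>)"
  note a = wright_angle[OF g, folded \<alpha>_def]
  define W where "W = (\<lambda>t r. wright_kernel \<gamma> t \<theta> (Complex r \<alpha>))"
  have W_meas [measurable]: "(\<lambda>(t, r). W t r) \<in> borel_measurable (borel \<Otimes>\<^sub>M borel)"
    unfolding W_def wright_kernel_def by measurable
  define F where "F = (\<lambda>t r. (indicator {0<..} t * exp (- \<mu> * t)) *\<^sub>R W t r)"
  define b where "b = (\<lambda>r. exp (\<gamma> * r - \<theta> * (- cos \<alpha>) * exp (\<gamma> * r)))"
  have ib: "integrable lborel b" unfolding b_def
    using g mult_pos_neg[OF th a(3)] by (intro integrable_exp_Gamma) auto
  have W_le: "norm (W t r) \<le> b r" if "t > 0" for t r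
    unfolding W_def b_def \<alpha>_def using norm_wright_kernel_le[OF g, of t \<theta> "Complex r \<alpha>"] th that by (simp add: \<alpha>_def)
  have ie: "integrable lborel (\<lambda>t. indicator {0<..} t * exp (- \<mu> * t) :: real)"
    using has_bochner_integral_exp_half_line_real[OF l] by (simp add: has_bochner_integral_iff)
  have iF: "integrable (lborel \<Otimes>\<^sub>M lborel) (\<lambda>(t, r). F t r)"
  proof (rule Bochner_Integration.integrable_bound[OF integrable_prod_mult[OF ie ib]])
    show "(\<lambda>(t, r). F t r) \<in> borel_measurable (lborel \<Otimes>\<^sub>M lborel)"
      unfolding F_def by measurable
    show "AE x in lborel \<Otimes>\<^sub>M lborel. norm (case x of (t, r) \<Rightarrow> F t r) \<le> norm (case x of (t, r) \<Rightarrow> indicator {0<..} t * exp (- \<mu> * t) * b r)"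
    proof (rule AE_I2, clarify)
      fix t r :: real
      have "b r \<ge> 0" by (simp add: b_def)
      thus "norm (F t r) \<le> norm (indicator {0<..} t * exp (- \<mu> * t) * b r)"
        using W_le[of t r] by (auto simp: F_def indicator_def)
    qed
  qed
  define f where "f = (\<lambda>r. wright_kernel \<gamma> 0 \<theta> (Complex r \<alpha>) / (\<mu> - exp (Complex r \<alpha>)))"
  have inner: "(LINT t|lborel. F t r) = f r" for r
  proof -
    have z: "Re (\<mu> - exp (Complex r \<alpha>)) > 0"
      using l a by (simp add: Re_exp) (smt (verit) mult_pos_neg exp_gt_zero)
    have "F t r = wright_kernel \<gamma> 0 \<theta> (Complex r \<alpha>) * (indicator {0<..} t *\<^sub>R exp (- (of_real t * (\<mu> - exp (Complex r \<alpha>)))))" for t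
      by (simp add: F_def W_def wright_kernel_def scaleR_conv_of_real exp_of_real[symmetric] exp_add exp_diff exp_minus field_simps)
    hence "(LINT t|lborel. F t r) = (LINT t|lborel. wright_kernel \<gamma> 0 \<theta> (Complex r \<alpha>) * (indicator {0<..} t *\<^sub>R exp (- (of_real t * (\<mu> - exp (Complex r \<alpha>))))))" by simp
    also have "\<dots> = wright_kernel \<gamma> 0 \<theta> (Complex r \<alpha>) * (1 / (\<mu> - exp (Complex r \<alpha>)))"
      by (intro has_bochner_integral_integral_eq has_bochner_integral_mult_right has_bochner_integral_exp_half_line z)
    finally show ?thesis by (simp add: f_def)
  qed
  have "integrable lborel (\<lambda>t. LINT r|lborel. F t r)"
    using lborel_pair.integrable_fst[OF iF] by simp
  moreover have "(LINT t|lborel. LINT r|lborel. F t r) = (LINT r|lborel. f r)"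
    using lborel_pair.Fubini_integral[OF iF] by (simp add: inner)
  ultimately have "has_bochner_integral lborel (\<lambda>t. LINT r|lborel. F t r) (LINT r|lborel. f r)"
    by (simp add: has_bochner_integral_iff)
  hence "has_bochner_integral lborel (\<lambda>t. Im (LINT r|lborel. F t r) / pi) (Im (LINT r|lborel. f r) / pi)"
    by (intro has_bochner_integral_divide) (rule has_bochner_integral_bounded_linear[OF bounded_linear_Im])
  moreover have "Im (LINT r|lborel. f r) / pi = \<mu> powr (\<gamma> - 1) * exp (- \<theta> * \<mu> powr \<gamma>)"
    unfolding f_def \<alpha>_def by (rule wright_line_integral[OF g th l])
  moreover have "Im (LINT r|lborel. F t r) / pi = indicator {0<..} t *\<^sub>R (exp (- \<mu> * t) * inverse_stable \<gamma> \<theta> t)" for t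
  proof (cases "t > 0")
    case True
    thus ?thesis unfolding mainardi_scaled_contour[OF g a(1-3) True] by (simp add: F_def W_def)
  qed (simp add: F_def)
  ultimately show ?thesis by simp
qed

section \<open>Nonnegativity of the Mainardi function\<close>

lemma power_le_fact_exp:
  assumes "(x::real) \<ge> 0"
  shows "x ^ n \<le> fact n * exp x"
proof -
  have s: "(\<lambda>k. x ^ k /\<^sub>R fact k) sums exp x" by (rule exp_converges)
  have "(\<Sum>k\<in>{n}. x ^ k /\<^sub>R fact k) \<le> (\<Sum>k. x ^ k /\<^sub>R fact k)"
    using assms s by (intro sum_le_suminf) (auto simp: sums_iff)
  hence "x ^ n / fact n \<le> exp x" using sums_unique[OF s] by (simp add: divide_inverse mult.commute)
  thus ?thesis by (simp add: field_simps)
qed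

text \<open>Half of the exponential decay pays for the power \<open>t ^ n\<close>.\<close>

lemma integrable_power_exp_half_line:
  fixes \<mu> :: real
  assumes "\<mu> > 0"
  shows "integrable lborel (\<lambda>t. indicator {0<..} t * (t ^ n * exp (- \<mu> * t)))"
proof (rule Bochner_Integration.integrable_bound)
  show "integrable lborel (\<lambda>t. (fact n * (2 / \<mu>) ^ n) * (indicator {0<..} t * exp (- (\<mu> / 2) * t)))"
    using has_bochner_integral_exp_half_line_real[of "\<mu> / 2"] assms
    by (intro integrable_mult_right) (auto simp: has_bochner_integral_iff)
  show "AE t in lborel. norm (indicator {0<..} t * (t ^ n * exp (- \<mu> * t))) \<le> norm ((fact n * (2 / \<mu>) ^ n) * (indicator {0<..} t * exp (- (\<mu> / 2) * t)))"
  proof (rule AE_I2)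
    fix t :: real
    show "norm (indicator {0<..} t * (t ^ n * exp (- \<mu> * t))) \<le> norm ((fact n * (2 / \<mu>) ^ n) * (indicator {0<..} t * exp (- (\<mu> / 2) * t)))"
    proof (cases "t > 0")
      case True
      have "(\<mu> / 2 * t) ^ n \<le> fact n * exp (\<mu> / 2 * t)" using True assms by (intro power_le_fact_exp) auto
      hence "t ^ n \<le> fact n * (2 / \<mu>) ^ n * exp (\<mu> / 2 * t)"
        using assms by (simp add: power_mult_distrib power_divide field_simps)
      hence "t ^ n * exp (- \<mu> * t) \<le> fact n * (2 / \<mu>) ^ n * exp (\<mu> / 2 * t) * exp (- \<mu> * t)"
        by (intro mult_right_mono) auto
      also have "\<dots> = fact n * (2 / \<mu>) ^ n * exp (- (\<mu> / 2) * t)" by (simp add: mult.assoc flip: exp_add)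
      finally show ?thesis using True assms by simp
    qed simp
  qed
qed auto

lemma integrable_power_exp_bounded:
  fixes h :: "real \<Rightarrow> real"
  assumes [measurable]: "h \<in> borel_measurable borel" and C: "\<And>t. t > 0 \<Longrightarrow> \<bar>h t\<bar> \<le> C" and m: "\<mu> > 0"
  shows "integrable lborel (\<lambda>t. indicator {0<..} t * (t ^ n * exp (- \<mu> * t)) * h t)"
proof (rule Bochner_Integration.integrable_bound)
  show "integrable lborel (\<lambda>t. C * (indicator {0<..} t * (t ^ n * exp (- \<mu> * t))))"
    by (intro integrable_mult_right integrable_power_exp_half_line m)
  have "C \<ge> 0" using C[of 1] by linarith
  thus "AE t in lborel. norm (indicator {0<..} t * (t ^ n * exp (- \<mu> * t)) * h t) \<le> norm (C * (indicator {0<..} t * (t ^ n * exp (- \<mu> * t))))"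
    by (intro AE_I2) (auto simp: indicator_def abs_mult C intro!: mult_left_mono mult_right_mono simp: mult.commute[of C])
qed auto

lemma exp_second_order:
  fixes y :: real
  shows "\<bar>exp y - 1 - y\<bar> \<le> exp \<bar>y\<bar> * y\<^sup>2"
proof -
  have "norm (exp (complex_of_real y) - (\<Sum>i\<le>1. of_real y ^ i / fact i)) \<le> exp \<bar>Re (of_real y)\<bar> * norm (complex_of_real y) ^ Suc 1 / fact 1"
    by (rule Taylor_exp)
  also have "exp (complex_of_real y) - (\<Sum>i\<le>1. of_real y ^ i / fact i) = of_real (exp y - 1 - y)"
    by (simp add: exp_of_real)
  finally show ?thesis by (simp only: norm_of_real Re_complex_of_real) (simp add: power2_eq_square)
qed

text \<open>Differentiation under the integral by a second-order remainder: |exp(-kt) - 1 + kt| <=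
  exp(|k| t) (k t)^2, and |k| < \<mu>/2 leaves the decay exp(- \<mu> t / 2), so the error is at most
  \<open>K * |k|\<close>.\<close>

lemma laplace_moment_deriv:
  fixes h :: "real \<Rightarrow> real"
  assumes meas [measurable]: "h \<in> borel_measurable borel" and C: "\<And>t. t > 0 \<Longrightarrow> \<bar>h t\<bar> \<le> C" and m: "\<mu> > 0"
  defines "H \<equiv> \<lambda>n \<mu>. LINT t|lborel. indicator {0<..} t * (t ^ n * exp (- \<mu> * t)) * h t"
  shows "(H n has_real_derivative - H (Suc n) \<mu>) (at \<mu>)"
proof -
  have C0: "C \<ge> 0" using C[of 1] by linarith
  note int = integrable_power_exp_bounded[OF meas C]
  define K where "K = C * (LINT t|lborel. indicator {0<..} t * (t ^ (n + 2) * exp (- (\<mu> / 2) * t)))"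
  have bound: "\<bar>(H n (\<mu> + k) - H n \<mu>) / k - (- H (Suc n) \<mu>)\<bar> \<le> K * \<bar>k\<bar>" if k: "k \<noteq> 0" "\<bar>k\<bar> < \<mu> / 2" for k
  proof -
    have mk: "\<mu> + k > 0" using k by linarith
    have eq: "(H n (\<mu> + k) - H n \<mu>) / k + H (Suc n) \<mu> =
      (LINT t|lborel. (indicator {0<..} t * (t ^ n * exp (- (\<mu> + k) * t)) * h t - indicator {0<..} t * (t ^ n * exp (- \<mu> * t)) * h t) / k
           + indicator {0<..} t * (t ^ Suc n * exp (- \<mu> * t)) * h t)"
    proof -
      have lin: "(LINT t|lborel. (A t - B t) / k + D t) = ((LINT t|lborel. A t) - (LINT t|lborel. B t)) / k + (LINT t|lborel. D t)"
        if "integrable lborel A" "integrable lborel B" "integrable lborel D" for A B D :: "real \<Rightarrow> real"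
        using that by simp
      show ?thesis unfolding H_def by (rule lin[symmetric]) (rule int[OF _ mk] int[OF _ m], assumption)+
    qed
    have "\<bar>(H n (\<mu> + k) - H n \<mu>) / k + H (Suc n) \<mu>\<bar> \<le> (LINT t|lborel. \<bar>k\<bar> * (C * (indicator {0<..} t * (t ^ (n + 2) * exp (- (\<mu> / 2) * t)))))"
      unfolding eq
    proof (rule order_trans[OF integral_abs_bound], rule integral_mono)
      show "integrable lborel (\<lambda>t. \<bar>k\<bar> * (C * (indicator {0<..} t * (t ^ (n + 2) * exp (- (\<mu> / 2) * t)))))"
        using m by (intro integrable_mult_right integrable_power_exp_half_line) auto
      show "integrable lborel (\<lambda>t. \<bar>(indicator {0<..} t * (t ^ n * exp (- (\<mu> + k) * t)) * h t - indicator {0<..} t * (t ^ n * exp (- \<mu> * t)) * h t) / k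
           + indicator {0<..} t * (t ^ Suc n * exp (- \<mu> * t)) * h t\<bar>)"
        using int[OF _ mk] int[OF _ m] by (intro integrable_abs Bochner_Integration.integrable_add integrable_divide Bochner_Integration.integrable_diff)
      fix t :: real
      show "\<bar>(indicator {0<..} t * (t ^ n * exp (- (\<mu> + k) * t)) * h t - indicator {0<..} t * (t ^ n * exp (- \<mu> * t)) * h t) / k
           + indicator {0<..} t * (t ^ Suc n * exp (- \<mu> * t)) * h t\<bar> \<le> \<bar>k\<bar> * (C * (indicator {0<..} t * (t ^ (n + 2) * exp (- (\<mu> / 2) * t))))"
      proof (cases "t > 0")
        case True
        have e: "exp (- (\<mu> + k) * t) = exp (- \<mu> * t) * exp (- k * t)" by (simp add: ring_distribs flip: exp_add)
        have eq': "(t ^ n * exp (- (\<mu> + k) * t) * h t - t ^ n * exp (- \<mu> * t) * h t) / k + t ^ Suc n * exp (- \<mu> * t) * h t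
            = t ^ n * exp (- \<mu> * t) * h t * ((exp (- k * t) - 1 - (- k * t)) / k)"
          unfolding e using k by (simp add: field_simps)
        have "\<bar>(t ^ n * exp (- (\<mu> + k) * t) * h t - t ^ n * exp (- \<mu> * t) * h t) / k + t ^ Suc n * exp (- \<mu> * t) * h t\<bar> = t ^ n * exp (- \<mu> * t) * \<bar>h t\<bar> * (\<bar>exp (- k * t) - 1 - (- k * t)\<bar> / \<bar>k\<bar>)"
          unfolding eq' using True by (simp add: abs_mult)
        also have "\<dots> \<le> t ^ n * exp (- \<mu> * t) * C * ((exp \<bar>- k * t\<bar> * (- k * t)\<^sup>2) / \<bar>k\<bar>)"
          using True C0 by (intro mult_mono divide_right_mono exp_second_order C) auto
        also have "\<dots> = \<bar>k\<bar> * (C * (t ^ (n + 2) * (exp (- \<mu> * t) * exp (\<bar>k\<bar> * t))))"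
        proof -
          have "(- k * t)\<^sup>2 / \<bar>k\<bar> = \<bar>k\<bar> * t\<^sup>2" using k by (simp add: power2_eq_square field_simps)
          hence "(exp \<bar>- k * t\<bar> * (- k * t)\<^sup>2) / \<bar>k\<bar> = exp (\<bar>k\<bar> * t) * (\<bar>k\<bar> * t\<^sup>2)"
            using True by (metis abs_minus_cancel abs_mult abs_of_pos mult_minus_left times_divide_eq_right)
          thus ?thesis by (simp add: power_add power2_eq_square mult_ac)
        qed
        also have "\<dots> \<le> \<bar>k\<bar> * (C * (t ^ (n + 2) * exp (- (\<mu> / 2) * t)))"
        proof -
          have "(\<bar>k\<bar> - \<mu>) * t \<le> (- (\<mu> / 2)) * t" using True k by (intro mult_right_mono) auto
          hence "exp ((\<bar>k\<bar> - \<mu>) * t) \<le> exp (- (\<mu> / 2) * t)" by simp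
          also have "exp ((\<bar>k\<bar> - \<mu>) * t) = exp (- \<mu> * t) * exp (\<bar>k\<bar> * t)" by (simp add: left_diff_distrib exp_diff exp_minus field_simps)
          finally show ?thesis using True C0 by (intro mult_left_mono) auto
        qed
        finally show ?thesis using True by simp
      qed simp
    qed
    also have "\<dots> = K * \<bar>k\<bar>" by (simp add: K_def)
    finally show ?thesis by simp
  qed
  have "(\<lambda>k. (H n (\<mu> + k) - H n \<mu>) / k - (- H (Suc n) \<mu>)) \<midarrow>0\<rightarrow> 0"
  proof (rule Lim_null_comparison)
    have "\<forall>\<^sub>F k in at (0::real). \<bar>k\<bar> < \<mu> / 2" using m
      by (auto simp: eventually_at dist_real_def intro!: exI[of _ "\<mu> / 2"])
    moreover have "\<forall>\<^sub>F k in at (0::real). k \<noteq> 0" by (rule eventually_neq_at_within)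
    ultimately show "\<forall>\<^sub>F k in at 0. norm ((H n (\<mu> + k) - H n \<mu>) / k - (- H (Suc n) \<mu>)) \<le> K * \<bar>k\<bar>"
      by eventually_elim (use bound in auto)
    show "((\<lambda>k. K * \<bar>k\<bar>) \<longlongrightarrow> 0) (at 0)"
      by (auto intro!: tendsto_eq_intros)
  qed
  hence "(\<lambda>k. (H n (\<mu> + k) - H n \<mu>) / k) \<midarrow>0\<rightarrow> - H (Suc n) \<mu>"
    by (rule LIM_zero_cancel)
  thus ?thesis by (simp add: DERIV_def)
qed

text \<open>Uniqueness of derivatives: an explicit family \<open>G\<close> with the derivative rule
  of the moments and the right zeroth member must be the moments. Their signs can then be read off
  from closed formulas.\<close>

lemma laplace_moments_eq:
  fixes h :: "real \<Rightarrow> real"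
  assumes meas: "h \<in> borel_measurable borel" and C: "\<And>t. t > 0 \<Longrightarrow> \<bar>h t\<bar> \<le> C"
    and G0: "\<And>\<mu>. \<mu> > 0 \<Longrightarrow> (LINT t|lborel. indicator {0<..} t * exp (- \<mu> * t) * h t) = G 0 \<mu>"
    and G: "\<And>n \<mu>. \<mu> > 0 \<Longrightarrow> (G n has_real_derivative - G (Suc n) \<mu>) (at \<mu>)"
    and m: "\<mu> > 0"
  shows "(LINT t|lborel. indicator {0<..} t * (t ^ n * exp (- \<mu> * t)) * h t) = G n \<mu>"
  using m
proof (induction n arbitrary: \<mu>)
  case 0
  thus ?case using G0 by simp
next
  case (Suc n)
  let ?H = "\<lambda>n \<mu>. LINT t|lborel. indicator {0<..} t * (t ^ n * exp (- \<mu> * t)) * h t"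
  have "(?H n has_real_derivative - G (Suc n) \<mu>) (at \<mu>)"
    by (rule has_field_derivative_transform_within_open[OF G[OF Suc.prems], of "{0<..}"])
       (use Suc in auto)
  moreover have "(?H n has_real_derivative - ?H (Suc n) \<mu>) (at \<mu>)"
    by (rule laplace_moment_deriv[OF meas C Suc.prems])
  ultimately show ?case using DERIV_unique by fastforce
qed

text \<open>Post's inversion argument: \<open>t\<^sup>n exp (- n t / t0)\<close> concentrates at \<open>t0\<close> as \<open>n \<rightarrow> \<infinity>\<close>.\<close>

lemma nonneg_if_laplace_moments_nonneg:
  fixes h :: "real \<Rightarrow> real"
  assumes meas [measurable]: "h \<in> borel_measurable borel" and C: "\<And>t. t > 0 \<Longrightarrow> \<bar>h t\<bar> \<le> C"
    and pos: "\<And>n \<mu>. \<mu> > 0 \<Longrightarrow> (LINT t|lborel. indicator {0<..} t * (t ^ n * exp (- \<mu> * t)) * h t) \<ge> 0"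
    and cont: "isCont h s" and s: "s > 0"
  shows "h s \<ge> 0"
proof (rule ccontr)
  assume "\<not> h s \<ge> 0"
  hence hs: "h s < 0" by simp
  have C0: "C \<ge> 0" using C[of 1] by linarith
  define m where "m = - h s / 2"
  have m: "m > 0" using hs by (simp add: m_def)
  obtain d0 where d0: "d0 > 0" "\<And>t. \<bar>t - s\<bar> < d0 \<Longrightarrow> h t < - m"
  proof -
    have "h s < - m" using hs by (simp add: m_def)
    hence "\<forall>\<^sub>F t in at s. h t < - m" using cont unfolding isCont_def by (rule order_tendstoD(2)[rotated])
    then obtain d where "d > 0" "\<And>t. t \<noteq> s \<Longrightarrow> dist t s < d \<Longrightarrow> h t < - m" unfolding eventually_at by blast
    with \<open>h s < - m\<close> show ?thesis by (intro that[of d]) (auto simp: dist_real_def, metis abs_zero)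
  qed
  define d where "d = min d0 (s / 2)"
  have d: "d > 0" "d < s" "\<And>t. \<bar>t - s\<bar> < d \<Longrightarrow> h t < - m" using d0 s by (auto simp: d_def)
  \<comment> \<open>The power \<open>\<kappa> t ^ n\<close> is Post's weight up to the constant (exp
    1 / s)^n, normalised to have its maximum 1 at t = s.\<close>
  define \<kappa> where "\<kappa> = (\<lambda>t. t / s * exp (1 - t / s))"
  define Q where "Q = (\<lambda>x::real. x * exp (1 - x))"
  have Q1: "Q x < 1" if "x > 0" "x \<noteq> 1" for x
  proof -
    have "ln x < x - 1" using that ln_le_minus_one[of x] ln_eq_minus_one[of x] by fastforce
    hence "x < exp (x - 1)" using that by (metis exp_less_cancel_iff exp_ln)
    thus ?thesis unfolding Q_def by (simp add: exp_diff field_simps)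
  qed
  \<comment> \<open>\<open>Q\<close> increases up to 1 and decreases afterwards; the tangent bound
    ln y <= y - 1 at y = x/a proves both without derivatives.\<close>
  have Qm: "Q x \<le> Q a" if "x > 0" "a > 0" "(x \<le> a \<and> a \<le> 1) \<or> (a \<le> x \<and> 1 \<le> a)" for x a
  proof -
    have "ln (x / a) \<le> x / a - 1" using that by (intro ln_le_minus_one) auto
    hence "ln x - x \<le> ln a - a + (x - a) * (1 / a - 1)" using that by (simp add: ln_div field_simps)
    also have "(x - a) * (1 / a - 1) \<le> 0" using that(3)
    proof
      assume "x \<le> a \<and> a \<le> 1"
      thus ?thesis using that by (intro mult_nonpos_nonneg) (auto simp: field_simps)
    next
      assume "a \<le> x \<and> 1 \<le> a"
      thus ?thesis using that by (intro mult_nonneg_nonpos) (auto simp: field_simps)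
    qed
    finally have "exp (1 + (ln x - x)) \<le> exp (1 + (ln a - a))" by simp
    thus ?thesis using that by (simp add: Q_def exp_add exp_diff mult.commute)
  qed
  \<comment> \<open>An upper bound for \<open>\<kappa>\<close> outside (s - d, s + d). The level
    \<open>q'\<close> below lies strictly between \<open>q\<close> and 1 and is reached throughout a
    smaller interval around s.\<close>
  define q where "q = max (Q (1 - d / s)) (Q (1 + d / s))"
  have q: "0 \<le> q" "q < 1"
    using Q1[of "1 - d / s"] Q1[of "1 + d / s"] d s by (auto simp: q_def Q_def le_max_iff_disj add_pos_pos)
  have \<kappa>Q: "\<kappa> t = Q (t / s)" for t by (simp add: \<kappa>_def Q_def)
  have far: "\<kappa> t \<le> q" if "t > 0" "\<bar>t - s\<bar> \<ge> d" for t
  proof (cases "t \<le> s")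
    case True
    have "t / s \<le> (s - d) / s" using that True s by (intro divide_right_mono) auto
    also have "(s - d) / s = 1 - d / s" using s by (simp add: diff_divide_distrib)
    finally have "Q (t / s) \<le> Q (1 - d / s)" using that d s by (intro Qm) auto
    thus ?thesis by (simp add: \<kappa>Q q_def)
  next
    case False
    have "(s + d) / s \<le> t / s" using that False s by (intro divide_right_mono) auto
    moreover have "(s + d) / s = 1 + d / s" using s by (simp add: add_divide_distrib)
    ultimately have "Q (t / s) \<le> Q (1 + d / s)" using that d s by (intro Qm) (auto simp: add_pos_pos)
    thus ?thesis by (simp add: \<kappa>Q q_def)
  qed
  define q' where "q' = (1 + q) / 2"
  have q': "q < q'" "q' < 1" "q' > 0" using q by (auto simp: q'_def)
  obtain e where e: "e > 0" "e \<le> d" "\<And>t. \<bar>t - s\<bar> < e \<Longrightarrow> \<kappa> t \<ge> q'"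
  proof -
    have "isCont \<kappa> s" unfolding \<kappa>_def using s by (intro continuous_intros) auto
    moreover have "\<kappa> s > q'" using q' s by (simp add: \<kappa>_def)
    ultimately have "\<forall>\<^sub>F t in at s. \<kappa> t > q'" unfolding isCont_def by (rule order_tendstoD)
    then obtain r where "r > 0" "\<And>t. t \<noteq> s \<Longrightarrow> dist t s < r \<Longrightarrow> \<kappa> t > q'" unfolding eventually_at by blast
    with \<open>\<kappa> s > q'\<close> d show ?thesis
      by (intro that[of "min r d"]) (auto simp: dist_real_def, metis abs_zero less_le)
  qed
  have \<kappa>0: "\<kappa> t \<ge> 0" if "t > 0" for t using that s by (simp add: \<kappa>_def)
  have \<kappa>p: "\<kappa> t ^ n = (exp 1 / s) ^ n * (t ^ n * exp (- (n / s) * t))" for t n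
    by (simp add: \<kappa>_def power_mult_distrib power_divide exp_diff exp_minus exp_of_nat_mult[symmetric] field_simps flip: exp_add)
  define K where "K = (LINT t|lborel. indicator {0<..} t * \<kappa> t)"
  have iK: "integrable lborel (\<lambda>t. indicator {0<..} t * \<kappa> t)"
    using integrable_mult_right[OF integrable_power_exp_half_line[of "1 / s" 1], of "exp 1 / s"] s \<kappa>p[of _ 1]
    by (simp add: mult_ac)
  have ii: "integrable lborel (indicator {s-e<..<s+e} :: real \<Rightarrow> real)"
    using e by (auto simp: integrable_indicator_iff emeasure_lborel_Ioo)
  \<comment> \<open>The exponent is \<open>Suc n\<close> because far from s one factor
    \<open>\<kappa>\<close> is kept for integrability while n factors are bounded by
    \<open>q\<close>. Near s, h < - m; in between, h is still negative and is estimated by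
    0.\<close>
  have main: "0 \<le> - m * q' ^ Suc n * (2 * e) + C * q ^ n * K" for n
  proof -
    have "0 \<le> (exp 1 / s) ^ Suc n * (LINT t|lborel. indicator {0<..} t * (t ^ Suc n * exp (- (Suc n / s) * t)) * h t)"
      using s by (intro mult_nonneg_nonneg pos) auto
    also have "\<dots> = (LINT t|lborel. (exp 1 / s) ^ Suc n * (indicator {0<..} t * (t ^ Suc n * exp (- (Suc n / s) * t)) * h t))"
      by (rule integral_mult_right_zero[symmetric])
    also have "\<dots> \<le> (LINT t|lborel. (- m * q' ^ Suc n) * indicator {s-e<..<s+e} t + (C * q ^ n) * (indicator {0<..} t * \<kappa> t))"
    proof (rule integral_mono)
      show "integrable lborel (\<lambda>t. (exp 1 / s) ^ Suc n * (indicator {0<..} t * (t ^ Suc n * exp (- (Suc n / s) * t)) * h t))"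
        using s by (intro integrable_mult_right integrable_power_exp_bounded[OF meas C]) auto
      show "integrable lborel (\<lambda>t. (- m * q' ^ Suc n) * indicator {s-e<..<s+e} t + (C * q ^ n) * (indicator {0<..} t * \<kappa> t))"
        by (intro Bochner_Integration.integrable_add integrable_mult_right iK ii)
      fix t :: real
      have near: "t > 0" if "t \<in> {s-e<..<s+e}" using that e d by auto
      show "(exp 1 / s) ^ Suc n * (indicator {0<..} t * (t ^ Suc n * exp (- (Suc n / s) * t)) * h t) \<le> (- m * q' ^ Suc n) * indicator {s-e<..<s+e} t + (C * q ^ n) * (indicator {0<..} t * \<kappa> t)"
      proof (cases "t > 0")
        case True
        have eq: "(exp 1 / s) ^ Suc n * (indicator {0<..} t * (t ^ Suc n * exp (- (Suc n / s) * t)) * h t) = \<kappa> t ^ Suc n * h t"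
          using True \<kappa>p[of t "Suc n"] by simp
        have r0: "C * q ^ n * \<kappa> t \<ge> 0" using C0 q \<kappa>0[OF True] by simp
        consider "\<bar>t - s\<bar> < e" | "\<bar>t - s\<bar> \<ge> e" "\<bar>t - s\<bar> < d" | "\<bar>t - s\<bar> \<ge> d" by linarith
        hence "\<kappa> t ^ Suc n * h t \<le> (- m * q' ^ Suc n) * indicator {s-e<..<s+e} t + C * q ^ n * \<kappa> t"
        proof cases
          case 1
          have "q' ^ Suc n * m \<le> \<kappa> t ^ Suc n * (- h t)"
            using e(3)[OF 1] q' d(3)[of t] 1 e(2) m by (intro mult_mono power_mono) auto
          moreover have "t \<in> {s-e<..<s+e}" using 1 by auto
          ultimately show ?thesis using r0 by (simp add: mult.commute)
        next
          case 2
          have "\<kappa> t ^ Suc n * h t \<le> 0" using d(3)[of t] 2 \<kappa>0[OF True] m by (intro mult_nonneg_nonpos) auto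
          moreover have "t \<notin> {s-e<..<s+e}" using 2 by auto
          ultimately show ?thesis using r0 by simp
        next
          case 3
          have "\<kappa> t ^ Suc n * h t = \<kappa> t ^ n * (\<kappa> t * h t)" by simp
          also have "\<dots> \<le> q ^ n * (\<kappa> t * C)"
            using far[OF True 3] \<kappa>0[OF True] C[OF True] C0 q
            by (intro order_trans[OF mult_left_mono[of "\<kappa> t * h t" "\<kappa> t * C"]] mult_right_mono power_mono mult_left_mono) auto
          finally have "\<kappa> t ^ Suc n * h t \<le> C * q ^ n * \<kappa> t" by (simp add: mult_ac)
          moreover have "t \<notin> {s-e<..<s+e}" using 3 e by auto
          ultimately show ?thesis by simp
        qed
        thus ?thesis unfolding eq using True by simp
      next
        case False
        hence "t \<notin> {s-e<..<s+e}" using near by auto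
        with False show ?thesis by simp
      qed
    qed
    also have "\<dots> = - m * q' ^ Suc n * (2 * e) + C * q ^ n * K"
      using iK ii e by (subst Bochner_Integration.integral_add) (auto simp: K_def)
    finally show ?thesis .
  qed
  \<comment> \<open>After division by q'^n the left side is a positive constant and the right side
    tends to 0.\<close>
  have "m * q' * (2 * e) \<le> C * K * (q / q') ^ n" for n
  proof -
    have "m * q' ^ Suc n * (2 * e) / q' ^ n \<le> C * q ^ n * K / q' ^ n" using main[of n] q' by (intro divide_right_mono) auto
    thus ?thesis using q' by (simp add: power_divide field_simps)
  qed
  moreover have "(\<lambda>n. C * K * (q / q') ^ n) \<longlonglongrightarrow> C * K * 0"
    using q q' by (intro tendsto_intros LIMSEQ_realpow_zero) auto
  ultimately have "m * q' * (2 * e) \<le> C * K * 0" by (intro LIMSEQ_le_const) auto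
  moreover have "m * q' * (2 * e) > 0" using m q' e by simp
  ultimately show False by simp
qed

text \<open>\<open>(-1)\<^sup>n\<close> times the \<open>n\<close>-th derivative of \<open>\<mu>\<^sup>a exp (- \<theta> \<mu>\<^sup>\<gamma>)\<close>; all summands are nonnegative when
  \<open>a \<le> 0\<close>, which is the complete monotonicity.\<close>

primrec stable_moment :: "real \<Rightarrow> real \<Rightarrow> nat \<Rightarrow> real \<Rightarrow> real \<Rightarrow> real" where
  "stable_moment \<gamma> \<theta> 0 = (\<lambda>a \<mu>. \<mu> powr a * exp (- \<theta> * \<mu> powr \<gamma>))"
| "stable_moment \<gamma> \<theta> (Suc n) = (\<lambda>a \<mu>. - a * stable_moment \<gamma> \<theta> n (a - 1) \<mu> + \<theta> * \<gamma> * stable_moment \<gamma> \<theta> n (a + \<gamma> - 1) \<mu>)"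

lemma stable_moment_deriv:
  assumes "\<mu> > 0"
  shows "(stable_moment \<gamma> \<theta> n a has_real_derivative - stable_moment \<gamma> \<theta> (Suc n) a \<mu>) (at \<mu>)"
  using assms
proof (induction n arbitrary: a)
  case 0
  have "\<mu> powr (a + \<gamma> - 1) = \<mu> powr a * \<mu> powr (\<gamma> - 1)" by (simp add: powr_add[symmetric] algebra_simps)
  with 0 show ?case by (auto intro!: derivative_eq_intros simp: algebra_simps)
next
  case (Suc n)
  show ?case unfolding stable_moment.simps(2)[of _ _ n]
    by (rule derivative_eq_intros Suc refl)+ (simp add: algebra_simps)
qed

text \<open>The recursion passes from a to a - 1 and a + \<gamma> - 1, which stay nonpositive
  because \<gamma> <= 1.\<close>

lemma stable_moment_nonneg:
  assumes "\<gamma> \<ge> 0" "\<gamma> \<le> 1" "\<theta> \<ge> 0" "a \<le> 0" "\<mu> > 0"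
  shows "stable_moment \<gamma> \<theta> n a \<mu> \<ge> 0"
  using assms(4)
proof (induction n arbitrary: a)
  case (Suc n)
  have "- a * stable_moment \<gamma> \<theta> n (a - 1) \<mu> \<ge> 0" "\<theta> * \<gamma> * stable_moment \<gamma> \<theta> n (a + \<gamma> - 1) \<mu> \<ge> 0"
    using Suc assms by (auto intro!: mult_nonneg_nonneg mult_nonpos_nonneg)
  thus ?case by simp
qed simp

text \<open>The value \<theta> = 1 is enough, since t^(-\<gamma>) takes every positive value. The
  Laplace transform \<mu>^(\<gamma>-1) exp(- \<mu>^\<gamma>) has the exponent a = \<gamma> - 1 <= 0,
  so all moments of \<open>h\<close> are nonnegative.\<close>

lemma mainardi_nonneg:
  assumes g: "0 < \<gamma>" "\<gamma> < 1" and x: "x > 0"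
  shows "mainardi \<gamma> x \<ge> 0"
proof -
  define h where "h = (\<lambda>t. t powr (-\<gamma>) * mainardi \<gamma> (1 * t powr (-\<gamma>)))"
  obtain C where C: "\<And>t. t > 0 \<Longrightarrow> \<bar>h t\<bar> \<le> C"
    using mainardi_scaled_bounded[OF g zero_less_one] unfolding h_def by blast
  have meas: "h \<in> borel_measurable borel" unfolding h_def by measurable
  define s where "s = x powr (- 1 / \<gamma>)"
  have s: "s > 0" "s powr (-\<gamma>) = x" using x g by (auto simp: s_def powr_powr)
  have "h s \<ge> 0"
  proof (rule nonneg_if_laplace_moments_nonneg[OF meas C _ _ s(1)])
    show "isCont h s" unfolding h_def
      using s(1) by (intro continuous_intros isCont_o2[OF _ isCont_mainardi[OF g]]) auto
    fix n and \<mu> :: real assume m: "\<mu> > 0"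
    have "(LINT t|lborel. indicator {0<..} t * (t ^ n * exp (- \<mu> * t)) * h t) = stable_moment \<gamma> 1 n (\<gamma> - 1) \<mu>"
    proof (rule laplace_moments_eq[OF meas C _ _ m, where G = "\<lambda>n. stable_moment \<gamma> 1 n (\<gamma> - 1)"])
      show "(LINT t|lborel. indicator {0<..} t * exp (- \<nu> * t) * h t) = stable_moment \<gamma> 1 0 (\<gamma> - 1) \<nu>" if "\<nu> > 0" for \<nu>
        using has_bochner_integral_integral_eq[OF mainardi_laplace[OF g zero_less_one that]]
        by (simp add: h_def mult_ac)
    qed (auto intro: stable_moment_deriv simp del: stable_moment.simps)
    also have "\<dots> \<ge> 0" using g m by (intro stable_moment_nonneg) auto
    finally show "(LINT t|lborel. indicator {0<..} t * (t ^ n * exp (- \<mu> * t)) * h t) \<ge> 0" .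
  qed
  thus ?thesis using s x by (simp add: h_def zero_le_mult_iff)
qed

section \<open>Fractional kernels and their resolvents\<close>

text \<open>The Riemann-Liouville kernel: convolution with it over [0,t] is the fractional integral
  of order a.\<close>

definition frac_kernel :: "real \<Rightarrow> real \<Rightarrow> real" where
  "frac_kernel a t = t powr (a - 1) / Gamma a"

lemma measurable_frac_kernel [measurable]: "frac_kernel a \<in> borel_measurable borel"
  unfolding frac_kernel_def by measurable

lemma frac_kernel_nonneg: "a > 0 \<Longrightarrow> frac_kernel a t \<ge> 0"
  using Gamma_real_pos[of a] by (simp add: frac_kernel_def)

text \<open>Since \<open>0 powr a = 0\<close> for every \<open>a\<close>, the kernels vanish at \<open>0\<close> even where they are singular;
  this settles the endpoint cases of the convolutions below.\<close>

lemma frac_kernel_0 [simp]: "frac_kernel a 0 = 0"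
  by (simp add: frac_kernel_def)

lemma has_bochner_integral_nonneg_has_integral:
  fixes f :: "real \<Rightarrow> real"
  assumes [measurable]: "f \<in> borel_measurable borel" "S \<in> sets borel" and f: "\<And>x. x \<in> S \<Longrightarrow> f x \<ge> 0" "(f has_integral I) S"
  shows "has_bochner_integral lborel (\<lambda>x. indicator S x * f x) I"
proof (rule has_bochner_integral_nn_integral)
  show "(\<integral>\<^sup>+x. ennreal (indicator S x * f x) \<partial>lborel) = ennreal I"
    using nn_integral_has_integral_lebesgue[OF f] by simp
  show "AE x in lborel. 0 \<le> indicator S x * f x" using f by (intro AE_I2) (auto simp: indicator_def)
  show "0 \<le> I" using f by (rule has_integral_nonneg[rotated])
qed measurable

lemma has_bochner_integral_frac_kernel:
  assumes g: "0 < \<gamma>" and t: "t \<ge> 0"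
  shows "has_bochner_integral lborel (\<lambda>s. indicator {0..t} s * frac_kernel \<gamma> s) (t powr \<gamma> / Gamma (\<gamma> + 1))"
proof -
  have "((\<lambda>s. s powr (\<gamma> - 1)) has_integral (t powr (\<gamma> - 1 + 1) / (\<gamma> - 1 + 1))) {0..t}"
    using g t by (intro has_integral_powr_from_0) auto
  hence "((\<lambda>s. s powr (\<gamma> - 1) / Gamma \<gamma>) has_integral (t powr \<gamma> / \<gamma> / Gamma \<gamma>)) {0..t}"
    by (intro has_integral_divide) simp
  moreover have "\<gamma> \<notin> \<int>\<^sub>\<le>\<^sub>0" using g by (auto elim!: nonpos_Ints_cases)
  hence "Gamma (\<gamma> + 1) = \<gamma> * Gamma \<gamma>" by (rule Gamma_plus1)
  ultimately have "(frac_kernel \<gamma> has_integral (t powr \<gamma> / Gamma (\<gamma> + 1))) {0..t}"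
    unfolding frac_kernel_def by (simp add: mult.commute)
  thus ?thesis using frac_kernel_nonneg[OF g] by (intro has_bochner_integral_nonneg_has_integral) auto
qed

lemma has_bochner_integral_frac_kernel_reflected:
  assumes g: "0 < \<gamma>" and t: "t \<ge> 0"
  shows "has_bochner_integral lborel (\<lambda>s. indicator {0..t} s * frac_kernel \<gamma> (t - s)) (t powr \<gamma> / Gamma (\<gamma> + 1))"
proof -
  have "has_bochner_integral lborel (\<lambda>s. indicator {0..t} (t + (-1) * s) * frac_kernel \<gamma> (t + (-1) * s)) ((t powr \<gamma> / Gamma (\<gamma> + 1)) /\<^sub>R \<bar>-1\<bar>)"
    by (subst lborel_has_bochner_integral_real_affine_iff[symmetric]) (auto intro: has_bochner_integral_frac_kernel assms)
  moreover have "indicator {0..t} (t + (-1) * s) * frac_kernel \<gamma> (t + (-1) * s) = indicator {0..t} s * frac_kernel \<gamma> (t - s)" for s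
    by (auto simp: indicator_def)
  ultimately have "has_bochner_integral lborel (\<lambda>s. indicator {0..t} s * frac_kernel \<gamma> (t - s)) ((t powr \<gamma> / Gamma (\<gamma> + 1)) /\<^sub>R \<bar>-1\<bar>)"
    by (simp only:)
  thus ?thesis by simp
qed

section \<open>Moments of the Mainardi function\<close>

lemma nn_integral_power_exp:
  "(\<integral>\<^sup>+t. ennreal (indicator {0<..} t * (t ^ n * exp (- t))) \<partial>lborel) = ennreal (fact n)"
proof -
  have "(\<integral>\<^sup>+t. ennreal (indicator {0<..} t * (t ^ n * exp (- t))) \<partial>lborel) =
      (\<integral>\<^sup>+t. ennreal (indicator {0..} t * t powr (real (Suc n) - 1) / exp t) \<partial>lborel)"
  proof (intro nn_integral_cong arg_cong[where f = ennreal])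
    fix t :: real
    show "indicator {0<..} t * (t ^ n * exp (- t)) = indicator {0..} t * t powr (real (Suc n) - 1) / exp t"
      by (cases "t > 0") (auto simp: indicator_def powr_realpow exp_minus divide_inverse)
  qed
  also have "\<dots> = ennreal (Gamma (real (Suc n)))"
    by (rule Gamma_conv_nn_integral_real[symmetric]) simp
  also have "Gamma (real (Suc n)) = fact n" using Gamma_fact[of n, where 'a = real] by (simp add: add.commute)
  finally show ?thesis .
qed

lemma pos_notin_nonpos_Ints: "(x::real) > 0 \<Longrightarrow> x \<notin> \<int>\<^sub>\<le>\<^sub>0"
  by (auto elim!: nonpos_Ints_cases)

text \<open>Tonelli for \<theta>^n exp(-t) \<open>inverse_stable \<gamma> \<theta> t\<close>.
  Integrating over t first uses the Laplace transform at \<mu> = 1 and leads to n!; integrating over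
  \<theta> first gives, after scaling \<theta> by t^\<gamma>, the moment times Gamma(\<gamma> n +
  1). Finiteness of the moment is part of the outcome.\<close>

lemma mainardi_moment_nn:
  assumes g: "0 < \<gamma>" "\<gamma> < 1"
  shows "(\<integral>\<^sup>+\<theta>. ennreal (indicator {0<..} \<theta> * (\<theta> ^ n * mainardi \<gamma> \<theta>)) \<partial>lborel) = ennreal (fact n / Gamma (\<gamma> * n + 1))"
    (is "?M = _")
proof -
  let ?F = "\<lambda>\<theta> t. ennreal (indicator {0<..} \<theta> * \<theta> ^ n * (indicator {0<..} t * (exp (- t) * inverse_stable \<gamma> \<theta> t)))"
  have inner1: "(\<integral>\<^sup>+t. ?F \<theta> t \<partial>lborel) = ennreal (indicator {0<..} \<theta> * (\<theta> ^ n * exp (- \<theta>)))" for \<theta>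
  proof (cases "\<theta> > 0")
    case True
    have nn: "indicator {0<..} t * (exp (- t) * inverse_stable \<gamma> \<theta> t) \<ge> 0" for t
      using mainardi_nonneg[OF g, of "\<theta> * t powr (-\<gamma>)"] True by (auto simp: indicator_def)
    have hb: "has_bochner_integral lborel (\<lambda>t. indicator {0<..} t * (exp (- t) * inverse_stable \<gamma> \<theta> t)) (exp (- \<theta>))"
      using mainardi_laplace[OF g True, of 1] by simp
    have "(\<integral>\<^sup>+t. ?F \<theta> t \<partial>lborel) = (\<integral>\<^sup>+t. ennreal (\<theta> ^ n) * ennreal (indicator {0<..} t * (exp (- t) * inverse_stable \<gamma> \<theta> t)) \<partial>lborel)"
      using True nn by (intro nn_integral_cong) (simp flip: ennreal_mult)
    also have "\<dots> = ennreal (\<theta> ^ n) * (\<integral>\<^sup>+t. ennreal (indicator {0<..} t * (exp (- t) * inverse_stable \<gamma> \<theta> t)) \<partial>lborel)"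
      by (intro nn_integral_cmult) measurable
    also have "(\<integral>\<^sup>+t. ennreal (indicator {0<..} t * (exp (- t) * inverse_stable \<gamma> \<theta> t)) \<partial>lborel) = ennreal (exp (- \<theta>))"
      using hb nn by (subst nn_integral_eq_integral) (auto simp: has_bochner_integral_iff)
    finally show ?thesis using True by (simp flip: ennreal_mult)
  qed simp
  have inner2: "(\<integral>\<^sup>+\<theta>. ?F \<theta> t \<partial>lborel) = ennreal (indicator {0..} t * t powr (\<gamma> * n + 1 - 1) / exp t) * ?M" for t
  proof (cases "t > 0")
    case True
    have "(\<integral>\<^sup>+\<theta>. ?F \<theta> t \<partial>lborel) = ennreal \<bar>t powr \<gamma>\<bar> * (\<integral>\<^sup>+\<theta>. ?F (0 + t powr \<gamma> * \<theta>) t \<partial>lborel)"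
      using True by (intro nn_integral_real_affine) auto
    also have "(\<integral>\<^sup>+\<theta>. ?F (0 + t powr \<gamma> * \<theta>) t \<partial>lborel) = (\<integral>\<^sup>+\<theta>. ennreal (exp (- t) * t powr (-\<gamma>) * (t powr \<gamma>) ^ n) * ennreal (indicator {0<..} \<theta> * (\<theta> ^ n * mainardi \<gamma> \<theta>)) \<partial>lborel)"
    proof (rule nn_integral_cong)
      fix \<theta> :: real
      have "t powr \<gamma> * \<theta> * t powr (-\<gamma>) = \<theta>" using True by (simp add: powr_minus field_simps)
      thus "?F (0 + t powr \<gamma> * \<theta>) t = ennreal (exp (- t) * t powr (-\<gamma>) * (t powr \<gamma>) ^ n) * ennreal (indicator {0<..} \<theta> * (\<theta> ^ n * mainardi \<gamma> \<theta>))"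
        using True mainardi_nonneg[OF g, of \<theta>]
        by (auto simp: indicator_def zero_less_mult_iff power_mult_distrib mult_ac simp flip: ennreal_mult)
    qed
    also have "\<dots> = ennreal (exp (- t) * t powr (-\<gamma>) * (t powr \<gamma>) ^ n) * ?M" by (intro nn_integral_cmult) measurable
    also have "ennreal \<bar>t powr \<gamma>\<bar> * (ennreal (exp (- t) * t powr (-\<gamma>) * (t powr \<gamma>) ^ n) * ?M) = ennreal (t powr \<gamma> * (exp (- t) * t powr (-\<gamma>) * (t powr \<gamma>) ^ n)) * ?M"
      by (simp add: ennreal_mult mult.assoc)
    also have "t powr \<gamma> * (exp (- t) * t powr (-\<gamma>) * (t powr \<gamma>) ^ n) = indicator {0..} t * t powr (\<gamma> * n + 1 - 1) / exp t"
      using True by (simp add: powr_minus exp_minus powr_realpow[symmetric] powr_powr field_simps)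
    finally show ?thesis .
  next
    case False
    hence "indicator {0..} t * t powr (\<gamma> * n + 1 - 1) / exp t = 0" by (auto simp: indicator_def)
    with False show ?thesis by simp
  qed
  have "ennreal (fact n) = (\<integral>\<^sup>+\<theta>. \<integral>\<^sup>+t. ?F \<theta> t \<partial>lborel \<partial>lborel)"
    unfolding inner1 nn_integral_power_exp ..
  also have "\<dots> = (\<integral>\<^sup>+t. \<integral>\<^sup>+\<theta>. ?F \<theta> t \<partial>lborel \<partial>lborel)"
    by (intro lborel_pair.Fubini') measurable
  also have "\<dots> = (\<integral>\<^sup>+t. ennreal (indicator {0..} t * t powr (\<gamma> * n + 1 - 1) / exp t) \<partial>lborel) * ?M"
    unfolding inner2 by (intro nn_integral_multc) measurable
  also have "\<dots> = ennreal (Gamma (\<gamma> * n + 1)) * ?M"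
    using g by (subst Gamma_conv_nn_integral_real) (auto intro: add_nonneg_pos)
  finally have eq: "ennreal (fact n) = ennreal (Gamma (\<gamma> * n + 1)) * ?M" .
  have G: "Gamma (\<gamma> * n + 1) > 0" using g by (intro Gamma_real_pos) (auto intro: add_nonneg_pos)
  have "ennreal (fact n / Gamma (\<gamma> * n + 1)) = ennreal (fact n) / ennreal (Gamma (\<gamma> * n + 1))"
    using G by (simp add: divide_ennreal)
  also have "\<dots> = ?M" unfolding eq mult.commute[of "ennreal (Gamma _)"] using G by (intro ennreal_mult_divide_eq) auto
  finally show ?thesis by simp
qed

lemma mainardi_moment:
  assumes g: "0 < \<gamma>" "\<gamma> < 1"
  shows "has_bochner_integral lborel (\<lambda>\<theta>. indicator {0<..} \<theta> * (\<theta> ^ n * mainardi \<gamma> \<theta>)) (fact n / Gamma (\<gamma> * n + 1))"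
proof (rule has_bochner_integral_nn_integral)
  have "Gamma (\<gamma> * n + 1) > 0" using g by (intro Gamma_real_pos) (auto intro: add_nonneg_pos)
  thus "0 \<le> fact n / Gamma (\<gamma> * n + 1)" by simp
  show "AE \<theta> in lborel. 0 \<le> indicator {0<..} \<theta> * (\<theta> ^ n * mainardi \<gamma> \<theta>)"
    using mainardi_nonneg[OF g] by (intro AE_I2) (auto simp: indicator_def)
qed (use mainardi_moment_nn[OF g] in auto)

text \<open>Euler's integral restricted to [R, R + 1]. As R is arbitrary, Gamma outgrows every
  exponential, which is all that the Mittag-Leffler series requires.\<close>

lemma Gamma_ge:
  assumes R: "R \<ge> 1" and s: "s > (0::real)"
  shows "Gamma s \<ge> exp (- (R + 1)) / (R + 1) * R powr s"
proof -
  have "ennreal (exp (- (R + 1)) / (R + 1) * R powr s) = (\<integral>\<^sup>+t. ennreal (exp (- (R + 1)) / (R + 1) * R powr s) * indicator {R..R+1} t \<partial>lborel)"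
    by (simp add: nn_integral_cmult_indicator)
  also have "\<dots> \<le> (\<integral>\<^sup>+t. ennreal (indicator {0..} t * t powr (s - 1) / exp t) \<partial>lborel)"
  proof (rule nn_integral_mono)
    fix t :: real
    have "exp (- (R + 1)) / (R + 1) * R powr s \<le> t powr (s - 1) / exp t" if t: "R \<le> t" "t \<le> R + 1"
    proof -
      have "exp (- (R + 1)) / (R + 1) * R powr s \<le> exp (- t) / t * t powr s"
        using t R s by (intro mult_mono frac_le powr_mono2) auto
      also have "\<dots> = t powr (s - 1) / exp t" using t R by (simp add: powr_diff exp_minus field_simps)
      finally show ?thesis .
    qed
    thus "ennreal (exp (- (R + 1)) / (R + 1) * R powr s) * indicator {R..R+1} t \<le> ennreal (indicator {0..} t * t powr (s - 1) / exp t)"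
      using R by (auto simp: indicator_def intro!: ennreal_leI)
  qed
  also have "\<dots> = ennreal (Gamma s)" by (rule Gamma_conv_nn_integral_real[OF s, symmetric])
  finally show ?thesis using Gamma_real_pos[OF s] by (subst (asm) ennreal_le_iff) auto
qed

lemma summable_mittag_leffler:
  fixes \<gamma> b x :: real
  assumes g: "\<gamma> > 0" and b: "b > 0" and x: "x \<ge> 0"
  shows "summable (\<lambda>n. x ^ n / Gamma (\<gamma> * n + b))"
proof -
  \<comment> \<open>Chosen with x <= R^\<gamma> / 2, so that the comparison is with a geometric
    series of ratio 1/2.\<close>
  define R where "R = max 1 ((2 * x) powr (1 / \<gamma>))"
  have R: "R \<ge> 1" by (simp add: R_def)
  have xR: "x \<le> R powr \<gamma> / 2"
  proof (cases "x = 0")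
    case False
    have "2 * x = ((2 * x) powr (1 / \<gamma>)) powr \<gamma>" using g x False by (simp add: powr_powr)
    also have "\<dots> \<le> R powr \<gamma>" using g by (intro powr_mono2) (auto simp: R_def)
    finally show ?thesis by simp
  qed simp
  show ?thesis
  proof (rule summable_comparison_test')
    show "summable (\<lambda>n. (exp (R + 1) * (R + 1)) * (1 / 2) ^ n)"
      by (intro summable_mult summable_geometric) auto
    fix n :: nat assume "n \<ge> 0"
    have gn: "\<gamma> * n + b > 0" using g b by (intro add_nonneg_pos) auto
    have "(R powr \<gamma>) ^ n = R powr (\<gamma> * n)" using R by (simp add: powr_realpow[symmetric] powr_powr)
    also have "\<dots> \<le> R powr (\<gamma> * n + b)" using R b by (intro powr_mono) auto
    finally have "exp (- (R + 1)) / (R + 1) * (R powr \<gamma>) ^ n \<le> exp (- (R + 1)) / (R + 1) * R powr (\<gamma> * n + b)"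
      using R by (intro mult_left_mono) auto
    also have "\<dots> \<le> Gamma (\<gamma> * n + b)" by (rule Gamma_ge[OF R gn])
    finally have G: "exp (- (R + 1)) / (R + 1) * (R powr \<gamma>) ^ n \<le> Gamma (\<gamma> * n + b)" .
    have "x ^ n / Gamma (\<gamma> * n + b) \<le> (R powr \<gamma> / 2) ^ n / (exp (- (R + 1)) / (R + 1) * (R powr \<gamma>) ^ n)"
      using R xR x G by (intro frac_le power_mono) auto
    also have "\<dots> = (exp (R + 1) * (R + 1)) * (1 / 2) ^ n"
      unfolding exp_minus using R by (simp add: power_divide field_simps)
    finally show "norm (x ^ n / Gamma (\<gamma> * n + b)) \<le> (exp (R + 1) * (R + 1)) * (1 / 2) ^ n"
      using x Gamma_real_pos[OF gn] by simp
  qed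
qed

text \<open>\<open>resolvent \<gamma> 1 t\<close> is the Mittag-Leffler function \<open>E\<^sub>\<gamma>(- t\<^sup>\<gamma>)\<close>, and \<open>resolvent \<gamma> \<gamma> t\<close> is
  \<open>t\<^sup>\<gamma>\<^sup>-\<^sup>1 E\<^sub>\<gamma>\<^sub>,\<^sub>\<gamma>(- t\<^sup>\<gamma>)\<close>.\<close>

definition resolvent :: "real \<Rightarrow> real \<Rightarrow> real \<Rightarrow> real" where
  "resolvent \<gamma> b t = (\<Sum>n. (-1) ^ n * frac_kernel (\<gamma> * real n + b) t)"

lemma measurable_resolvent [measurable]: "resolvent \<gamma> b \<in> borel_measurable borel"
  unfolding resolvent_def by measurable

lemma resolvent_0 [simp]: "resolvent \<gamma> b 0 = 0"
  by (simp add: resolvent_def)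

lemma frac_kernel_series:
  assumes "t > 0"
  shows "frac_kernel (\<gamma> * real n + b) t = t powr (b - 1) * ((t powr \<gamma>) ^ n / Gamma (\<gamma> * real n + b))"
proof -
  have "t powr (\<gamma> * real n + b - 1) = t powr (b - 1) * (t powr \<gamma>) ^ n"
    using assms by (simp add: powr_realpow[symmetric] powr_powr powr_add[symmetric] algebra_simps)
  thus ?thesis by (simp add: frac_kernel_def)
qed

lemma summable_frac_kernel:
  assumes "\<gamma> > 0" "b > 0" "t \<ge> 0"
  shows "summable (\<lambda>n. frac_kernel (\<gamma> * real n + b) t)"
proof (cases "t = 0")
  case False
  thus ?thesis using assms unfolding frac_kernel_series[OF order.not_eq_order_implies_strict[OF False[symmetric] assms(3)]]
    by (intro summable_mult summable_mittag_leffler) auto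
qed simp

text \<open>The semigroup law I^a I^b = I^(a+b) of fractional integrals at the level of kernels,
  from the Beta integral scaled to [0,t].\<close>

lemma frac_kernel_conv:
  assumes a: "a > 0" and b: "b > 0" and t: "t > 0"
  shows "has_bochner_integral lborel (\<lambda>s. indicator {0..t} s * (frac_kernel a (t - s) * frac_kernel b s)) (frac_kernel (a + b) t)"
proof -
  define B where "B = (\<lambda>x::real. indicator {0..1} x * (x powr (b - 1) * (1 - x) powr (a - 1)))"
  have "integrable lborel B" "(LINT x|lborel. B x) = Beta b a"
    using integrable_Beta[OF b a] set_borel_integral_eq_integral(2)[OF integrable_Beta[OF b a]] has_integral_Beta_real[OF b a]
    by (auto simp: set_integrable_def set_lebesgue_integral_def B_def has_integral_iff)
  hence "has_bochner_integral lborel B (Beta b a)" by (simp add: has_bochner_integral_iff)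
  hence "has_bochner_integral lborel (\<lambda>s. B (0 + (1 / t) * s)) (Beta b a /\<^sub>R \<bar>1 / t\<bar>)"
    using t by (subst lborel_has_bochner_integral_real_affine_iff[symmetric]) auto
  hence "has_bochner_integral lborel (\<lambda>s. (t powr (a + b - 2) / (Gamma a * Gamma b)) * B (0 + (1 / t) * s)) ((t powr (a + b - 2) / (Gamma a * Gamma b)) * (Beta b a /\<^sub>R \<bar>1 / t\<bar>))"
    by (rule has_bochner_integral_mult_right)
  moreover have "(t powr (a + b - 2) / (Gamma a * Gamma b)) * B (0 + (1 / t) * s) = indicator {0..t} s * (frac_kernel a (t - s) * frac_kernel b s)" for s
  proof (cases "s \<in> {0..t}")
    case True
    have "1 - s / t = (t - s) / t" using t by (simp add: field_simps)
    hence "B (0 + (1 / t) * s) = (s powr (b - 1) / t powr (b - 1)) * ((t - s) powr (a - 1) / t powr (a - 1))"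
      using True t by (simp add: B_def powr_divide)
    moreover have "t powr (a + b - 2) = t powr (a - 1) * t powr (b - 1)" by (simp add: powr_add[symmetric])
    ultimately show ?thesis using True t by (simp add: frac_kernel_def)
  next
    case False
    hence "B (0 + (1 / t) * s) = 0" using t by (auto simp: B_def indicator_def field_simps)
    thus ?thesis using False by simp
  qed
  moreover have "(t powr (a + b - 2) / (Gamma a * Gamma b)) * (Beta b a /\<^sub>R \<bar>1 / t\<bar>) = frac_kernel (a + b) t"
  proof -
    have "t powr (a + b - 1) = t powr (a + b - 2) * t powr 1" by (simp only: powr_add[symmetric]) simp
    thus ?thesis using t Gamma_real_pos[OF a] Gamma_real_pos[OF b] by (simp add: frac_kernel_def Beta_def add.commute)
  qed
  ultimately show ?thesis by (simp only:)
qed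

text \<open>Convolution with \<open>frac_kernel \<gamma>\<close> raises each index \<gamma> n + b to
  \<gamma> (n + 1) + b. Up to sign it shifts the alternating series by one place, so only the term n
  = 0 is left over.\<close>

lemma resolvent_equation:
  assumes g: "\<gamma> > 0" and b: "b > 0" and t: "t > 0"
  shows "has_bochner_integral lborel (\<lambda>s. indicator {0..t} s * (frac_kernel \<gamma> (t - s) * resolvent \<gamma> b s))
           (frac_kernel b t - resolvent \<gamma> b t)"
proof -
  define f where "f = (\<lambda>n s. (-1) ^ n * (indicator {0..t} s * (frac_kernel \<gamma> (t - s) * frac_kernel (\<gamma> * real n + b) s)))"
  have gn: "\<gamma> * real n + b > 0" for n using g b by (intro add_nonneg_pos) auto
  have hb: "has_bochner_integral lborel (f n) ((-1) ^ n * frac_kernel (\<gamma> + (\<gamma> * real n + b)) t)" for n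
    unfolding f_def by (intro has_bochner_integral_mult_right frac_kernel_conv g gn t)
  have int: "integrable lborel (f n)" for n using hb by (auto simp: has_bochner_integral_iff)
  have nf: "norm (f n s) = indicator {0..t} s * (frac_kernel \<gamma> (t - s) * frac_kernel (\<gamma> * real n + b) s)" for n s
    using frac_kernel_nonneg[OF g] frac_kernel_nonneg[OF gn] by (simp add: f_def abs_mult)
  have snf: "summable (\<lambda>n. norm (f n s))" for s
    unfolding nf
  proof (cases "s \<in> {0..t}")
    case True
    thus "summable (\<lambda>n. indicator {0..t} s * (frac_kernel \<gamma> (t - s) * frac_kernel (\<gamma> * real n + b) s))"
      by (intro summable_mult summable_frac_kernel g b) auto
  qed simp
  have "(LINT s|lborel. norm (f n s)) = frac_kernel (\<gamma> * real n + (\<gamma> + b)) t" for n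
    unfolding nf using has_bochner_integral_integral_eq[OF frac_kernel_conv[OF g gn t]] by (simp add: algebra_simps)
  hence sint: "summable (\<lambda>n. (LINT s|lborel. norm (f n s)))"
    using summable_frac_kernel[OF g _ less_imp_le[OF t], of "\<gamma> + b"] g b by simp
  have S: "(\<Sum>n. f n s) = indicator {0..t} s * (frac_kernel \<gamma> (t - s) * resolvent \<gamma> b s)" for s
  proof (cases "s \<in> {0..t}")
    case True
    have "summable (\<lambda>n. (-1) ^ n * frac_kernel (\<gamma> * real n + b) s)"
      by (rule summable_norm_cancel) (use True frac_kernel_nonneg[OF gn] summable_frac_kernel[OF g b, of s] in \<open>simp add: abs_mult\<close>)
    from suminf_mult[OF this, of "frac_kernel \<gamma> (t - s)"] True show ?thesis
      by (simp add: f_def resolvent_def mult_ac)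
  qed (simp add: f_def)
  have ae: "AE s in lborel. summable (\<lambda>n. norm (f n s))" using snf by simp
  have 1: "integrable lborel (\<lambda>s. indicator {0..t} s * (frac_kernel \<gamma> (t - s) * resolvent \<gamma> b s))"
    using integrable_suminf[OF int ae sint] unfolding S .
  have "(\<lambda>n. LINT s|lborel. f n s) sums (LINT s|lborel. indicator {0..t} s * (frac_kernel \<gamma> (t - s) * resolvent \<gamma> b s))"
    using sums_integral[OF int ae sint] unfolding S .
  moreover have "(LINT s|lborel. f n s) = - ((-1) ^ Suc n * frac_kernel (\<gamma> * real (Suc n) + b) t)" for n
    using has_bochner_integral_integral_eq[OF hb[of n]] by (simp add: algebra_simps)
  ultimately have "(\<lambda>n. - ((-1) ^ Suc n * frac_kernel (\<gamma> * real (Suc n) + b) t)) sums (LINT s|lborel. indicator {0..t} s * (frac_kernel \<gamma> (t - s) * resolvent \<gamma> b s))"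
    by simp
  from sums_minus[OF this]
  have "(\<lambda>n. (-1) ^ Suc n * frac_kernel (\<gamma> * real (Suc n) + b) t) sums - (LINT s|lborel. indicator {0..t} s * (frac_kernel \<gamma> (t - s) * resolvent \<gamma> b s))"
    by simp
  hence "(\<lambda>n. (-1) ^ n * frac_kernel (\<gamma> * real n + b) t) sums (- (LINT s|lborel. indicator {0..t} s * (frac_kernel \<gamma> (t - s) * resolvent \<gamma> b s)) + frac_kernel b t)"
    by (subst (asm) sums_Suc_iff) simp
  hence "resolvent \<gamma> b t = - (LINT s|lborel. indicator {0..t} s * (frac_kernel \<gamma> (t - s) * resolvent \<gamma> b s)) + frac_kernel b t"
    unfolding resolvent_def by (rule sums_unique[symmetric])
  with 1 show ?thesis by (simp add: has_bochner_integral_iff)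
qed

text \<open>The functional equation of Gamma at \<gamma> n + \<gamma>. Through it the extra factor
  \<theta> in \<open>S_op\<close> turns the coefficients of \<open>E\<^sub>\<gamma>\<close> into
  those of \<open>E\<^sub>\<gamma>\<^sub>,\<^sub>\<gamma>\<close>.\<close>

lemma fact_Gamma_quotient:
  fixes \<gamma> :: real
  assumes "\<gamma> > 0"
  shows "\<gamma> * (fact (n + 1) / fact n / Gamma (\<gamma> * real (n + 1) + 1)) = 1 / Gamma (\<gamma> * n + \<gamma>)"
proof -
  have gn: "\<gamma> * n + \<gamma> > 0" using assms by (intro add_nonneg_pos) auto
  have "\<gamma> * real (n + 1) + 1 = (\<gamma> * n + \<gamma>) + 1" by (simp add: algebra_simps)
  hence "Gamma (\<gamma> * real (n + 1) + 1) = (\<gamma> * n + \<gamma>) * Gamma (\<gamma> * n + \<gamma>)"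
    using Gamma_plus1[OF pos_notin_nonpos_Ints[OF gn]] by simp
  also have "\<gamma> * n + \<gamma> = \<gamma> * (real n + 1)" by (simp add: algebra_simps)
  finally have "Gamma (\<gamma> * real (n + 1) + 1) = \<gamma> * (real n + 1) * Gamma (\<gamma> * n + \<gamma>)" by (simp add: algebra_simps)
  moreover have "fact (n + 1) / fact n = real n + 1" by simp
  moreover have "real n + 1 \<noteq> 0" by simp
  ultimately show ?thesis using assms by (simp only:) (simp add: divide_simps)
qed

text \<open>Expand the exponential and insert the moments. The powers j = 0 and j = 1 are those
  occurring in \<open>P_op\<close> and \<open>S_op\<close>; for each, the series of L1 norms is a
  Mittag-Leffler series at a nonnegative argument.\<close>

lemma mainardi_exp_integral:
  assumes g: "0 < \<gamma>" "\<gamma> < 1" and x: "x \<ge> 0" and j: "j = 0 \<or> j = 1"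
  shows "has_bochner_integral lborel (\<lambda>\<theta>. indicator {0<..} \<theta> * (\<theta> ^ j * mainardi \<gamma> \<theta> * exp (- (x * \<theta>))))
           (\<Sum>n. (-x) ^ n * (fact (n + j) / fact n / Gamma (\<gamma> * (n + j) + 1)))"
proof -
  define f where "f = (\<lambda>n \<theta>. (-x) ^ n / fact n * (indicator {0<..} \<theta> * (\<theta> ^ (n + j) * mainardi \<gamma> \<theta>)))"
  have hb: "has_bochner_integral lborel (f n) ((-x) ^ n / fact n * (fact (n + j) / Gamma (\<gamma> * real (n + j) + 1)))" for n
    unfolding f_def by (intro has_bochner_integral_mult_right mainardi_moment g)
  have int: "integrable lborel (f n)" for n using hb by (auto simp: has_bochner_integral_iff)
  have nf: "norm (f n \<theta>) = x ^ n / fact n * (indicator {0<..} \<theta> * (\<theta> ^ (n + j) * mainardi \<gamma> \<theta>))" for n \<theta>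
    using x mainardi_nonneg[OF g, of \<theta>] by (auto simp: f_def abs_mult power_abs indicator_def)
  have es: "(\<lambda>n. (c * y ^ n / fact n)) sums (c * exp y)" for c y :: real
    using sums_mult[OF exp_converges[of y], of c] by (simp add: divide_inverse mult_ac)
  have snf: "summable (\<lambda>n. norm (f n \<theta>))" for \<theta>
  proof -
    have "norm (f n \<theta>) = (indicator {0<..} \<theta> * \<theta> ^ j * mainardi \<gamma> \<theta>) * (x * \<theta>) ^ n / fact n" for n
      unfolding nf by (simp add: power_add power_mult_distrib mult_ac)
    thus ?thesis using sums_summable[OF es] by simp
  qed
  have S: "(\<Sum>n. f n \<theta>) = indicator {0<..} \<theta> * (\<theta> ^ j * mainardi \<gamma> \<theta> * exp (- (x * \<theta>)))" for \<theta>
  proof -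
    have "f n \<theta> = (indicator {0<..} \<theta> * \<theta> ^ j * mainardi \<gamma> \<theta>) * (- (x * \<theta>)) ^ n / fact n" for n
      unfolding f_def mult_minus_left[symmetric] by (simp only: power_add power_mult_distrib) (simp add: mult_ac)
    hence "(\<Sum>n. f n \<theta>) = (indicator {0<..} \<theta> * \<theta> ^ j * mainardi \<gamma> \<theta>) * exp (- (x * \<theta>))"
      by (simp only:) (rule sums_unique[OF es, symmetric])
    thus ?thesis by (simp only: mult_ac)
  qed
  have "(LINT \<theta>|lborel. norm (f n \<theta>)) = x ^ n * (fact (n + j) / fact n / Gamma (\<gamma> * real (n + j) + 1))" for n
    unfolding nf using has_bochner_integral_integral_eq[OF mainardi_moment[OF g]] by simp
  moreover have "summable (\<lambda>n. x ^ n * (fact (n + j) / fact n / Gamma (\<gamma> * real (n + j) + 1)))"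
  proof (cases "j = 0")
    case True
    thus ?thesis using summable_mittag_leffler[OF g(1) zero_less_one x] by simp
  next
    case False
    hence j1: "j = 1" using j by simp
    have "x ^ n * (fact (n + j) / fact n / Gamma (\<gamma> * real (n + j) + 1)) = (1 / \<gamma>) * (x ^ n / Gamma (\<gamma> * n + \<gamma>))" for n
    proof -
      have "x ^ n * (fact (n + j) / fact n / Gamma (\<gamma> * real (n + j) + 1)) = (1 / \<gamma>) * (x ^ n * (\<gamma> * (fact (n + 1) / fact n / Gamma (\<gamma> * real (n + 1) + 1))))"
        using g by (simp add: j1 del: fact_Suc)
      also have "\<dots> = (1 / \<gamma>) * (x ^ n / Gamma (\<gamma> * n + \<gamma>))"
        unfolding fact_Gamma_quotient[OF g(1)] by simp
      finally show ?thesis .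
    qed
    thus ?thesis by (simp only:) (intro summable_mult summable_mittag_leffler g x)
  qed
  ultimately have sint: "summable (\<lambda>n. (LINT \<theta>|lborel. norm (f n \<theta>)))" by simp
  have ae: "AE s in lborel. summable (\<lambda>n. norm (f n s))" using snf by simp
  have 1: "integrable lborel (\<lambda>\<theta>. indicator {0<..} \<theta> * (\<theta> ^ j * mainardi \<gamma> \<theta> * exp (- (x * \<theta>))))"
    using integrable_suminf[OF int ae sint] unfolding S .
  have "(\<lambda>n. LINT s|lborel. f n s) sums (LINT \<theta>|lborel. indicator {0<..} \<theta> * (\<theta> ^ j * mainardi \<gamma> \<theta> * exp (- (x * \<theta>))))"
    using sums_integral[OF int ae sint] unfolding S .
  moreover have "(LINT s|lborel. f n s) = (-x) ^ n * (fact (n + j) / fact n / Gamma (\<gamma> * real (n + j) + 1))" for n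
    using has_bochner_integral_integral_eq[OF hb[of n]] by simp
  ultimately have "(LINT \<theta>|lborel. indicator {0<..} \<theta> * (\<theta> ^ j * mainardi \<gamma> \<theta> * exp (- (x * \<theta>)))) = (\<Sum>n. (-x) ^ n * (fact (n + j) / fact n / Gamma (\<gamma> * (n + j) + 1)))"
    by (simp add: sums_iff)
  with 1 show ?thesis by (simp add: has_bochner_integral_iff)
qed

text \<open>The scalar model of \<open>P_op\<close>: the heat semigroup at time s is replaced by the
  number exp(-s).\<close>

lemma resolvent_one_eq:
  assumes g: "0 < \<gamma>" "\<gamma> < 1" and t: "t > 0"
  shows "has_bochner_integral lborel (\<lambda>\<theta>. indicator {0<..} \<theta> * (mainardi \<gamma> \<theta> * exp (- (t powr \<gamma> * \<theta>)))) (resolvent \<gamma> 1 t)"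
proof -
  have "(- (t powr \<gamma>)) ^ n * (fact (n + 0) / fact n / Gamma (\<gamma> * (n + 0) + 1)) = (-1) ^ n * frac_kernel (\<gamma> * real n + 1) t" for n
    unfolding frac_kernel_series[OF t] using t by (subst power_minus) simp
  thus ?thesis using mainardi_exp_integral[OF g, of "t powr \<gamma>" 0] by (simp add: resolvent_def)
qed

text \<open>The scalar model of the Duhamel kernel t^(\<gamma>-1) \<open>S_op\<close>, again with
  exp(-s) in place of the heat semigroup.\<close>

lemma resolvent_gamma_eq:
  assumes g: "0 < \<gamma>" "\<gamma> < 1" and t: "t > 0"
  shows "has_bochner_integral lborel (\<lambda>\<theta>. \<gamma> * t powr (\<gamma> - 1) * (indicator {0<..} \<theta> * (\<theta> * mainardi \<gamma> \<theta> * exp (- (t powr \<gamma> * \<theta>))))) (resolvent \<gamma> \<gamma> t)"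
proof -
  define f where "f = (\<lambda>n. (- (t powr \<gamma>)) ^ n * (fact (n + 1) / fact n / Gamma (\<gamma> * (n + 1) + 1)))"
  have s: "summable f" and eq: "\<gamma> * t powr (\<gamma> - 1) * f n = (-1) ^ n * frac_kernel (\<gamma> * real n + \<gamma>) t" for n
  proof -
    show eq: "\<gamma> * t powr (\<gamma> - 1) * f n = (-1) ^ n * frac_kernel (\<gamma> * real n + \<gamma>) t" for n
    proof -
      have "\<gamma> * (fact (n + 1) / fact n / Gamma (\<gamma> * (n + 1) + 1)) = 1 / Gamma (\<gamma> * n + \<gamma>)"
        by (rule fact_Gamma_quotient[OF g(1)])
      moreover have "\<gamma> * t powr (\<gamma> - 1) * f n = t powr (\<gamma> - 1) * ((- (t powr \<gamma>)) ^ n * (\<gamma> * (fact (n + 1) / fact n / Gamma (\<gamma> * (n + 1) + 1))))"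
        unfolding f_def by (simp only: mult_ac)
      ultimately have "\<gamma> * t powr (\<gamma> - 1) * f n = t powr (\<gamma> - 1) * ((- (t powr \<gamma>)) ^ n * (1 / Gamma (\<gamma> * n + \<gamma>)))"
        by (simp only:)
      also have "(- (t powr \<gamma>)) ^ n = (-1) ^ n * (t powr \<gamma>) ^ n" by (rule power_minus)
      finally show ?thesis unfolding frac_kernel_series[OF t] by simp
    qed
    have gn: "\<gamma> * real n + \<gamma> > 0" for n using g by (intro add_nonneg_pos) auto
    have "summable (\<lambda>n. (-1) ^ n * frac_kernel (\<gamma> * real n + \<gamma>) t)"
      by (rule summable_norm_cancel)
         (use frac_kernel_nonneg[OF gn] summable_frac_kernel[OF g(1) g(1) less_imp_le[OF t]] in \<open>simp add: abs_mult\<close>)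
    from summable_mult[OF this, of "1 / (\<gamma> * t powr (\<gamma> - 1))"]
    show "summable f" unfolding eq[symmetric] using g t by simp
  qed
  have "has_bochner_integral lborel (\<lambda>\<theta>. \<gamma> * t powr (\<gamma> - 1) * (indicator {0<..} \<theta> * (\<theta> ^ 1 * mainardi \<gamma> \<theta> * exp (- (t powr \<gamma> * \<theta>))))) (\<gamma> * t powr (\<gamma> - 1) * suminf f)"
    unfolding f_def by (intro has_bochner_integral_mult_right mainardi_exp_integral g) auto
  also have "\<gamma> * t powr (\<gamma> - 1) * suminf f = resolvent \<gamma> \<gamma> t"
    unfolding suminf_mult[OF s, symmetric] eq resolvent_def ..
  finally show ?thesis by simp
qed

text \<open>Invisible in the alternating series; it follows from the representation as an average of
  exponentials over the nonnegative Mainardi function.\<close>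

lemma resolvent_nonneg:
  assumes g: "0 < \<gamma>" "\<gamma> < 1" and b: "b = 1 \<or> b = \<gamma>" and t: "t \<ge> 0"
  shows "resolvent \<gamma> b t \<ge> 0"
proof (cases "t = 0")
  case False
  with t have t: "t > 0" by simp
  have m: "indicator {0<..} \<theta> * (\<theta> ^ j * mainardi \<gamma> \<theta> * exp (- (t powr \<gamma> * \<theta>))) \<ge> 0" for \<theta> j
    using mainardi_nonneg[OF g, of \<theta>] by (auto simp: indicator_def)
  have "resolvent \<gamma> 1 t \<ge> 0"
    using has_bochner_integral_integral_eq[OF resolvent_one_eq[OF g t]] m[of _ 0]
    by (metis (no_types, lifting) Bochner_Integration.integral_nonneg mult_1 power_0)
  moreover have "resolvent \<gamma> \<gamma> t \<ge> 0"
    unfolding has_bochner_integral_integral_eq[OF resolvent_gamma_eq[OF g t], symmetric]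
    using g by (intro Bochner_Integration.integral_nonneg mult_nonneg_nonneg[OF _ m[of _ 1, simplified]]) simp
  ultimately show ?thesis using b by auto
qed simp

section \<open>The heat semigroup and the weight\<close>

lemma nn_integral_gaussian_real:
  assumes a: "a > 0"
  shows "(\<integral>\<^sup>+x. ennreal (exp (- a * x\<^sup>2)) \<partial>lborel) = ennreal (sqrt (pi / a))"
proof -
  define \<sigma> where "\<sigma> = sqrt (1 / (2 * a))"
  have s: "\<sigma> > 0" "\<sigma>\<^sup>2 = 1 / (2 * a)" using a by (auto simp: \<sigma>_def)
  have eq: "exp (- a * x\<^sup>2) = sqrt (pi / a) * normal_density 0 \<sigma> x" for x
    using a by (simp add: normal_density_def s(2) real_sqrt_divide field_simps)
  have "(\<integral>\<^sup>+x. ennreal (exp (- a * x\<^sup>2)) \<partial>lborel) = ennreal (LINT x|lborel. sqrt (pi / a) * normal_density 0 \<sigma> x)"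
    unfolding eq using a s by (intro nn_integral_eq_integral) auto
  also have "(LINT x|lborel. sqrt (pi / a) * normal_density 0 \<sigma> x) = sqrt (pi / a)"
    using s by simp
  finally show ?thesis .
qed

lemma nn_integral_gaussian:
  assumes a: "a > 0"
  shows "(\<integral>\<^sup>+(x::'a::euclidean_space). ennreal (exp (- a * (norm x)\<^sup>2)) \<partial>lborel) = ennreal ((pi / a) powr (real DIM('a) / 2))"
proof -
  have "(\<integral>\<^sup>+(x::'a). ennreal (exp (- a * (norm x)\<^sup>2)) \<partial>lborel) = (\<integral>\<^sup>+(x::'a). (\<Prod>b\<in>Basis. ennreal (exp (- a * (x \<bullet> b)\<^sup>2))) \<partial>lborel)"
  proof (rule nn_integral_cong)
    fix x :: 'a
    have "(norm x)\<^sup>2 = (\<Sum>b\<in>Basis. (x \<bullet> b)\<^sup>2)"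
      unfolding power2_norm_eq_inner by (subst euclidean_inner) (simp add: power2_eq_square)
    thus "ennreal (exp (- a * (norm x)\<^sup>2)) = (\<Prod>b\<in>Basis. ennreal (exp (- a * (x \<bullet> b)\<^sup>2)))"
      by (simp add: prod_ennreal sum_distrib_left exp_sum[symmetric] sum_negf)
  qed
  also have "\<dots> = (\<Prod>b\<in>(Basis::'a set). \<integral>\<^sup>+x. ennreal (exp (- a * x\<^sup>2)) \<partial>lborel)"
    by (rule nn_integral_lborel_prod) auto
  also have "\<dots> = (\<Prod>b\<in>(Basis::'a set). ennreal (sqrt (pi / a)))"
    unfolding nn_integral_gaussian_real[OF a] ..
  also have "\<dots> = ennreal (sqrt (pi / a) ^ DIM('a))" using a by (subst prod_ennreal) auto
  also have "sqrt (pi / a) ^ DIM('a) = (pi / a) powr (real DIM('a) / 2)"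
    using a by (simp add: powr_half_sqrt[symmetric] powr_realpow[symmetric] powr_powr)
  finally show ?thesis .
qed

lemma nn_integral_lborel_translate:
  fixes f :: "'a::euclidean_space \<Rightarrow> ennreal"
  assumes [measurable]: "f \<in> borel_measurable borel"
  shows "(\<integral>\<^sup>+x. f x \<partial>lborel) = (\<integral>\<^sup>+x. f (c + x) \<partial>lborel)"
proof -
  have "(\<integral>\<^sup>+x. f x \<partial>lborel) = (\<integral>\<^sup>+x. f x \<partial>distr lborel borel ((+) c))" by (simp add: lborel_distr_plus)
  also have "\<dots> = (\<integral>\<^sup>+x. f (c + x) \<partial>lborel)" by (rule nn_integral_distr) auto
  finally show ?thesis .
qed

lemma nn_integral_lborel_uminus:
  fixes f :: "'a::euclidean_space \<Rightarrow> ennreal"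
  assumes [measurable]: "f \<in> borel_measurable borel"
  shows "(\<integral>\<^sup>+x. f x \<partial>lborel) = (\<integral>\<^sup>+x. f (- x) \<partial>lborel)"
proof -
  have "(lborel :: 'a measure) = distr lborel borel (\<lambda>x. - x)"
    using lborel_affine[of "-1" "0::'a"] by (simp add: density_1 one_ennreal_def[symmetric])
  hence "(\<integral>\<^sup>+x. f x \<partial>lborel) = (\<integral>\<^sup>+x. f x \<partial>distr lborel borel (\<lambda>x. - x))" by simp
  also have "\<dots> = (\<integral>\<^sup>+x. f (- x) \<partial>lborel)" by (rule nn_integral_distr) auto
  finally show ?thesis .
qed

lemma measurable_heat_kernel [measurable]:
  "(\<lambda>(t, x). heat_kernel t x) \<in> borel_measurable (borel \<Otimes>\<^sub>M borel)"
  unfolding heat_kernel_def by measurable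

text \<open>Values in \<open>ennreal\<close>, so that Tonelli and monotonicity apply before the
  integrability of \<open>chi\<close> is established.\<close>

abbreviation chi_mass :: "('a::euclidean_space \<Rightarrow> real) \<Rightarrow> ennreal" where
  "chi_mass w \<equiv> \<integral>\<^sup>+x. ennreal (w x * chi x) \<partial>lborel"

lemma measurable_chi [measurable]: "chi \<in> borel_measurable borel"
  unfolding chi_def by measurable

lemma heat_kernel_nonneg: "heat_kernel s x \<ge> 0"
  by (simp add: heat_kernel_def)

lemma heat_kernel_minus: "heat_kernel s (- x) = heat_kernel s x"
  by (simp add: heat_kernel_def)

lemma nn_integral_heat_kernel:
  assumes "s > 0"
  shows "(\<integral>\<^sup>+(y::'a::euclidean_space). ennreal (heat_kernel s (x - y)) \<partial>lborel) = 1"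
proof -
  have "(\<integral>\<^sup>+(y::'a). ennreal (heat_kernel s (x - y)) \<partial>lborel) = (\<integral>\<^sup>+(y::'a). ennreal (heat_kernel s (x - (x + y))) \<partial>lborel)"
    by (rule nn_integral_lborel_translate) measurable
  also have "\<dots> = (\<integral>\<^sup>+(y::'a). ennreal ((4 * pi * s) powr (- real DIM('a) / 2)) * ennreal (exp (- (1 / (4 * s)) * (norm y)\<^sup>2)) \<partial>lborel)"
    by (intro nn_integral_cong) (simp add: heat_kernel_def ennreal_mult[symmetric])
  also have "\<dots> = ennreal ((4 * pi * s) powr (- real DIM('a) / 2)) * (\<integral>\<^sup>+(y::'a). ennreal (exp (- (1 / (4 * s)) * (norm y)\<^sup>2)) \<partial>lborel)"
    by (rule nn_integral_cmult) measurable
  also have "\<dots> = ennreal ((4 * pi * s) powr (- real DIM('a) / 2) * (4 * pi * s) powr (real DIM('a) / 2))"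
    using assms by (subst nn_integral_gaussian) (auto simp: ennreal_mult mult_ac)
  also have "(4 * pi * s) powr (- real DIM('a) / 2) * (4 * pi * s) powr (real DIM('a) / 2) = 1"
    using assms by (simp add: powr_add[symmetric])
  finally show ?thesis by simp
qed

text \<open>The tangent of the concave square root at r^2, in the form 2 r sqrt B <= r^2 + B. It
  bounds chi y from below by chi x times a Gaussian in y, for which the heat integral is explicit. A
  vanishing normalising integral does no harm, since division by 0 gives 0.\<close>

lemma chi_ge:
  fixes x y :: "'a::euclidean_space"
  defines "r \<equiv> sqrt ((real DIM('a))\<^sup>2 + (norm x)\<^sup>2)"
  shows "chi x * exp (- (((norm y)\<^sup>2 - (norm x)\<^sup>2) / (2 * r))) \<le> chi y"
proof -
  have N: "real DIM('a) > 0" by simp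
  have rr: "(real DIM('a))\<^sup>2 + (norm x)\<^sup>2 > 0" using N by (simp add: add_pos_nonneg)
  hence r: "r > 0" "r\<^sup>2 = (real DIM('a))\<^sup>2 + (norm x)\<^sup>2" by (auto simp: r_def)
  define B where "B = (real DIM('a))\<^sup>2 + (norm y)\<^sup>2"
  have B: "B \<ge> 0" by (simp add: B_def)
  have "0 \<le> (r - sqrt B)\<^sup>2" by simp
  hence "2 * r * sqrt B \<le> r\<^sup>2 + B" using B by (simp add: power2_diff)
  hence "sqrt B \<le> (r\<^sup>2 + B) / (2 * r)" using r by (simp add: field_simps)
  also have "\<dots> = r + ((norm y)\<^sup>2 - (norm x)\<^sup>2) / (2 * r)"
    using r by (simp add: B_def field_simps power2_eq_square)
  finally have "exp (- r) * exp (- (((norm y)\<^sup>2 - (norm x)\<^sup>2) / (2 * r))) \<le> exp (- sqrt B)"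
    by (simp flip: exp_add)
  hence "exp (- r) * exp (- (((norm y)\<^sup>2 - (norm x)\<^sup>2) / (2 * r))) / (\<integral>y. exp (- sqrt ((real DIM('a))^2 + (norm (y::'a))^2)) \<partial>lborel)
     \<le> exp (- sqrt B) / (\<integral>y. exp (- sqrt ((real DIM('a))^2 + (norm (y::'a))^2)) \<partial>lborel)"
    by (intro divide_right_mono) auto
  thus ?thesis by (simp add: chi_def r_def B_def)
qed

lemma chi_nonneg: "chi x \<ge> 0"
  by (simp add: chi_def)

text \<open>The pointwise Jensen inequality \<open>chi_ge\<close>, whose linear term is odd in \<open>y - x\<close>, replaces
  the differential inequality \<open>\<Delta>\<chi> \<ge> - \<chi>\<close>.\<close>

lemma heat_kernel_chi_ge:
  fixes x :: "'a::euclidean_space"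
  assumes s: "s > 0"
  shows "(\<integral>\<^sup>+y. ennreal (heat_kernel s (x - y) * chi y) \<partial>lborel) \<ge> ennreal (exp (- s) * chi x)"
proof -
  define N where "N = real DIM('a)"
  have N: "N > 0" by (simp add: N_def)
  define r where "r = sqrt (N\<^sup>2 + (norm x)\<^sup>2)"
  \<comment> \<open>The bound r >= N is what the summand N^2 in \<open>chi\<close> is for: it makes
    the rate N / r below at most 1.\<close>
  have "sqrt (N\<^sup>2) \<le> r" unfolding r_def by (intro real_sqrt_le_mono) auto
  hence rN: "r \<ge> N" using N by simp
  hence r: "r > 0" using N by linarith
  \<comment> \<open>With y = x + z, \<open>F\<close> is the heat kernel times the lower bound for
    chi y relative to chi x, and \<open>G\<close> drops the term linear in z.\<close>
  define F where "F = (\<lambda>z. heat_kernel s z * exp (- ((2 * (x \<bullet> z) + (norm z)\<^sup>2) / (2 * r))))"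
  define G where "G = (\<lambda>z::'a. heat_kernel s z * exp (- ((norm z)\<^sup>2 / (2 * r))))"
  have [measurable]: "F \<in> borel_measurable borel" "G \<in> borel_measurable borel"
    unfolding F_def G_def by measurable
  \<comment> \<open>Pairing z with -z turns the linear term into c + 1/c >= 2, so it can only
    help.\<close>
  have FG: "2 * G z \<le> F z + F (- z)" for z
  proof -
    define c where "c = exp (- (x \<bullet> z) / r)"
    have c: "c > 0" by (simp add: c_def)
    have "F z = G z * c" unfolding F_def G_def c_def mult.assoc exp_add[symmetric]
      using r by (simp add: field_simps)
    moreover have "F (- z) = G z * (1 / c)" unfolding F_def G_def c_def mult.assoc exp_minus[symmetric] inverse_eq_divide[symmetric] exp_add[symmetric] heat_kernel_minus
      using r by (simp add: field_simps)
    moreover have "2 \<le> c + 1 / c"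
    proof -
      have "0 \<le> (c - 1)\<^sup>2" by simp
      hence "2 * c \<le> c * c + 1" by (simp add: power2_eq_square algebra_simps)
      thus ?thesis using c by (simp add: field_simps)
    qed
    moreover have "G z \<ge> 0" by (simp add: G_def heat_kernel_nonneg)
    ultimately have "G z * 2 \<le> G z * (c + 1 / c)" by (intro mult_left_mono)
    thus ?thesis using \<open>F z = _\<close> \<open>F (- z) = _\<close> by (simp add: ring_distribs)
  qed
  have F0: "F z \<ge> 0" for z by (simp add: F_def heat_kernel_nonneg)
  have G0: "G z \<ge> 0" for z by (simp add: G_def heat_kernel_nonneg)
  have "ennreal (exp (- s)) \<le> (\<integral>\<^sup>+z. ennreal (G z) \<partial>lborel)"
  proof -
    have a: "1 / (4 * s) + 1 / (2 * r) > 0" using s r by (simp add: add_pos_pos)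
    have "(\<integral>\<^sup>+z. ennreal (G z) \<partial>lborel) = (\<integral>\<^sup>+(z::'a). ennreal ((4 * pi * s) powr (- N / 2)) * ennreal (exp (- (1 / (4 * s) + 1 / (2 * r)) * (norm z)\<^sup>2)) \<partial>lborel)"
      unfolding G_def heat_kernel_def N_def
      by (intro nn_integral_cong) (simp add: ennreal_mult[symmetric] mult.assoc exp_add[symmetric] ring_distribs)
    also have "\<dots> = ennreal ((4 * pi * s) powr (- N / 2)) * (\<integral>\<^sup>+(z::'a). ennreal (exp (- (1 / (4 * s) + 1 / (2 * r)) * (norm z)\<^sup>2)) \<partial>lborel)"
      by (rule nn_integral_cmult) measurable
    also have "\<dots> = ennreal ((4 * pi * s) powr (- N / 2) * (pi / (1 / (4 * s) + 1 / (2 * r))) powr (N / 2))"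
      using nn_integral_gaussian[OF a, where 'a = 'a] by (simp add: N_def ennreal_mult)
    also have "(4 * pi * s) powr (- N / 2) * (pi / (1 / (4 * s) + 1 / (2 * r))) powr (N / 2) = (1 + 2 * s / r) powr (- N / 2)"
    proof -
      have "pi / (1 / (4 * s) + 1 / (2 * r)) = (4 * pi * s) / (1 + 2 * s / r)"
        using s r by (simp add: divide_simps add_pos_pos algebra_simps)
      hence "(pi / (1 / (4 * s) + 1 / (2 * r))) powr (N / 2) = (4 * pi * s) powr (N / 2) / (1 + 2 * s / r) powr (N / 2)"
        using s r by (simp add: powr_divide)
      thus ?thesis using s by (simp add: powr_minus field_simps)
    qed
    \<comment> \<open>From ln(1 + y) <= y the decay is at least exp(- s N / r), and N <= r.\<close>
    also have "exp (- s) \<le> (1 + 2 * s / r) powr (- N / 2)"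
    proof -
      have p: "1 + 2 * s / r > 0" using s r by (simp add: add_pos_pos)
      have "ln (1 + 2 * s / r) \<le> 2 * s / r" using s r by (intro ln_add_one_self_le_self) auto
      hence "N / 2 * ln (1 + 2 * s / r) \<le> N / 2 * (2 * s / r)" using N by (intro mult_left_mono) auto
      also have "N / 2 * (2 * s / r) = s * (N / r)" by simp
      also have "\<dots> \<le> s * 1" using s r rN by (intro mult_left_mono) auto
      finally have "- s \<le> - N / 2 * ln (1 + 2 * s / r)" by simp
      thus ?thesis using p by (simp add: powr_def)
    qed
    ultimately show ?thesis by (metis ennreal_leI)
  qed
  also have "\<dots> \<le> (\<integral>\<^sup>+z. ennreal (F z) \<partial>lborel)"
  proof -
    have "2 * (\<integral>\<^sup>+z. ennreal (G z) \<partial>lborel) = (\<integral>\<^sup>+z. ennreal (2 * G z) \<partial>lborel)"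
      using G0 by (subst nn_integral_cmult[symmetric]) (auto simp: ennreal_mult)
    also have "\<dots> \<le> (\<integral>\<^sup>+z. ennreal (F z) + ennreal (F (- z)) \<partial>lborel)"
      using FG F0 by (intro nn_integral_mono) (auto simp flip: ennreal_plus intro!: ennreal_leI)
    also have "\<dots> = (\<integral>\<^sup>+z. ennreal (F z) \<partial>lborel) + (\<integral>\<^sup>+z. ennreal (F (- z)) \<partial>lborel)"
      by (intro nn_integral_add) measurable
    also have "(\<integral>\<^sup>+z. ennreal (F (- z)) \<partial>lborel) = (\<integral>\<^sup>+z. ennreal (F z) \<partial>lborel)"
      by (rule nn_integral_lborel_uminus[symmetric]) measurable
    finally have "2 * (\<integral>\<^sup>+z. ennreal (G z) \<partial>lborel) \<le> 2 * (\<integral>\<^sup>+z. ennreal (F z) \<partial>lborel)" by (simp add: mult_2)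
    thus ?thesis by (subst (asm) ennreal_mult_le_mult_iff) auto
  qed
  finally have 1: "ennreal (exp (- s)) \<le> (\<integral>\<^sup>+z. ennreal (F z) \<partial>lborel)" .
  have "ennreal (exp (- s) * chi x) = ennreal (chi x) * ennreal (exp (- s))"
    by (simp add: ennreal_mult chi_nonneg mult.commute)
  also have "\<dots> \<le> ennreal (chi x) * (\<integral>\<^sup>+z. ennreal (F z) \<partial>lborel)" by (rule mult_left_mono[OF 1]) simp
  also have "\<dots> = (\<integral>\<^sup>+z. ennreal (chi x * F z) \<partial>lborel)"
    by (subst nn_integral_cmult[symmetric]) (auto simp: ennreal_mult chi_nonneg F0)
  also have "\<dots> \<le> (\<integral>\<^sup>+z. ennreal (heat_kernel s (x - (x + z)) * chi (x + z)) \<partial>lborel)"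
  proof (intro nn_integral_mono ennreal_leI)
    fix z :: 'a
    have "(norm (x + z))\<^sup>2 - (norm x)\<^sup>2 = 2 * (x \<bullet> z) + (norm z)\<^sup>2"
      by (simp add: power2_norm_eq_inner inner_add_left inner_add_right inner_commute)
    hence "chi x * exp (- ((2 * (x \<bullet> z) + (norm z)\<^sup>2) / (2 * r))) \<le> chi (x + z)"
      using chi_ge[of x "x + z"] by (simp add: r_def N_def)
    hence "heat_kernel s z * (chi x * exp (- ((2 * (x \<bullet> z) + (norm z)\<^sup>2) / (2 * r)))) \<le> heat_kernel s z * chi (x + z)"
      by (intro mult_left_mono heat_kernel_nonneg)
    thus "chi x * F z \<le> heat_kernel s (x - (x + z)) * chi (x + z)"
      by (simp add: F_def heat_kernel_minus mult_ac)
  qed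
  also have "\<dots> = (\<integral>\<^sup>+y. ennreal (heat_kernel s (x - y) * chi y) \<partial>lborel)"
    by (rule nn_integral_lborel_translate[symmetric]) measurable
  finally show ?thesis .
qed

section \<open>The heat semigroup and its time averages tested against the weight\<close>

lemma integrable_heat_kernel_mult:
  fixes w :: "'a::euclidean_space \<Rightarrow> real"
  assumes [measurable]: "w \<in> borel_measurable borel" and w: "\<And>y. 0 \<le> w y" "\<And>y. w y \<le> M" and s: "s > 0"
  shows "integrable lborel (\<lambda>y. heat_kernel s (x - y) * w y)"
proof (rule Bochner_Integration.integrable_bound)
  show "integrable lborel (\<lambda>y. M * heat_kernel s (x - y))"
    by (intro integrable_mult_right integrableI_nonneg)
       (use nn_integral_heat_kernel[OF s, of x] in \<open>auto simp: heat_kernel_nonneg\<close>)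
  show "AE y in lborel. norm (heat_kernel s (x - y) * w y) \<le> norm (M * heat_kernel s (x - y))"
  proof (rule AE_I2)
    fix y
    have "\<bar>w y\<bar> \<le> \<bar>M\<bar>" using w[of y] by simp
    thus "norm (heat_kernel s (x - y) * w y) \<le> norm (M * heat_kernel s (x - y))"
      by (auto simp: abs_mult heat_kernel_nonneg mult.commute[of "heat_kernel s (x - y)"] intro!: mult_right_mono)
  qed
qed measurable

lemma heat_sg_nn:
  fixes w :: "'a::euclidean_space \<Rightarrow> real"
  assumes "w \<in> borel_measurable borel" "\<And>y. 0 \<le> w y" "\<And>y. w y \<le> M" "s > 0"
  shows "ennreal (heat_sg s w x) = (\<integral>\<^sup>+y. ennreal (heat_kernel s (x - y) * w y) \<partial>lborel)"
  using integrable_heat_kernel_mult[OF assms] assms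
  by (subst nn_integral_eq_integral) (auto simp: heat_sg_def heat_kernel_nonneg)

lemma heat_sg_bounds:
  fixes w :: "'a::euclidean_space \<Rightarrow> real"
  assumes [measurable]: "w \<in> borel_measurable borel" and w: "\<And>y. 0 \<le> w y" "\<And>y. w y \<le> M"
  shows "0 \<le> heat_sg s w x" "s \<ge> 0 \<Longrightarrow> heat_sg s w x \<le> M"
proof -
  show "0 \<le> heat_sg s w x"
    using w by (auto simp: heat_sg_def heat_kernel_nonneg intro!: Bochner_Integration.integral_nonneg)
  have M: "M \<ge> 0" using w[of 0] by linarith
  assume "s \<ge> 0"
  show "heat_sg s w x \<le> M"
  proof (cases "s = 0")
    case False
    with \<open>s \<ge> 0\<close> have s: "s > 0" by simp
    have "ennreal (heat_sg s w x) = (\<integral>\<^sup>+y. ennreal (heat_kernel s (x - y) * w y) \<partial>lborel)"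
      by (rule heat_sg_nn) (use w s in auto)
    also have "\<dots> \<le> (\<integral>\<^sup>+y. ennreal M * ennreal (heat_kernel s (x - y)) \<partial>lborel)"
      using w M by (intro nn_integral_mono) (auto simp: ennreal_mult[symmetric] heat_kernel_nonneg mult.commute intro!: ennreal_leI mult_right_mono)
    also have "\<dots> = ennreal M * (\<integral>\<^sup>+y. ennreal (heat_kernel s (x - y)) \<partial>lborel)"
      by (intro nn_integral_cmult) measurable
    also have "\<dots> = ennreal M" using nn_integral_heat_kernel[OF s, of x] by simp
    finally show ?thesis using M by simp
  qed (use w in \<open>simp add: heat_sg_def\<close>)
qed

lemma measurable_heat_sg [measurable (raw)]:
  fixes w :: "'b \<Rightarrow> 'a::euclidean_space \<Rightarrow> real"
  assumes [measurable]: "s \<in> borel_measurable N" "(\<lambda>(z, y). w z y) \<in> borel_measurable (N \<Otimes>\<^sub>M borel)" "x \<in> measurable N borel"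
  shows "(\<lambda>z. heat_sg (s z) (w z) (x z)) \<in> borel_measurable N"
  unfolding heat_sg_def by measurable

text \<open>The heat semigroup is symmetric: by Tonelli and evenness of the kernel it is moved onto
  \<open>chi\<close>, where \<open>heat_kernel_chi_ge\<close> applies.\<close>

lemma heat_sg_chi_ge:
  fixes w :: "'a::euclidean_space \<Rightarrow> real"
  assumes [measurable]: "w \<in> borel_measurable borel" and w: "\<And>y. 0 \<le> w y" "\<And>y. w y \<le> M" and s: "s > 0"
  shows "chi_mass (heat_sg s w) \<ge> ennreal (exp (- s)) * chi_mass w"
proof -
  have "ennreal (exp (- s)) * (\<integral>\<^sup>+y. ennreal (w y * chi y) \<partial>lborel) = (\<integral>\<^sup>+y. ennreal (w y) * ennreal (exp (- s) * chi y) \<partial>lborel)"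
    using w by (subst nn_integral_cmult[symmetric]) (auto simp: ennreal_mult[symmetric] chi_nonneg mult_ac)
  also have "\<dots> \<le> (\<integral>\<^sup>+y. ennreal (w y) * (\<integral>\<^sup>+x. ennreal (heat_kernel s (y - x) * chi x) \<partial>lborel) \<partial>lborel)"
    by (intro nn_integral_mono mult_left_mono heat_kernel_chi_ge s) simp
  also have "\<dots> = (\<integral>\<^sup>+y. \<integral>\<^sup>+x. ennreal (heat_kernel s (x - y) * w y) * ennreal (chi x) \<partial>lborel \<partial>lborel)"
  proof (rule nn_integral_cong)
    fix y :: 'a
    have "heat_kernel s (y - x) = heat_kernel s (x - y)" for x using heat_kernel_minus[of s "x - y"] by simp
    thus "ennreal (w y) * (\<integral>\<^sup>+x. ennreal (heat_kernel s (y - x) * chi x) \<partial>lborel) = (\<integral>\<^sup>+x. ennreal (heat_kernel s (x - y) * w y) * ennreal (chi x) \<partial>lborel)"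
      using w[of y] by (subst nn_integral_cmult[symmetric]) (auto simp: ennreal_mult[symmetric] chi_nonneg heat_kernel_nonneg mult_ac)
  qed
  also have "\<dots> = (\<integral>\<^sup>+x. \<integral>\<^sup>+y. ennreal (heat_kernel s (x - y) * w y) * ennreal (chi x) \<partial>lborel \<partial>lborel)"
    by (intro lborel_pair.Fubini') measurable
  also have "\<dots> = chi_mass (heat_sg s w)"
  proof (rule nn_integral_cong)
    fix x :: 'a
    have "(\<integral>\<^sup>+y. ennreal (heat_kernel s (x - y) * w y) * ennreal (chi x) \<partial>lborel) = ennreal (heat_sg s w x) * ennreal (chi x)"
      unfolding heat_sg_nn[OF assms] by (intro nn_integral_multc) measurable
    thus "(\<integral>\<^sup>+y. ennreal (heat_kernel s (x - y) * w y) * ennreal (chi x) \<partial>lborel) = ennreal (heat_sg s w x * chi x)"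
      using heat_sg_bounds(1)[OF assms(1-3)] by (simp add: ennreal_mult chi_nonneg)
  qed
  finally show ?thesis .
qed

text \<open>Common form of both solution operators: j = 0 gives \<open>P_op\<close>, and j = 1 gives
  \<open>S_op\<close> up to the factor \<gamma>.\<close>

definition frac_avg :: "real \<Rightarrow> nat \<Rightarrow> real \<Rightarrow> ('a::euclidean_space \<Rightarrow> real) \<Rightarrow> 'a \<Rightarrow> real" where
  "frac_avg \<gamma> j t w x = (LINT \<theta>|lborel. indicator {0<..} \<theta> * (\<theta> ^ j * mainardi \<gamma> \<theta>) * heat_sg (t powr \<gamma> * \<theta>) w x)"

lemma P_op_eq: "P_op \<gamma> t w x = frac_avg \<gamma> 0 t w x"
  by (simp add: P_op_def frac_avg_def set_lebesgue_integral_def mult.assoc)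

lemma S_op_eq: "S_op \<gamma> t w x = \<gamma> * frac_avg \<gamma> 1 t w x"
  by (simp add: S_op_def frac_avg_def set_lebesgue_integral_def mult.assoc)

lemma measurable_frac_avg [measurable (raw)]:
  fixes w :: "'b \<Rightarrow> 'a::euclidean_space \<Rightarrow> real"
  assumes [measurable]: "t \<in> borel_measurable N" "(\<lambda>(z, y). w z y) \<in> borel_measurable (N \<Otimes>\<^sub>M borel)" "x \<in> measurable N borel"
  shows "(\<lambda>z. frac_avg \<gamma> j (t z) (w z) (x z)) \<in> borel_measurable N"
  unfolding frac_avg_def by measurable

text \<open>The heat semigroup keeps w between 0 and M, and the j-th moment of
  \<open>mainardi\<close> is finite; so the Bochner integral is genuine and may be rewritten as a
  nonnegative one.\<close>

lemma frac_avg_nn: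
  fixes w :: "'a::euclidean_space \<Rightarrow> real"
  assumes g: "0 < \<gamma>" "\<gamma> < 1" and [measurable]: "w \<in> borel_measurable borel" and w: "\<And>y. 0 \<le> w y" "\<And>y. w y \<le> M"
  shows "ennreal (frac_avg \<gamma> j t w x) = (\<integral>\<^sup>+\<theta>. ennreal (indicator {0<..} \<theta> * (\<theta> ^ j * mainardi \<gamma> \<theta>) * heat_sg (t powr \<gamma> * \<theta>) w x) \<partial>lborel)"
    and "0 \<le> frac_avg \<gamma> j t w x" and "frac_avg \<gamma> j t w x \<le> M * (fact j / Gamma (\<gamma> * j + 1))"
proof -
  have nn: "0 \<le> indicator {0<..} \<theta> * (\<theta> ^ j * mainardi \<gamma> \<theta>)" for \<theta>
    using mainardi_nonneg[OF g, of \<theta>] by (auto simp: indicator_def)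
  have M: "M \<ge> 0" using w[of 0] by linarith
  note hb = heat_sg_bounds[OF assms(3-5)]
  have le: "indicator {0<..} \<theta> * (\<theta> ^ j * mainardi \<gamma> \<theta>) * heat_sg (t powr \<gamma> * \<theta>) w x \<le> M * (indicator {0<..} \<theta> * (\<theta> ^ j * mainardi \<gamma> \<theta>))" for \<theta>
  proof (cases "\<theta> > 0")
    case True
    thus ?thesis using nn[of \<theta>] hb(2)[of "t powr \<gamma> * \<theta>" x] by (subst mult.commute[of M]) (intro mult_left_mono, auto)
  qed simp
  note mom = mainardi_moment[OF g, of j]
  have iM: "integrable lborel (\<lambda>\<theta>. M * (indicator {0<..} \<theta> * (\<theta> ^ j * mainardi \<gamma> \<theta>)))"
    using mom by (simp add: has_bochner_integral_iff)
  have int: "integrable lborel (\<lambda>\<theta>. indicator {0<..} \<theta> * (\<theta> ^ j * mainardi \<gamma> \<theta>) * heat_sg (t powr \<gamma> * \<theta>) w x)"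
  proof (rule Bochner_Integration.integrable_bound[OF iM])
    show "AE \<theta> in lborel. norm (indicator {0<..} \<theta> * (\<theta> ^ j * mainardi \<gamma> \<theta>) * heat_sg (t powr \<gamma> * \<theta>) w x) \<le> norm (M * (indicator {0<..} \<theta> * (\<theta> ^ j * mainardi \<gamma> \<theta>)))"
    proof (rule AE_I2)
      fix \<theta>
      have "0 \<le> indicator {0<..} \<theta> * (\<theta> ^ j * mainardi \<gamma> \<theta>) * heat_sg (t powr \<gamma> * \<theta>) w x" by (intro mult_nonneg_nonneg[OF nn hb(1)])
      with le[of \<theta>] show "norm (indicator {0<..} \<theta> * (\<theta> ^ j * mainardi \<gamma> \<theta>) * heat_sg (t powr \<gamma> * \<theta>) w x) \<le> norm (M * (indicator {0<..} \<theta> * (\<theta> ^ j * mainardi \<gamma> \<theta>)))"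
        unfolding real_norm_def by linarith
    qed
  qed measurable
  show "ennreal (frac_avg \<gamma> j t w x) = (\<integral>\<^sup>+\<theta>. ennreal (indicator {0<..} \<theta> * (\<theta> ^ j * mainardi \<gamma> \<theta>) * heat_sg (t powr \<gamma> * \<theta>) w x) \<partial>lborel)"
    unfolding frac_avg_def
    by (rule nn_integral_eq_integral[symmetric, OF int]) (intro AE_I2 mult_nonneg_nonneg[OF nn hb(1)])
  show "0 \<le> frac_avg \<gamma> j t w x" unfolding frac_avg_def
    by (intro Bochner_Integration.integral_nonneg mult_nonneg_nonneg[OF nn hb(1)])
  have "frac_avg \<gamma> j t w x \<le> (LINT \<theta>|lborel. M * (indicator {0<..} \<theta> * (\<theta> ^ j * mainardi \<gamma> \<theta>)))"
    unfolding frac_avg_def by (rule integral_mono[OF int iM le])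
  also have "\<dots> = M * (fact j / Gamma (\<gamma> * j + 1))"
    by (intro has_bochner_integral_integral_eq has_bochner_integral_mult_right mom)
  finally show "frac_avg \<gamma> j t w x \<le> M * (fact j / Gamma (\<gamma> * j + 1))" .
qed

text \<open>The decay exp(-s) of the tested semigroup at s = t^\<gamma> \<theta> is averaged over
  the nonnegative Mainardi weight. Hypothesis \<open>E\<close> supplies the averaged exponential as
  the number \<open>e\<close>, so one proof serves both operators.\<close>

lemma frac_avg_chi_ge:
  fixes w :: "'a::euclidean_space \<Rightarrow> real"
  assumes g: "0 < \<gamma>" "\<gamma> < 1" and [measurable]: "w \<in> borel_measurable borel" and w: "\<And>y. 0 \<le> w y" "\<And>y. w y \<le> M"
    and t: "t > 0"
    and E: "has_bochner_integral lborel (\<lambda>\<theta>. indicator {0<..} \<theta> * (\<theta> ^ j * mainardi \<gamma> \<theta> * exp (- (t powr \<gamma> * \<theta>)))) e"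
  shows "ennreal e * chi_mass w \<le> chi_mass (frac_avg \<gamma> j t w)"
proof -
  let ?m = "\<lambda>\<theta>. indicator {0<..} \<theta> * (\<theta> ^ j * mainardi \<gamma> \<theta>) :: real"
  let ?I = "\<integral>\<^sup>+x. ennreal (w x * chi x) \<partial>lborel"
  have nn: "0 \<le> ?m \<theta>" for \<theta>
    using mainardi_nonneg[OF g, of \<theta>] by (auto simp: indicator_def)
  note hb = heat_sg_bounds[OF assms(3-5)]
  have e: "ennreal e = (\<integral>\<^sup>+\<theta>. ennreal (?m \<theta>) * ennreal (exp (- (t powr \<gamma> * \<theta>))) \<partial>lborel)"
  proof -
    have "(\<integral>\<^sup>+\<theta>. ennreal (?m \<theta>) * ennreal (exp (- (t powr \<gamma> * \<theta>))) \<partial>lborel) = (\<integral>\<^sup>+\<theta>. ennreal (indicator {0<..} \<theta> * (\<theta> ^ j * mainardi \<gamma> \<theta> * exp (- (t powr \<gamma> * \<theta>)))) \<partial>lborel)"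
      using nn by (intro nn_integral_cong) (simp add: ennreal_mult[symmetric] mult.assoc)
    also have "\<dots> = ennreal (LINT \<theta>|lborel. indicator {0<..} \<theta> * (\<theta> ^ j * mainardi \<gamma> \<theta> * exp (- (t powr \<gamma> * \<theta>))))"
      using E mult_nonneg_nonneg[OF nn exp_ge_zero] by (intro nn_integral_eq_integral) (auto simp: has_bochner_integral_iff mult.assoc)
    also have "\<dots> = ennreal e" using E by (simp add: has_bochner_integral_iff)
    finally show ?thesis by simp
  qed
  have "ennreal e * ?I = (\<integral>\<^sup>+\<theta>. ennreal (?m \<theta>) * ennreal (exp (- (t powr \<gamma> * \<theta>))) * ?I \<partial>lborel)"
    unfolding e by (intro nn_integral_multc[symmetric]) measurable
  also have "\<dots> \<le> (\<integral>\<^sup>+\<theta>. ennreal (?m \<theta>) * chi_mass (heat_sg (t powr \<gamma> * \<theta>) w) \<partial>lborel)"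
  proof (rule nn_integral_mono)
    fix \<theta> :: real
    show "ennreal (?m \<theta>) * ennreal (exp (- (t powr \<gamma> * \<theta>))) * ?I \<le> ennreal (?m \<theta>) * chi_mass (heat_sg (t powr \<gamma> * \<theta>) w)"
    proof (cases "\<theta> > 0")
      case True
      thus ?thesis unfolding mult.assoc using t
        by (intro mult_left_mono heat_sg_chi_ge[OF assms(3-5)]) auto
    qed simp
  qed
  also have "\<dots> = (\<integral>\<^sup>+\<theta>. \<integral>\<^sup>+x. ennreal (?m \<theta> * heat_sg (t powr \<gamma> * \<theta>) w x) * ennreal (chi x) \<partial>lborel \<partial>lborel)"
  proof (rule nn_integral_cong)
    fix \<theta> :: real
    have "ennreal a * chi_mass (heat_sg (t powr \<gamma> * \<theta>) w) = (\<integral>\<^sup>+x. ennreal (a * heat_sg (t powr \<gamma> * \<theta>) w x) * ennreal (chi x) \<partial>lborel)"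
      if "a \<ge> 0" for a
      by (subst nn_integral_cmult[symmetric], measurable)
         (intro nn_integral_cong, simp add: ennreal_mult mult.assoc hb(1) chi_nonneg that)
    thus "ennreal (?m \<theta>) * chi_mass (heat_sg (t powr \<gamma> * \<theta>) w) = (\<integral>\<^sup>+x. ennreal (?m \<theta> * heat_sg (t powr \<gamma> * \<theta>) w x) * ennreal (chi x) \<partial>lborel)"
      using nn .
  qed
  also have "\<dots> = (\<integral>\<^sup>+x. \<integral>\<^sup>+\<theta>. ennreal (?m \<theta> * heat_sg (t powr \<gamma> * \<theta>) w x) * ennreal (chi x) \<partial>lborel \<partial>lborel)"
    by (intro lborel_pair.Fubini') measurable
  also have "\<dots> = chi_mass (frac_avg \<gamma> j t w)"
  proof (rule nn_integral_cong)
    fix x :: 'a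
    have "(\<integral>\<^sup>+\<theta>. ennreal (?m \<theta> * heat_sg (t powr \<gamma> * \<theta>) w x) * ennreal (chi x) \<partial>lborel) = ennreal (frac_avg \<gamma> j t w x) * ennreal (chi x)"
      unfolding frac_avg_nn(1)[OF assms(1-5)] by (intro nn_integral_multc) measurable
    thus "(\<integral>\<^sup>+\<theta>. ennreal (?m \<theta> * heat_sg (t powr \<gamma> * \<theta>) w x) * ennreal (chi x) \<partial>lborel) = ennreal (frac_avg \<gamma> j t w x * chi x)"
      using frac_avg_nn(2)[OF assms(1-5)] by (simp add: ennreal_mult chi_nonneg)
  qed
  finally show ?thesis .
qed

section \<open>Fractional blow-up inequality\<close>

lemma frac_kernel_antimono:
  assumes "0 < \<gamma>" "\<gamma> < 1" "0 < s" "s \<le> t"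
  shows "frac_kernel \<gamma> t \<le> frac_kernel \<gamma> s"
  using assms Gamma_real_pos[of \<gamma>] unfolding frac_kernel_def
  by (intro divide_right_mono powr_mono2') auto

lemma integrable_frac_kernel_mult:
  fixes k :: "real \<Rightarrow> real"
  assumes g: "0 < \<gamma>" and t: "t \<ge> 0" and k: "continuous_on {0..t} k"
  shows "integrable lborel (\<lambda>s. indicator {0..t} s * (frac_kernel \<gamma> (t - s) * k s))"
    and "integrable lborel (\<lambda>s. indicator {0..t} s * (frac_kernel \<gamma> s * k s))"
proof -
  obtain C where C: "\<And>s. s \<in> {0..t} \<Longrightarrow> \<bar>k s\<bar> \<le> C"
    using compact_imp_bounded[OF compact_continuous_image[OF k compact_Icc]] unfolding bounded_iff by (metis imageI real_norm_def)
  have C0: "C \<ge> 0" using C[of 0] t by force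
  have m: "(\<lambda>s. indicator {0..t} s * k s) \<in> borel_measurable borel"
    using borel_measurable_continuous_on_indicator[OF _ k] by simp
  have *: "integrable lborel (\<lambda>s. (indicator {0..t} s * f s) * (indicator {0..t} s * k s))"
    if f: "integrable lborel (\<lambda>s. indicator {0..t} s * f s)" for f :: "real \<Rightarrow> real"
  proof (rule Bochner_Integration.integrable_bound)
    show "integrable lborel (\<lambda>s. C * (indicator {0..t} s * f s))" using f by simp
    show "(\<lambda>s. (indicator {0..t} s * f s) * (indicator {0..t} s * k s)) \<in> borel_measurable lborel"
      using borel_measurable_integrable[OF f] m by measurable
    show "AE s in lborel. norm ((indicator {0..t} s * f s) * (indicator {0..t} s * k s)) \<le> norm (C * (indicator {0..t} s * f s))"
      using C C0 by (intro AE_I2) (auto simp: indicator_def abs_mult mult.commute[of C] intro!: mult_left_mono)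
  qed
  have eq: "(indicator {0..t} s * a) * (indicator {0..t} s * b) = indicator {0..t} s * (a * b)" for s a b :: real
    by (simp add: indicator_def)
  show "integrable lborel (\<lambda>s. indicator {0..t} s * (frac_kernel \<gamma> (t - s) * k s))"
    using *[of "\<lambda>s. frac_kernel \<gamma> (t - s)"] has_bochner_integral_frac_kernel_reflected[OF g t] by (simp add: eq has_bochner_integral_iff)
  show "integrable lborel (\<lambda>s. indicator {0..t} s * (frac_kernel \<gamma> s * k s))"
    using *[of "frac_kernel \<gamma>"] has_bochner_integral_frac_kernel[OF g t] by (simp add: eq has_bochner_integral_iff)
qed

text \<open>Chebyshev's rearrangement: the kernel \<open>frac_kernel \<gamma> (t - s)\<close> is increasing in \<open>s\<close>.\<close>

lemma frac_kernel_rearrangement: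
  fixes k :: "real \<Rightarrow> real"
  assumes g: "0 < \<gamma>" "\<gamma> < 1" and t: "t > 0" and k: "continuous_on {0..t} k"
    and mono: "\<And>r s. 0 \<le> r \<Longrightarrow> r \<le> s \<Longrightarrow> s \<le> t \<Longrightarrow> k r \<le> k s"
  shows "(LINT s|lborel. indicator {0..t} s * (frac_kernel \<gamma> s * k s)) \<le> (LINT s|lborel. indicator {0..t} s * (frac_kernel \<gamma> (t - s) * k s))"
proof -
  have t0: "t \<ge> 0" using t by simp
  \<comment> \<open>Both kernels have the same integral, so a constant may be subtracted from k
    freely. The kernels cross at s = t/2, and with this choice k - c changes sign at the same
    point.\<close>
  define c where "c = k (t / 2)"
  define a where "a = (\<lambda>s. indicator {0..t} s * frac_kernel \<gamma> (t - s) :: real)"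
  define b where "b = (\<lambda>s. indicator {0..t} s * frac_kernel \<gamma> s :: real)"
  note h1 = has_bochner_integral_frac_kernel_reflected[OF g(1) t0] and h2 = has_bochner_integral_frac_kernel[OF g(1) t0]
  have ia: "integrable lborel a" "integrable lborel b" "(LINT s|lborel. a s) = (LINT s|lborel. b s)"
    using h1 h2 by (auto simp: has_bochner_integral_iff a_def b_def)
  have i1: "integrable lborel (\<lambda>s. a s * k s)" "integrable lborel (\<lambda>s. b s * k s)"
    using integrable_frac_kernel_mult[OF g(1) t0 k] by (simp_all add: a_def b_def mult.assoc)
  have "0 \<le> (LINT s|lborel. (a s * k s - b s * k s) - (a s * c - b s * c))"
  proof (rule integral_nonneg_AE)
    show "AE s in lborel. 0 \<le> (a s * k s - b s * k s) - (a s * c - b s * c)"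
    \<comment> \<open>The endpoints are discarded: \<open>frac_kernel\<close> is 0 at 0 instead of
      infinite, so the difference of the kernels has the wrong sign there.\<close>
    proof (rule AE_mp[OF AE_conjI[OF AE_lborel_singleton[of 0] AE_lborel_singleton[of t]]], intro AE_I2 impI)
      fix s assume s: "s \<noteq> 0 \<and> s \<noteq> t"
      show "0 \<le> (a s * k s - b s * k s) - (a s * c - b s * c)"
      proof (cases "s \<in> {0..t}")
        case True
        with s have s': "0 < s" "s < t" by auto
        have "0 \<le> (frac_kernel \<gamma> (t - s) - frac_kernel \<gamma> s) * (k s - c)"
        proof (cases "s \<le> t / 2")
          case True
          thus ?thesis unfolding c_def using s' g
            by (intro mult_nonpos_nonpos) (auto intro!: frac_kernel_antimono mono)
        next
          case False
          thus ?thesis unfolding c_def using s' g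
            by (intro mult_nonneg_nonneg) (auto intro!: frac_kernel_antimono mono)
        qed
        thus ?thesis using True by (simp add: a_def b_def algebra_simps)
      qed (simp add: a_def b_def)
    qed
  qed
  also have "\<dots> = (LINT s|lborel. a s * k s) - (LINT s|lborel. b s * k s)"
    using i1 ia by simp
  finally show ?thesis by (simp add: a_def b_def mult.assoc)
qed

text \<open>For z above the threshold this keeps the argument 1 - 2^p z^(1-p) of the logarithm in
  the bound positive.\<close>

lemma two_powr_times_less_one:
  fixes p z :: real
  assumes p: "1 < p" and z: "2 powr (p / (p - 1)) < z"
  shows "2 powr p * z powr (1 - p) < 1"
proof -
  have "z powr (1 - p) < (2 powr (p / (p - 1))) powr (1 - p)" using z p by (intro powr_less_mono2_neg) auto
  also have "p / (p - 1) * (1 - p) = - p" using p by (simp add: divide_simps) (simp add: algebra_simps)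
  hence "(2 powr (p / (p - 1))) powr (1 - p) = 2 powr (- p)" by (simp only: powr_powr)
  finally show ?thesis by (simp add: powr_minus field_simps)
qed

text \<open>Comparison of \<open>Z\<close> with
  \<open>w t = y (t powr \<gamma> / Gamma (\<gamma> + 1))\<close>, started at z. The strict gap z <
  Z0 forbids a first contact. The inequality for Z at t is assumed only if Z >= 2 before t; this is
  available up to the contact time, because there Z > w >= z > 2.\<close>

lemma fractional_blowup_bound_strict:
  fixes Z :: "real \<Rightarrow> real"
  assumes g: "0 < \<gamma>" "\<gamma> < 1" and p: "1 < p"
    and z: "2 powr (p / (p - 1)) < z" "z < Z0"
    and cont: "continuous_on {0..T} Z" and T: "T \<ge> 0" and Z00: "Z 0 \<ge> Z0" and Znn: "\<And>t. 0 \<le> t \<Longrightarrow> t \<le> T \<Longrightarrow> Z t \<ge> 0"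
    and Zineq: "\<And>t. 0 < t \<Longrightarrow> t \<le> T \<Longrightarrow> (\<And>s. 0 \<le> s \<Longrightarrow> s < t \<Longrightarrow> Z s \<ge> 2) \<Longrightarrow>
       Z t \<ge> Z0 + (LINT s|lborel. indicator {0..t} s * (frac_kernel \<gamma> (t - s) * (2 powr (1 - p) * Z s powr p - 2 * Z s)))"
  shows "T \<le> (ln (1 - 2 powr p * z powr (1 - p)) / (2 * (1 - p)) * Gamma (\<gamma> + 1)) powr (1 / \<gamma>)"
proof (rule ccontr)
  have two: "2 < 2 powr (p / (p - 1))"
  proof -
    have "(2::real) powr 1 < 2 powr (p / (p - 1))" using p by (intro powr_less_mono) (auto simp: field_simps)
    thus ?thesis by simp
  qed
  hence z2: "z > 2" using z by simp
  define F where "F = (\<lambda>x::real. 2 powr (1 - p) * x powr p - 2 * x)"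
  define W1 where "W1 = z powr (1 - p)"
  have W1: "W1 > 0" "2 powr p * W1 < 1"
  proof -
    show "W1 > 0" using z2 by (simp add: W1_def)
    show "2 powr p * W1 < 1" unfolding W1_def by (rule two_powr_times_less_one[OF p z(1)])
  qed
  \<comment> \<open>Origin: for W = y^(1-p) the equation y' = F(y) becomes W' = 2 (p - 1) (W -
    2^(-p)). Its solution with W(0) = z^(1-p) is 2^(-p) - d exp(2 (p - 1) x), which vanishes at
    \<open>\<tau>s\<close>.\<close>
  define d where "d = 2 powr (- p) - W1"
  have d: "d > 0" using W1 by (simp add: d_def powr_minus field_simps)
  define \<tau>s where "\<tau>s = ln (1 - 2 powr p * W1) / (2 * (1 - p))"
  have \<tau>s: "\<tau>s > 0"
  proof -
    have "1 - 2 powr p * W1 < 1" using W1 by simp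
    hence "ln (1 - 2 powr p * W1) < 0" using W1 by (simp add: ln_less_zero)
    thus ?thesis using p unfolding \<tau>s_def by (intro divide_neg_neg) auto
  qed
  define G where "G = Gamma (\<gamma> + 1)"
  have G: "G > 0" unfolding G_def using g by (intro Gamma_real_pos) auto
  \<comment> \<open>The time at which t^\<gamma> / Gamma(\<gamma> + 1) reaches
    \<open>\<tau>s\<close>, hence the blow-up time of \<open>w\<close>.\<close>
  define ts where "ts = (\<tau>s * G) powr (1 / \<gamma>)"
  have ts: "ts > 0" using \<tau>s G by (simp add: ts_def)
  have ts_powr: "ts powr \<gamma> = \<tau>s * G" using \<tau>s G g by (simp add: ts_def powr_powr)
  assume "\<not> T \<le> (ln (1 - 2 powr p * z powr (1 - p)) / (2 * (1 - p)) * Gamma (\<gamma> + 1)) powr (1 / \<gamma>)"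
  hence tsT: "ts < T" by (simp add: ts_def \<tau>s_def W1_def G_def)
  define W where "W = (\<lambda>x. 2 powr (- p) - d * exp (2 * (p - 1) * x))"
  have W0: "W 0 = W1" by (simp add: W_def d_def)
  have Wts: "W \<tau>s = 0"
  proof -
    have "2 * (p - 1) * \<tau>s = - ln (1 - 2 powr p * W1)" using p by (simp add: \<tau>s_def field_simps)
    hence "exp (2 * (p - 1) * \<tau>s) = 1 / (1 - 2 powr p * W1)" using W1 by (simp add: exp_minus divide_inverse)
    moreover have "d = 2 powr (- p) * (1 - 2 powr p * W1)" by (simp add: d_def powr_minus algebra_simps)
    ultimately show ?thesis using W1 by (simp add: W_def)
  qed
  have Wdec: "W x < W y" if "y < x" for x y
    using that d p by (simp add: W_def)
  define y where "y = (\<lambda>x. W x powr (1 / (1 - p)))"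
  have Wpos: "W x > 0" if "x < \<tau>s" for x using Wdec[OF that] Wts by simp
  have ymono: "y a \<le> y b" if "a \<le> b" "b < \<tau>s" for a b
  proof (cases "a = b")
    case False
    thus ?thesis unfolding y_def using that p Wdec[of a b] Wpos[OF that(2)] by (intro powr_mono2') (auto simp: field_simps)
  qed simp
  have y0: "y 0 = z" using p z2 by (simp add: y_def W0 W1_def powr_powr)
  have yz: "y x \<ge> z" if "0 \<le> x" "x < \<tau>s" for x using ymono[OF that] y0 by simp
  have yd: "(y has_real_derivative F (y x)) (at x)" if x: "x < \<tau>s" for x
  proof -
    have Wd: "(W has_real_derivative - (d * (exp (2 * (p - 1) * x) * (2 * (p - 1))))) (at x)"
      unfolding W_def by (auto intro!: derivative_eq_intros)
    have "(y has_real_derivative (1 / (1 - p)) * W x powr (1 / (1 - p) - 1) * - (d * (exp (2 * (p - 1) * x) * (2 * (p - 1))))) (at x)"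
      unfolding y_def by (rule DERIV_chain2[OF has_real_derivative_powr[OF Wpos[OF x]] Wd, THEN DERIV_cong]) simp
    moreover have "(1 / (1 - p)) * W x powr (1 / (1 - p) - 1) * - (d * (exp (2 * (p - 1) * x) * (2 * (p - 1)))) = F (y x)"
    proof -
      have e: "d * exp (2 * (p - 1) * x) = 2 powr (- p) - W x" by (simp add: W_def)
      have e1: "y x powr p = W x powr (1 / (1 - p) - 1)"
        unfolding y_def powr_powr using p by (intro arg_cong2[where f = "(powr)"]) (auto simp: field_simps)
      have e2: "W x * W x powr (1 / (1 - p) - 1) = y x"
        using Wpos[OF x] by (simp add: y_def powr_diff)
      have "(1 / (1 - p)) * W x powr (1 / (1 - p) - 1) * - (d * (exp (2 * (p - 1) * x) * (2 * (p - 1))))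
         = 2 * W x powr (1 / (1 - p) - 1) * (d * exp (2 * (p - 1) * x)) * ((p - 1) / (p - 1))"
        using p by (simp add: field_simps)
      also have "\<dots> = 2 * 2 powr (- p) * W x powr (1 / (1 - p) - 1) - 2 * (W x * W x powr (1 / (1 - p) - 1))"
        unfolding e using p by (simp add: algebra_simps)
      also have "\<dots> = F (y x)" unfolding e2 unfolding e1[symmetric] F_def by (simp add: powr_diff powr_minus divide_inverse)
      finally show ?thesis .
    qed
    ultimately show ?thesis by simp
  qed
  \<comment> \<open>For x >= z the power x^(p-1) is at least 2^p, so F'(x) = 2^(1-p) p x^(p-1) - 2
    is nonnegative.\<close>
  have Fmono: "F a \<le> F b" if "z \<le> a" "a \<le> b" for a b
  proof (rule DERIV_nonneg_imp_nondecreasing[OF that(2)])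
    fix x assume x: "a \<le> x" "x \<le> b"
    have x0: "x > 0" using x that z2 by linarith
    have "(F has_real_derivative 2 powr (1 - p) * (p * x powr (p - 1)) - 2) (at x)"
      unfolding F_def using x0 by (auto intro!: derivative_eq_intros)
    moreover have "2 \<le> 2 powr (1 - p) * (p * x powr (p - 1))"
    proof -
      have "2 powr p = (2 powr (p / (p - 1))) powr (p - 1)" using p by (simp add: powr_powr)
      also have "\<dots> \<le> x powr (p - 1)" using x that z p by (intro powr_mono2) auto
      finally have "2 powr (1 - p) * (1 * 2 powr p) \<le> 2 powr (1 - p) * (p * x powr (p - 1))"
        using p by (intro mult_left_mono mult_mono) auto
      moreover have "2 powr (1 - p) * (2::real) powr p = 2" by (simp flip: powr_add)
      ultimately show ?thesis by simp
    qed
    ultimately show "\<exists>D. (F has_real_derivative D) (at x) \<and> 0 \<le> D" by force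
  qed
  have Fz: "F z \<ge> 0"
  proof -
    have "2 powr p = (2 powr (p / (p - 1))) powr (p - 1)" using p by (simp add: powr_powr)
    also have "\<dots> \<le> z powr (p - 1)" using z p by (intro powr_mono2) auto
    finally have "2 powr (1 - p) * 2 powr p * z \<le> 2 powr (1 - p) * z powr (p - 1) * z"
      using z2 by (intro mult_left_mono mult_right_mono) auto
    moreover have "2 powr (1 - p) * (2::real) powr p = 2" by (simp flip: powr_add)
    moreover have "z powr (p - 1) * z = z powr p" using z2 by (simp add: powr_diff)
    ultimately show ?thesis by (simp add: F_def mult.assoc)
  qed
  define h where "h = (\<lambda>t. t powr \<gamma> / G)"
  define w where "w = (\<lambda>t. y (h t))"
  have h0: "h 0 = 0" by (simp add: h_def)
  have hnn: "h t \<ge> 0" for t using G by (simp add: h_def)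
  have hlt: "h t < \<tau>s" if "0 \<le> t" "t < ts" for t
  proof -
    have "t powr \<gamma> < ts powr \<gamma>" using that g by (intro powr_less_mono2) auto
    thus ?thesis using G by (simp add: h_def ts_powr field_simps)
  qed
  have hmono: "h s \<le> h t" if "0 \<le> s" "s \<le> t" for s t
    using that g G unfolding h_def by (intro divide_right_mono powr_mono2) auto
  have hcont: "continuous_on {0..} h" unfolding h_def using g G
    by (intro continuous_intros continuous_on_powr') auto
  have wcont: "continuous_on {0..t} w" if "t < ts" for t
    unfolding w_def
  proof (rule continuous_on_compose2[of "{..<\<tau>s}" y])
    show "continuous_on {..<\<tau>s} y"
      by (intro continuous_at_imp_continuous_on ballI DERIV_isCont) (use yd in auto)
    show "continuous_on {0..t} h" by (rule continuous_on_subset[OF hcont]) auto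
    show "h ` {0..t} \<subseteq> {..<\<tau>s}" using hlt that by auto
  qed
  have wz: "w t \<ge> z" if "0 \<le> t" "t < ts" for t unfolding w_def using hlt[OF that] hnn by (intro yz) auto
  have w0: "w 0 = z" by (simp add: w_def h0 y0)
  have wmono: "w s \<le> w t" if "0 \<le> s" "s \<le> t" "t < ts" for s t
    unfolding w_def using hmono[OF that(1,2)] hlt[of t] that by (intro ymono) auto
  have Fcont: "continuous_on {0<..} F" unfolding F_def by (intro continuous_intros) auto
  have Fwcont: "continuous_on {0..t} (\<lambda>s. F (w s))" if "t < ts" for t
    by (rule continuous_on_compose2[OF Fcont wcont[OF that]]) (use wz z2 that in force)
  \<comment> \<open>The derivative of t^\<gamma> / Gamma(\<gamma> + 1) is
    \<open>frac_kernel \<gamma> t\<close>, so \<open>w\<close> satisfies an ordinary integral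
    equation with the kernel at s instead of t - s. The interior form of the fundamental theorem is
    used because this derivative is singular at 0.\<close>
  have wint: "(LINT s|lborel. indicator {0..t} s * (frac_kernel \<gamma> s * F (w s))) = w t - z" if t: "0 < t" "t < ts" for t
  proof -
    have hi: "((\<lambda>s. frac_kernel \<gamma> s * F (w s)) has_integral (w t - w 0)) {0..t}"
    proof (rule fundamental_theorem_of_calculus_interior)
      show "0 \<le> t" using t by simp
      show "continuous_on {0..t} w" by (rule wcont[OF t(2)])
      fix s assume s: "s \<in> {0<..<t}"
      have "Gamma (\<gamma> + 1) = \<gamma> * Gamma \<gamma>" using g by (intro Gamma_plus1) (auto elim!: nonpos_Ints_cases)
      hence "\<gamma> * s powr (\<gamma> - 1) / G = frac_kernel \<gamma> s" using g by (simp add: G_def frac_kernel_def)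
      moreover have "(h has_real_derivative \<gamma> * s powr (\<gamma> - 1) / G) (at s)"
        unfolding h_def using s by (auto intro!: DERIV_cdivide has_real_derivative_powr)
      ultimately have "(h has_real_derivative frac_kernel \<gamma> s) (at s)" by simp
      hence "((\<lambda>s. y (h s)) has_real_derivative F (y (h s)) * frac_kernel \<gamma> s) (at s)"
        using s t by (intro DERIV_chain2[OF yd] hlt) auto
      thus "(w has_vector_derivative frac_kernel \<gamma> s * F (w s)) (at s)"
        unfolding w_def by (simp add: has_real_derivative_iff_has_vector_derivative mult.commute)
    qed
    have nn: "frac_kernel \<gamma> s * F (w s) \<ge> 0" if "s \<in> {0..t}" for s
      using that t wz[of s] Fmono[of z "w s"] Fz frac_kernel_nonneg[OF g(1)] by (intro mult_nonneg_nonneg) auto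
    have "(\<integral>\<^sup>+s. ennreal (indicator {0..t} s * (frac_kernel \<gamma> s * F (w s))) \<partial>lborel) = ennreal (w t - z)"
      using nn_integral_has_integral_lebesgue[OF nn hi] w0 by simp
    moreover have "(\<integral>\<^sup>+s. ennreal (indicator {0..t} s * (frac_kernel \<gamma> s * F (w s))) \<partial>lborel) = ennreal (LINT s|lborel. indicator {0..t} s * (frac_kernel \<gamma> s * F (w s)))"
      using nn integrable_frac_kernel_mult(2)[OF g(1) _ Fwcont[OF t(2)]] t
      by (intro nn_integral_eq_integral) (auto simp: indicator_def)
    moreover have "(LINT s|lborel. indicator {0..t} s * (frac_kernel \<gamma> s * F (w s))) \<ge> 0"
      using nn by (intro Bochner_Integration.integral_nonneg) (auto simp: indicator_def)
    moreover have "w t - z \<ge> 0" using wz[of t] t by simp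
    ultimately show ?thesis by (metis ennreal_inj)
  qed
  have main: "Z t > w t" if t: "0 \<le> t" "t < ts" for t
  proof (rule ccontr)
    assume Zw: "\<not> Z t > w t"
    define S where "S = {s \<in> {0..t}. Z s \<le> w s}"
    have "closed S" unfolding S_def
      using t tsT by (intro continuous_on_closed_Collect_le wcont continuous_on_subset[OF cont]) auto
    moreover have "bounded S" by (rule bounded_subset[of "{0..t}"]) (auto simp: S_def)
    ultimately have "compact S" by (simp add: compact_eq_bounded_closed)
    moreover have "S \<noteq> {}" using Zw t by (auto simp: S_def)
    ultimately obtain t1 where t1: "t1 \<in> S" "\<And>s. s \<in> S \<Longrightarrow> t1 \<le> s"
      using compact_attains_inf by metis
    have t1t: "0 \<le> t1" "t1 \<le> t" "Z t1 \<le> w t1" using t1 by (auto simp: S_def)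
    have "0 \<notin> S" using w0 z Z00 by (auto simp: S_def)
    hence t1p: "t1 > 0" using t1 t1t by (cases "t1 = 0") auto
    have t1s: "t1 < ts" "t1 \<le> T" using t1t t tsT by auto
    have gt: "Z s > w s" if "0 \<le> s" "s < t1" for s
      using t1(2)[of s] that t1t by (auto simp: S_def not_le[symmetric])
    \<comment> \<open>At the first contact time: the integral equation of \<open>w\<close>,
      rearrangement to the kernel at t1 - s, monotonicity of F and the inequality for Z together
      give w t1 < Z t1, contradicting the contact.\<close>
    have "w t1 < Z0 + (LINT s|lborel. indicator {0..t1} s * (frac_kernel \<gamma> s * F (w s)))"
      using wint[OF t1p t1s(1)] z by simp
    also have "(LINT s|lborel. indicator {0..t1} s * (frac_kernel \<gamma> s * F (w s))) \<le> (LINT s|lborel. indicator {0..t1} s * (frac_kernel \<gamma> (t1 - s) * F (w s)))"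
      by (intro frac_kernel_rearrangement g t1p Fwcont t1s Fmono wmono wz) (use t1s in auto)
    also have "\<dots> \<le> (LINT s|lborel. indicator {0..t1} s * (frac_kernel \<gamma> (t1 - s) * F (Z s)))"
    proof (rule integral_mono)
      show "integrable lborel (\<lambda>s. indicator {0..t1} s * (frac_kernel \<gamma> (t1 - s) * F (w s)))"
        by (intro integrable_frac_kernel_mult g t1t Fwcont t1s)
      have F0: "continuous_on {0..} F" unfolding F_def using p by (intro continuous_intros continuous_on_powr') auto
      have "continuous_on {0..t1} (\<lambda>s. F (Z s))"
        by (rule continuous_on_compose2[OF F0 continuous_on_subset[OF cont]]) (use t1s Znn in auto)
      thus "integrable lborel (\<lambda>s. indicator {0..t1} s * (frac_kernel \<gamma> (t1 - s) * F (Z s)))"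
        by (intro integrable_frac_kernel_mult g t1t)
      fix s :: real
      show "indicator {0..t1} s * (frac_kernel \<gamma> (t1 - s) * F (w s)) \<le> indicator {0..t1} s * (frac_kernel \<gamma> (t1 - s) * F (Z s))"
      proof (cases "0 \<le> s \<and> s < t1")
        case True
        hence "F (w s) \<le> F (Z s)" using t1s gt[of s] wz[of s] by (intro Fmono) auto
        thus ?thesis using frac_kernel_nonneg[OF g(1)] by (intro mult_left_mono) auto
      next
        case False
        thus ?thesis by (cases "s = t1") (auto simp: indicator_def)
      qed
    qed
    finally have "w t1 < Z0 + (LINT s|lborel. indicator {0..t1} s * (frac_kernel \<gamma> (t1 - s) * F (Z s)))" by simp
    also have "\<dots> \<le> Z t1" unfolding F_def
    proof (rule Zineq[OF t1p t1s(2)])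
      fix s assume "0 \<le> s" "s < t1"
      thus "2 \<le> Z s" using gt[of s] wz[of s] z2 t1s by linarith
    qed
    finally show False using t1t by simp
  qed
  \<comment> \<open>Beyond \<open>ts\<close> the continuous Z would still be bounded by some C, and
    w lies below it. In terms of W = w^(1-p) this reads C^(1-p) <= W, while W tends to 0 at
    \<open>ts\<close>.\<close>
  obtain C where C: "\<And>s. s \<in> {0..T} \<Longrightarrow> \<bar>Z s\<bar> \<le> C"
    using compact_imp_bounded[OF compact_continuous_image[OF cont compact_Icc]] unfolding bounded_iff by (metis imageI real_norm_def)
  have C0: "C > 0" using C[of 0] Z00 z z2 T by force
  have low: "C powr (1 - p) \<le> W (h t)" if "0 \<le> t" "t < ts" for t
  proof -
    have ht: "0 \<le> h t" "h t < \<tau>s" using hlt[OF that] hnn by auto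
    have "w t \<le> C" using main[OF that] C[of t] that tsT by auto
    moreover have "w t > 0" using wz[OF that] z2 by linarith
    ultimately have "C powr (1 - p) \<le> w t powr (1 - p)" using p by (intro powr_mono2') auto
    also have "\<dots> = W (h t)" using Wpos[OF ht(2)] p by (simp add: w_def y_def powr_powr)
    finally show ?thesis .
  qed
  have "((\<lambda>t. W (h t)) \<longlongrightarrow> W (h ts)) (at_left ts)"
    unfolding W_def h_def using ts G by (intro tendsto_intros) auto
  moreover have "W (h ts) = 0" using G by (simp add: h_def ts_powr Wts)
  ultimately have "((\<lambda>t. W (h t)) \<longlongrightarrow> 0) (at_left ts)" by simp
  moreover have "\<forall>\<^sub>F t in at_left ts. C powr (1 - p) \<le> W (h t)"
    using eventually_at_left_real[OF ts] by eventually_elim (use low in auto)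
  ultimately have "C powr (1 - p) \<le> 0" by (rule tendsto_lowerbound) simp
  thus False using C0 by simp
qed

text \<open>The bound is continuous in z, so z may increase to Z0. The nonzero base
  \<open>nz\<close> secures continuity of the outer power.\<close>

lemma fractional_blowup_bound:
  fixes Z :: "real \<Rightarrow> real"
  assumes g: "0 < \<gamma>" "\<gamma> < 1" and p: "1 < p"
    and z: "2 powr (p / (p - 1)) < Z0"
    and "continuous_on {0..T} Z" "T \<ge> 0" "Z 0 \<ge> Z0" "\<And>t. 0 \<le> t \<Longrightarrow> t \<le> T \<Longrightarrow> Z t \<ge> 0"
    and "\<And>t. 0 < t \<Longrightarrow> t \<le> T \<Longrightarrow> (\<And>s. 0 \<le> s \<Longrightarrow> s < t \<Longrightarrow> Z s \<ge> 2) \<Longrightarrow>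
       Z t \<ge> Z0 + (LINT s|lborel. indicator {0..t} s * (frac_kernel \<gamma> (t - s) * (2 powr (1 - p) * Z s powr p - 2 * Z s)))"
  shows "T \<le> (ln (1 - 2 powr p * Z0 powr (1 - p)) / (2 * (1 - p)) * Gamma (\<gamma> + 1)) powr (1 / \<gamma>)"
proof -
  define B where "B = (\<lambda>z. (ln (1 - 2 powr p * z powr (1 - p)) / (2 * (1 - p)) * Gamma (\<gamma> + 1)) powr (1 / \<gamma>))"
  have Zp: "Z0 > 0" using z by (smt (verit) powr_gt_zero)
  have "2 powr p * Z0 powr (1 - p) < 1" by (rule two_powr_times_less_one[OF p z])
  hence L: "1 - 2 powr p * Z0 powr (1 - p) > 0" "1 - 2 powr p * Z0 powr (1 - p) < 1" using Zp by auto
  have G: "Gamma (\<gamma> + 1) > 0" using g by (intro Gamma_real_pos) auto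
  have "ln (1 - 2 powr p * Z0 powr (1 - p)) < 0" using L by (simp add: ln_less_zero)
  hence nz: "ln (1 - 2 powr p * Z0 powr (1 - p)) / (2 * (1 - p)) * Gamma (\<gamma> + 1) \<noteq> 0" using p G by simp
  have "(B \<longlongrightarrow> B Z0) (at_left Z0)"
    unfolding B_def using L Zp p nz by (intro tendsto_intros) auto
  moreover have "\<forall>\<^sub>F y in at_left Z0. T \<le> B y"
    using eventually_at_left_real[OF z]
  proof eventually_elim
    case (elim y)
    thus ?case unfolding B_def using assms by (intro fractional_blowup_bound_strict[where Z = Z and ?Z0.0 = Z0]) auto
  qed
  ultimately have "T \<le> B Z0" by (rule tendsto_lowerbound) simp
  thus ?thesis by (simp add: B_def)
qed

section \<open>Mild solutions\<close>

text \<open>By Tonelli it suffices to test \<open>S_op\<close> at each \<tau>. There \<gamma>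
  r^(\<gamma>-1) times the averaged exponential of \<open>frac_avg_chi_ge\<close> is the scalar
  kernel \<open>resolvent \<gamma> \<gamma> r\<close> with r = t - \<tau>.\<close>

lemma duhamel_chi_ge:
  fixes f :: "real \<Rightarrow> 'a::euclidean_space \<Rightarrow> real"
  assumes g: "0 < \<gamma>" "\<gamma> < 1" and meas [measurable]: "(\<lambda>(\<tau>, y). f \<tau> y) \<in> borel_measurable (borel \<Otimes>\<^sub>M borel)"
    and f: "\<And>\<tau> y. 0 \<le> f \<tau> y" "\<And>\<tau> y. f \<tau> y \<le> M" and t: "t \<ge> 0"
  defines "D \<equiv> \<lambda>x. LINT \<tau>:{0..t}|lborel. (t - \<tau>) powr (\<gamma> - 1) * S_op \<gamma> (t - \<tau>) (f \<tau>) x"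
  shows "(\<integral>\<^sup>+\<tau>. ennreal (indicator {0..t} \<tau> * resolvent \<gamma> \<gamma> (t - \<tau>)) * chi_mass (f \<tau>) \<partial>lborel)
      \<le> chi_mass D"
    and "0 \<le> D x" and "D \<in> borel_measurable borel"
proof -
  have fm [measurable]: "f \<tau> \<in> borel_measurable borel" for \<tau> by measurable
  define q where "q = (\<lambda>\<tau> x. indicator {0..t} \<tau> * ((t - \<tau>) powr (\<gamma> - 1) * (\<gamma> * frac_avg \<gamma> 1 (t - \<tau>) (f \<tau>) x)))"
  have qm [measurable]: "(\<lambda>(\<tau>, x). q \<tau> x) \<in> borel_measurable (borel \<Otimes>\<^sub>M borel)"
    unfolding q_def by measurable
  have Dq: "D x = (LINT \<tau>|lborel. q \<tau> x)" for x
    by (simp add: D_def set_lebesgue_integral_def S_op_eq q_def)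
  have q0: "0 \<le> q \<tau> x" for \<tau> x
    using frac_avg_nn(2)[OF g fm f] g by (simp add: q_def)
  define K where "K = \<gamma> * (M * (fact 1 / Gamma (\<gamma> * real 1 + 1)))"
  have G: "Gamma \<gamma> > 0" using g by (intro Gamma_real_pos) auto
  have iK: "integrable lborel (\<lambda>\<tau>. K * Gamma \<gamma> * (indicator {0..t} \<tau> * frac_kernel \<gamma> (t - \<tau>)))"
    using has_bochner_integral_frac_kernel_reflected[OF g(1) t] by (simp add: has_bochner_integral_iff)
  have qint: "integrable lborel (\<lambda>\<tau>. q \<tau> x)" for x
  proof (rule Bochner_Integration.integrable_bound[OF iK])
    show "AE \<tau> in lborel. norm (q \<tau> x) \<le> norm (K * Gamma \<gamma> * (indicator {0..t} \<tau> * frac_kernel \<gamma> (t - \<tau>)))"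
    proof (rule AE_I2)
      fix \<tau> :: real
      have "\<gamma> * frac_avg \<gamma> 1 (t - \<tau>) (f \<tau>) x \<le> K"
        unfolding K_def using frac_avg_nn(3)[OF g fm f, of 1 "t - \<tau>" \<tau> x] g by (intro mult_left_mono) auto
      hence "indicator {0..t} \<tau> * (t - \<tau>) powr (\<gamma> - 1) * (\<gamma> * frac_avg \<gamma> 1 (t - \<tau>) (f \<tau>) x) \<le> indicator {0..t} \<tau> * (t - \<tau>) powr (\<gamma> - 1) * K"
        by (intro mult_left_mono) auto
      hence "q \<tau> x \<le> K * Gamma \<gamma> * (indicator {0..t} \<tau> * frac_kernel \<gamma> (t - \<tau>))"
        using G by (simp add: q_def frac_kernel_def mult_ac)
      with q0[of \<tau> x] show "norm (q \<tau> x) \<le> norm (K * Gamma \<gamma> * (indicator {0..t} \<tau> * frac_kernel \<gamma> (t - \<tau>)))" by simp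
    qed
  qed measurable
  have Dnn: "ennreal (D x) = (\<integral>\<^sup>+\<tau>. ennreal (q \<tau> x) \<partial>lborel)" for x
    unfolding Dq by (rule nn_integral_eq_integral[symmetric, OF qint]) (simp add: q0)
  show D0: "0 \<le> D x" for x unfolding Dq by (intro Bochner_Integration.integral_nonneg q0)
  show "D \<in> borel_measurable borel" unfolding Dq by measurable
  have "(\<integral>\<^sup>+\<tau>. ennreal (indicator {0..t} \<tau> * resolvent \<gamma> \<gamma> (t - \<tau>)) * chi_mass (f \<tau>) \<partial>lborel)
     \<le> (\<integral>\<^sup>+\<tau>. \<integral>\<^sup>+x. ennreal (q \<tau> x) * ennreal (chi x) \<partial>lborel \<partial>lborel)"
  proof (rule nn_integral_mono)
    fix \<tau> :: real
    let ?I = "\<integral>\<^sup>+x. ennreal (f \<tau> x * chi x) \<partial>lborel"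
    show "ennreal (indicator {0..t} \<tau> * resolvent \<gamma> \<gamma> (t - \<tau>)) * ?I \<le> (\<integral>\<^sup>+x. ennreal (q \<tau> x) * ennreal (chi x) \<partial>lborel)"
    proof (cases "0 \<le> \<tau> \<and> \<tau> < t")
      case False
      thus ?thesis by (cases "\<tau> = t") (auto simp: indicator_def)
    next
      case True
      define r where "r = t - \<tau>"
      have r: "r > 0" using True by (simp add: r_def)
      define c where "c = \<gamma> * r powr (\<gamma> - 1)"
      have c: "c > 0" using g r by (simp add: c_def)
      have "has_bochner_integral lborel (\<lambda>\<theta>. (1 / c) * (c * (indicator {0<..} \<theta> * (\<theta> * mainardi \<gamma> \<theta> * exp (- (r powr \<gamma> * \<theta>)))))) ((1 / c) * resolvent \<gamma> \<gamma> r)"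
        unfolding c_def by (intro has_bochner_integral_mult_right resolvent_gamma_eq g r)
      hence hb: "has_bochner_integral lborel (\<lambda>\<theta>. indicator {0<..} \<theta> * (\<theta> ^ 1 * mainardi \<gamma> \<theta> * exp (- (r powr \<gamma> * \<theta>)))) ((1 / c) * resolvent \<gamma> \<gamma> r)"
        using c by simp
      have R0: "resolvent \<gamma> \<gamma> r \<ge> 0" using r by (intro resolvent_nonneg g) auto
      have "ennreal (resolvent \<gamma> \<gamma> r) * ?I = ennreal c * (ennreal ((1 / c) * resolvent \<gamma> \<gamma> r) * ?I)"
        using c R0 by (simp add: mult.assoc[symmetric] ennreal_mult[symmetric])
      also have "\<dots> \<le> ennreal c * chi_mass (frac_avg \<gamma> 1 r (f \<tau>))"
        by (intro mult_left_mono frac_avg_chi_ge[OF g fm f r hb]) simp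
      also have "\<dots> = (\<integral>\<^sup>+x. ennreal (q \<tau> x) * ennreal (chi x) \<partial>lborel)"
      proof (subst nn_integral_cmult[symmetric], measurable, rule nn_integral_cong)
        fix x
        have "q \<tau> x = c * frac_avg \<gamma> 1 r (f \<tau>) x" using True by (simp add: q_def c_def r_def)
        thus "ennreal c * ennreal (frac_avg \<gamma> 1 r (f \<tau>) x * chi x) = ennreal (q \<tau> x) * ennreal (chi x)"
          using c frac_avg_nn(2)[OF g fm f] by (simp add: ennreal_mult[symmetric] chi_nonneg mult.assoc)
      qed
      finally show ?thesis using True by (simp add: r_def)
    qed
  qed
  also have "\<dots> = (\<integral>\<^sup>+x. \<integral>\<^sup>+\<tau>. ennreal (q \<tau> x) * ennreal (chi x) \<partial>lborel \<partial>lborel)"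
    by (intro lborel_pair.Fubini') measurable
  also have "\<dots> = chi_mass D"
  proof (rule nn_integral_cong)
    fix x :: 'a
    have "(\<integral>\<^sup>+\<tau>. ennreal (q \<tau> x) * ennreal (chi x) \<partial>lborel) = ennreal (D x) * ennreal (chi x)"
      unfolding Dnn by (intro nn_integral_multc) measurable
    thus "(\<integral>\<^sup>+\<tau>. ennreal (q \<tau> x) * ennreal (chi x) \<partial>lborel) = ennreal (D x * chi x)"
      using D0 by (simp add: ennreal_mult chi_nonneg)
  qed
  finally show "(\<integral>\<^sup>+\<tau>. ennreal (indicator {0..t} \<tau> * resolvent \<gamma> \<gamma> (t - \<tau>)) * chi_mass (f \<tau>) \<partial>lborel)
      \<le> chi_mass D" .
qed

text \<open>The resolvent equation without subtraction, as sums in \<open>ennreal\<close> demand; it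
  rests on the sign of the resolvents.\<close>

lemma resolvent_equation_nn:
  assumes g: "0 < \<gamma>" "\<gamma> < 1" and b: "b = 1 \<or> b = \<gamma>" and t: "t > 0"
  shows "ennreal (resolvent \<gamma> b t) + (\<integral>\<^sup>+s. ennreal (indicator {0..t} s * frac_kernel \<gamma> (t - s)) * ennreal (resolvent \<gamma> b s) \<partial>lborel) = ennreal (frac_kernel b t)"
proof -
  have b0: "b > 0" using b g by auto
  note re = resolvent_equation[OF g(1) b0 t]
  have nn: "0 \<le> indicator {0..t} s * (frac_kernel \<gamma> (t - s) * resolvent \<gamma> b s)" for s
    using resolvent_nonneg[OF g b, of s] frac_kernel_nonneg[OF g(1)] by (auto simp: indicator_def)
  have "(\<integral>\<^sup>+s. ennreal (indicator {0..t} s * frac_kernel \<gamma> (t - s)) * ennreal (resolvent \<gamma> b s) \<partial>lborel)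
      = (\<integral>\<^sup>+s. ennreal (indicator {0..t} s * (frac_kernel \<gamma> (t - s) * resolvent \<gamma> b s)) \<partial>lborel)"
  proof (rule nn_integral_cong)
    fix s show "ennreal (indicator {0..t} s * frac_kernel \<gamma> (t - s)) * ennreal (resolvent \<gamma> b s) = ennreal (indicator {0..t} s * (frac_kernel \<gamma> (t - s) * resolvent \<gamma> b s))"
      using resolvent_nonneg[OF g b, of s] frac_kernel_nonneg[OF g(1)] by (auto simp: indicator_def ennreal_mult)
  qed
  also have "\<dots> = ennreal (frac_kernel b t - resolvent \<gamma> b t)"
    using re nn by (subst nn_integral_eq_integral) (auto simp: has_bochner_integral_iff)
  finally have eq: "(\<integral>\<^sup>+s. ennreal (indicator {0..t} s * frac_kernel \<gamma> (t - s)) * ennreal (resolvent \<gamma> b s) \<partial>lborel) = ennreal (frac_kernel b t - resolvent \<gamma> b t)" .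
  have "0 \<le> frac_kernel b t - resolvent \<gamma> b t"
    unfolding has_bochner_integral_integral_eq[OF re, symmetric] by (intro Bochner_Integration.integral_nonneg nn)
  thus ?thesis unfolding eq using resolvent_nonneg[OF g b, of t] t by (simp flip: ennreal_plus)
qed

text \<open>Applying the positive operator \<open>I + I\<^sup>\<gamma>\<close> to the variation-of-constants inequality
  removes the Mittag-Leffler kernels.\<close>

lemma volterra_inequality:
  fixes Z G :: "real \<Rightarrow> ennreal"
  assumes g: "0 < \<gamma>" "\<gamma> < 1" and [measurable]: "Z \<in> borel_measurable borel" "G \<in> borel_measurable borel" and t: "t > 0"
    and ineq: "\<And>s. 0 \<le> s \<Longrightarrow> s \<le> t \<Longrightarrow> ennreal (resolvent \<gamma> 1 s) * z + (\<integral>\<^sup>+r. ennreal (indicator {0..s} r * resolvent \<gamma> \<gamma> (s - r)) * G r \<partial>lborel) \<le> Z s"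
  shows "z + (\<integral>\<^sup>+s. ennreal (indicator {0..t} s * frac_kernel \<gamma> (t - s)) * G s \<partial>lborel)
      \<le> Z t + (\<integral>\<^sup>+s. ennreal (indicator {0..t} s * frac_kernel \<gamma> (t - s)) * Z s \<partial>lborel)"
proof -
  define k where "k = (\<lambda>s. ennreal (indicator {0..t} s * frac_kernel \<gamma> (t - s)))"
  have [measurable]: "k \<in> borel_measurable borel" unfolding k_def by measurable
  define E where "E = (\<lambda>s r. ennreal (indicator {0..s} r * resolvent \<gamma> \<gamma> (s - r)))"
  have ind: "indicator {0..s} r = (if 0 \<le> r \<and> r \<le> s then 1 else 0 :: real)" for s r :: real by (simp add: indicator_def)
  have [measurable]: "(\<lambda>(s, r). E s r) \<in> borel_measurable (borel \<Otimes>\<^sub>M borel)"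
    unfolding E_def ind by measurable
  define A where "A = (\<lambda>s. \<integral>\<^sup>+r. E s r * G r \<partial>lborel)"
  have [measurable]: "A \<in> borel_measurable borel" unfolding A_def by measurable
  \<comment> \<open>I + I^\<gamma> maps \<open>resolvent \<gamma> 1\<close> to
    \<open>frac_kernel 1\<close>, which is 1 for t > 0: this is the factor of the initial
    mass.\<close>
  have k1: "ennreal (resolvent \<gamma> 1 t) + (\<integral>\<^sup>+s. k s * ennreal (resolvent \<gamma> 1 s) \<partial>lborel) = 1"
    unfolding k_def using resolvent_equation_nn[OF g _ t, of 1] t by (simp add: frac_kernel_def)
  \<comment> \<open>The same for the convolution kernel: I + I^\<gamma> maps
    \<open>resolvent \<gamma> \<gamma>\<close> started at r to \<open>frac_kernel \<gamma>\<close>.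
    By Tonelli this handles the whole convolution with \<open>G\<close>.\<close>
  have kE: "k r \<le> E t r + (\<integral>\<^sup>+s. k s * E s r \<partial>lborel)" for r
  proof (cases "0 \<le> r \<and> r < t")
    case False
    hence "k r = 0" by (cases "r = t") (auto simp: k_def indicator_def)
    thus ?thesis by simp
  next
    case True
    have "(\<integral>\<^sup>+s. k s * E s r \<partial>lborel) = (\<integral>\<^sup>+s. k (r + s) * E (r + s) r \<partial>lborel)"
      by (rule nn_integral_lborel_translate) measurable
    also have "\<dots> = (\<integral>\<^sup>+s. ennreal (indicator {0..t-r} s * frac_kernel \<gamma> ((t - r) - s)) * ennreal (resolvent \<gamma> \<gamma> s) \<partial>lborel)"
      using True by (intro nn_integral_cong) (auto simp: k_def E_def indicator_def algebra_simps)
    finally have "E t r + (\<integral>\<^sup>+s. k s * E s r \<partial>lborel) = ennreal (resolvent \<gamma> \<gamma> (t - r)) + (\<integral>\<^sup>+s. ennreal (indicator {0..t-r} s * frac_kernel \<gamma> ((t - r) - s)) * ennreal (resolvent \<gamma> \<gamma> s) \<partial>lborel)"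
      using True by (simp add: E_def)
    also have "\<dots> = ennreal (frac_kernel \<gamma> (t - r))" using True by (intro resolvent_equation_nn g) auto
    also have "\<dots> = k r" using True by (simp add: k_def)
    finally show ?thesis by simp
  qed
  have kA: "(\<integral>\<^sup>+s. k s * G s \<partial>lborel) \<le> A t + (\<integral>\<^sup>+s. k s * A s \<partial>lborel)"
  proof -
    have "(\<integral>\<^sup>+s. k s * A s \<partial>lborel) = (\<integral>\<^sup>+s. \<integral>\<^sup>+r. k s * E s r * G r \<partial>lborel \<partial>lborel)"
      unfolding A_def by (intro nn_integral_cong) (subst nn_integral_cmult[symmetric], measurable, simp add: mult.assoc)
    also have "\<dots> = (\<integral>\<^sup>+r. \<integral>\<^sup>+s. k s * E s r * G r \<partial>lborel \<partial>lborel)"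
      by (intro lborel_pair.Fubini') measurable
    also have "\<dots> = (\<integral>\<^sup>+r. (\<integral>\<^sup>+s. k s * E s r \<partial>lborel) * G r \<partial>lborel)"
      by (intro nn_integral_cong nn_integral_multc) measurable
    finally have "A t + (\<integral>\<^sup>+s. k s * A s \<partial>lborel) = (\<integral>\<^sup>+r. E t r * G r + (\<integral>\<^sup>+s. k s * E s r \<partial>lborel) * G r \<partial>lborel)"
      unfolding A_def by (subst nn_integral_add) auto
    also have "\<dots> = (\<integral>\<^sup>+r. (E t r + (\<integral>\<^sup>+s. k s * E s r \<partial>lborel)) * G r \<partial>lborel)"
      by (simp add: ring_distribs)
    also have "\<dots> \<ge> (\<integral>\<^sup>+s. k s * G s \<partial>lborel)" by (intro nn_integral_mono mult_right_mono kE) simp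
    finally show ?thesis .
  qed
  have ineq': "ennreal (resolvent \<gamma> 1 s) * z + A s \<le> Z s" if "0 \<le> s" "s \<le> t" for s
    using ineq[OF that] by (simp add: A_def E_def)
  have "z + (\<integral>\<^sup>+s. k s * G s \<partial>lborel) \<le> (ennreal (resolvent \<gamma> 1 t) + (\<integral>\<^sup>+s. k s * ennreal (resolvent \<gamma> 1 s) \<partial>lborel)) * z + (A t + (\<integral>\<^sup>+s. k s * A s \<partial>lborel))"
    unfolding k1 using kA by (simp add: add_left_mono)
  also have "\<dots> = (ennreal (resolvent \<gamma> 1 t) * z + A t) + ((\<integral>\<^sup>+s. k s * ennreal (resolvent \<gamma> 1 s) * z \<partial>lborel) + (\<integral>\<^sup>+s. k s * A s \<partial>lborel))"
    by (subst nn_integral_multc) (auto simp: ring_distribs add_ac)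
  also have "(\<integral>\<^sup>+s. k s * ennreal (resolvent \<gamma> 1 s) * z \<partial>lborel) + (\<integral>\<^sup>+s. k s * A s \<partial>lborel) = (\<integral>\<^sup>+s. k s * (ennreal (resolvent \<gamma> 1 s) * z + A s) \<partial>lborel)"
    by (subst nn_integral_add[symmetric]) (auto simp: ring_distribs mult.assoc)
  also have "(ennreal (resolvent \<gamma> 1 t) * z + A t) + \<dots> \<le> Z t + (\<integral>\<^sup>+s. k s * Z s \<partial>lborel)"
  proof (intro add_mono ineq' nn_integral_mono)
    fix s
    show "k s * (ennreal (resolvent \<gamma> 1 s) * z + A s) \<le> k s * Z s"
      using ineq'[of s] by (cases "s \<in> {0..t}") (auto simp: k_def intro!: mult_left_mono)
  qed (use t in auto)
  finally show ?thesis by (simp add: k_def)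
qed

text \<open>Convexity on (0, infinity), where the power is differentiable; x = 0 is checked by
  hand.\<close>

lemma powr_above_tangent:
  fixes a x p :: real
  assumes a: "a > 0" and x: "x \<ge> 0" and p: "p \<ge> 1"
  shows "a powr p + p * a powr (p - 1) * (x - a) \<le> x powr p"
proof (cases "x = 0")
  case True
  have "a powr p = a powr (p - 1) * a" using a by (simp add: powr_diff)
  thus ?thesis using True p a by (simp add: algebra_simps mult_le_cancel_right1)
next
  case False
  with x have x: "x > 0" by simp
  have "(\<lambda>x. x powr p) x - (\<lambda>x. x powr p) a \<ge> (p * a powr (p - 1)) * (x - a)"
    by (rule convex_on_imp_above_tangent[where A = "{0<..}"])
       (use a x p in \<open>auto intro!: powr_convex derivative_eq_intros simp: interior_open\<close>)
  thus ?thesis by simp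
qed

text \<open>Convexity at the mean (U + V) / 2 gives the factor 2^(1-p). The exponent q is lowered to
  p at the cost of 1, which covers the range U < 1 where U^q may be below U^p.\<close>

lemma two_powers_ge:
  fixes U V p q :: real
  assumes "U \<ge> 0" "V \<ge> 0" "1 < p" "p \<le> q"
  shows "2 powr (1 - p) * (U + V) powr p - 1 \<le> V powr p + U powr q"
proof -
  have 1: "U powr p - 1 \<le> U powr q"
  proof (cases "U \<ge> 1")
    case True
    hence "U powr p \<le> U powr q" using assms by (intro powr_mono) auto
    thus ?thesis by simp
  next
    case False
    hence "U powr p \<le> 1 powr p" using assms by (intro powr_mono2) auto
    moreover have "0 \<le> U powr q" by simp
    ultimately show ?thesis unfolding powr_one_eq_one by linarith
  qed
  have 2: "2 powr (1 - p) * (U + V) powr p \<le> U powr p + V powr p"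
  proof (cases "U + V = 0")
    case False
    define a where "a = (U + V) / 2"
    have a: "a > 0" using False assms by (simp add: a_def)
    have "2 * a powr p + p * a powr (p - 1) * (U - a + (V - a)) \<le> U powr p + V powr p"
      using powr_above_tangent[OF a assms(1), of p] powr_above_tangent[OF a assms(2), of p] assms(3) by (simp add: algebra_simps)
    moreover have "U - a + (V - a) = 0" by (simp add: a_def)
    moreover have "2 * a powr p = 2 powr (1 - p) * (U + V) powr p"
      using assms by (simp add: a_def powr_divide powr_diff)
    ultimately show ?thesis by simp
  qed (use assms in simp)
  show ?thesis using 1 2 by linarith
qed

lemma integrable_bounded_chi:
  fixes w :: "'a::euclidean_space \<Rightarrow> real"
  assumes chi: "integrable lborel (chi :: 'a \<Rightarrow> real)" and [measurable]: "w \<in> borel_measurable borel" and w: "\<And>x. \<bar>w x\<bar> \<le> M"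
  shows "integrable lborel (\<lambda>x. w x * chi x)"
proof (rule Bochner_Integration.integrable_bound)
  show "integrable lborel (\<lambda>x::'a. M * chi x)" by (intro integrable_mult_right chi)
  have "M \<ge> 0" using w[of 0] by linarith
  thus "AE x in lborel. norm (w x * chi x) \<le> norm (M * chi x)"
    using w chi_nonneg by (intro AE_I2) (auto simp: abs_mult intro!: mult_right_mono)
qed measurable

text \<open>The tangent inequality at the mean V is integrated against \<open>chi\<close>; its
  linear term vanishes because \<open>chi\<close> has mass 1.\<close>

lemma powr_chi_jensen:
  fixes w :: "'a::euclidean_space \<Rightarrow> real"
  assumes chi: "has_bochner_integral lborel (chi :: 'a \<Rightarrow> real) 1" and [measurable]: "w \<in> borel_measurable borel"
    and w: "\<And>x. 0 \<le> w x" "\<And>x. w x \<le> M" and p: "p \<ge> 1"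
  shows "(LINT x|lborel. w x * chi x) powr p \<le> (LINT x|lborel. w x powr p * chi x)"
proof -
  define V where "V = (LINT x|lborel. w x * chi x)"
  have ic: "integrable lborel (chi :: 'a \<Rightarrow> real)" "(LINT x|lborel. chi (x::'a)) = 1" using chi by (auto simp: has_bochner_integral_iff)
  have iw: "integrable lborel (\<lambda>x. w x * chi x)" using w by (intro integrable_bounded_chi[OF ic(1), where M = M]) auto
  have ip: "integrable lborel (\<lambda>x. w x powr p * chi x)" using w p
    by (intro integrable_bounded_chi[OF ic(1), where M = "M powr p"]) (auto intro!: powr_mono2)
  have "V \<ge> 0" unfolding V_def using w chi_nonneg by (intro Bochner_Integration.integral_nonneg mult_nonneg_nonneg)
  show ?thesis
  proof (cases "V = 0")
    case True
    have "(LINT x|lborel. w x powr p * chi x) \<ge> 0" using chi_nonneg by (intro Bochner_Integration.integral_nonneg mult_nonneg_nonneg) auto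
    thus ?thesis using True by (simp add: V_def)
  next
    case False
    with \<open>V \<ge> 0\<close> have V: "V > 0" by simp
    have "V powr p = (LINT x|lborel. V powr p * chi x + p * V powr (p - 1) * (w x * chi x - V * chi x))"
      using ic iw by (simp add: V_def[symmetric])
    also have "\<dots> \<le> (LINT x|lborel. w x powr p * chi x)"
    proof (rule integral_mono[OF _ ip])
      show "integrable lborel (\<lambda>x. V powr p * chi x + p * V powr (p - 1) * (w x * chi x - V * chi x))" using ic iw by simp
      fix x
      have "(V powr p + p * V powr (p - 1) * (w x - V)) * chi x \<le> w x powr p * chi x"
        by (intro mult_right_mono powr_above_tangent V w p chi_nonneg)
      thus "V powr p * chi x + p * V powr (p - 1) * (w x * chi x - V * chi x) \<le> w x powr p * chi x" by (simp add: algebra_simps)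
    qed
    finally show ?thesis by (simp add: V_def)
  qed
qed

section \<open>Paths in C0 that are continuous in the sup norm\<close>

lemma C0_bounded:
  assumes "w \<in> C0"
  obtains M where "\<And>x. \<bar>w x\<bar> \<le> M"
proof -
  have c: "continuous_on UNIV w" and l: "(w \<longlongrightarrow> 0) at_infinity" using assms by (auto simp: C0_def)
  have "\<forall>\<^sub>F x in at_infinity. dist (w x) 0 < 1" using l by (rule tendstoD) simp
  then obtain b where b: "\<And>x. norm x \<ge> b \<Longrightarrow> \<bar>w x\<bar> < 1" unfolding eventually_at_infinity by auto
  have "bounded (w ` cball 0 b)"
    by (intro compact_imp_bounded compact_continuous_image continuous_on_subset[OF c]) auto
  then obtain a where a: "\<And>x. norm x \<le> b \<Longrightarrow> \<bar>w x\<bar> \<le> a"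
    unfolding bounded_iff by (metis imageI mem_cball_0 real_norm_def)
  have "\<bar>w x\<bar> \<le> max a 1" for x using a[of x] b[of x] by (cases "norm x \<le> b") auto
  thus ?thesis using that by blast
qed

lemma C0_measurable: "w \<in> C0 \<Longrightarrow> w \<in> borel_measurable borel"
  by (auto simp: C0_def intro: borel_measurable_continuous_onI)

lemma uniform_path_near:
  fixes u :: "real \<Rightarrow> 'a \<Rightarrow> real"
  assumes "uniform_limit UNIV u (u t) (at t within {0..T})" "e > 0"
  obtains d where "d > 0" "\<And>s x. s \<in> {0..T} \<Longrightarrow> \<bar>s - t\<bar> < d \<Longrightarrow> \<bar>u s x - u t x\<bar> < e"
proof -
  have "\<forall>\<^sub>F s in at t within {0..T}. \<forall>x\<in>UNIV. dist (u s x) (u t x) < e"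
    using assms by (simp add: uniform_limit_iff)
  then obtain d where d: "d > 0" "\<And>s. s \<in> {0..T} \<Longrightarrow> s \<noteq> t \<Longrightarrow> dist s t < d \<Longrightarrow> (\<forall>x. dist (u s x) (u t x) < e)"
    unfolding eventually_at by auto
  have "\<bar>u s x - u t x\<bar> < e" if "s \<in> {0..T}" "\<bar>s - t\<bar> < d" for s x
    using d(2)[of s] that assms(2) by (cases "s = t") (auto simp: dist_real_def)
  thus ?thesis using that d(1) by blast
qed

text \<open>Each time has a neighbourhood with a uniform bound, and finitely many of these cover
  [0,T]; the sum over the cover serves as a common bound.\<close>

lemma C0_path_bounded:
  fixes u :: "real \<Rightarrow> 'a::euclidean_space \<Rightarrow> real"
  assumes u: "\<And>t. t \<in> {0..T} \<Longrightarrow> u t \<in> C0"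
    and lim: "\<And>t. t \<in> {0..T} \<Longrightarrow> uniform_limit UNIV u (u t) (at t within {0..T})"
  obtains M where "\<And>t x. t \<in> {0..T} \<Longrightarrow> \<bar>u t x\<bar> \<le> M"
proof -
  have "\<exists>M d. d > 0 \<and> (\<forall>s\<in>{0..T}. \<bar>s - t\<bar> < d \<longrightarrow> (\<forall>x. \<bar>u s x\<bar> \<le> M))" if t: "t \<in> {0..T}" for t
  proof -
    obtain M where M: "\<And>x. \<bar>u t x\<bar> \<le> M" using C0_bounded[OF u[OF t]] by blast
    obtain d where d: "d > 0" "\<And>s x. s \<in> {0..T} \<Longrightarrow> \<bar>s - t\<bar> < d \<Longrightarrow> \<bar>u s x - u t x\<bar> < 1"
      using uniform_path_near[OF lim[OF t] zero_less_one] by blast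
    have "\<bar>u s x\<bar> \<le> M + 1" if "s \<in> {0..T}" "\<bar>s - t\<bar> < d" for s x
      using M[of x] d(2)[OF that, of x] by linarith
    thus ?thesis using d(1) by blast
  qed
  then obtain M d where Md: "\<And>t. t \<in> {0..T} \<Longrightarrow> d t > 0"
      "\<And>t s x. t \<in> {0..T} \<Longrightarrow> s \<in> {0..T} \<Longrightarrow> \<bar>s - t\<bar> < d t \<Longrightarrow> \<bar>u s x\<bar> \<le> M t"
    by metis
  obtain C where C: "C \<subseteq> {0..T}" "finite C" "{0..T} \<subseteq> (\<Union>t\<in>C. ball t (d t))"
    by (rule compactE_image[of "{0..T}" "{0..T}" "\<lambda>t. ball t (d t)"]) (use Md(1) in force)+
  have "\<bar>u s x\<bar> \<le> (\<Sum>t\<in>C. \<bar>M t\<bar>)" if s: "s \<in> {0..T}" for s x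
  proof -
    obtain t where t: "t \<in> C" "s \<in> ball t (d t)" using C(3) s by auto
    have "\<bar>u s x\<bar> \<le> M t" using t C(1) s by (intro Md(2)) (auto simp: dist_real_def)
    also have "\<dots> \<le> \<bar>M t\<bar>" by simp
    also have "\<dots> \<le> (\<Sum>t\<in>C. \<bar>M t\<bar>)" using t C(2) by (intro member_le_sum) auto
    finally show ?thesis .
  qed
  thus ?thesis using that by blast
qed

text \<open>Clamping time to [0,T] extends the path to a function jointly continuous for all real
  times, so measurability is global in the Tonelli arguments.\<close>

lemma C0_path_measurable:
  fixes u :: "real \<Rightarrow> 'a::euclidean_space \<Rightarrow> real"
  assumes T: "T \<ge> 0" and u: "\<And>t. t \<in> {0..T} \<Longrightarrow> u t \<in> C0"
    and lim: "\<And>t. t \<in> {0..T} \<Longrightarrow> uniform_limit UNIV u (u t) (at t within {0..T})"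
  shows "(\<lambda>(t, x). u (max 0 (min T t)) x) \<in> borel_measurable (borel \<Otimes>\<^sub>M borel)"
proof -
  define c where "c = (\<lambda>t::real. max 0 (min T t))"
  have c: "c t \<in> {0..T}" "\<bar>c s - c t\<bar> \<le> \<bar>s - t\<bar>" for s t using T by (auto simp: c_def)
  have "continuous_on UNIV (\<lambda>(t, x). u (c t) x)"
    unfolding continuous_on_iff
  proof (intro ballI allI impI)
    fix z :: "real \<times> 'a" and e :: real assume e: "e > 0"
    obtain t x where z: "z = (t, x)" by force
    obtain d1 where d1: "d1 > 0" "\<And>s y. s \<in> {0..T} \<Longrightarrow> \<bar>s - c t\<bar> < d1 \<Longrightarrow> \<bar>u s y - u (c t) y\<bar> < e / 2"
      using uniform_path_near[OF lim[OF c(1)], of "e / 2"] e by (metis half_gt_zero)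
    have "continuous_on UNIV (u (c t))" using u[OF c(1)] by (simp add: C0_def)
    then obtain d2 where d2: "d2 > 0" "\<And>y. dist y x < d2 \<Longrightarrow> dist (u (c t) y) (u (c t) x) < e / 2"
      unfolding continuous_on_iff using e by (metis UNIV_I half_gt_zero)
    show "\<exists>d>0. \<forall>z'\<in>UNIV. dist z' z < d \<longrightarrow> dist (case z' of (t, x) \<Rightarrow> u (c t) x) (case z of (t, x) \<Rightarrow> u (c t) x) < e"
    proof (intro exI[of _ "min d1 d2"] conjI ballI impI)
      fix z' assume z': "dist z' z < min d1 d2"
      obtain s y where zz: "z' = (s, y)" by force
      have "\<bar>s - t\<bar> < d1" "dist y x < d2"
        using z' dist_fst_le[of z' z] dist_snd_le[of z' z] by (auto simp: zz z dist_real_def)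
      moreover from this have "\<bar>c s - c t\<bar> < d1" using c(2)[of s t] by linarith
      ultimately have "\<bar>u (c s) y - u (c t) y\<bar> < e / 2" "dist (u (c t) y) (u (c t) x) < e / 2"
        using d1(2)[OF c(1)] d2(2) by blast+
      thus "dist (case z' of (t, x) \<Rightarrow> u (c t) x) (case z of (t, x) \<Rightarrow> u (c t) x) < e"
        unfolding zz z prod.case dist_real_def by linarith
    qed (use d1 d2 in auto)
  qed
  hence "(\<lambda>(t, x). u (c t) x) \<in> borel_measurable borel" by (rule borel_measurable_continuous_onI)
  thus ?thesis unfolding c_def borel_prod .
qed

lemma C0_path_chi_continuous:
  fixes u :: "real \<Rightarrow> 'a::euclidean_space \<Rightarrow> real"
  assumes chi: "has_bochner_integral lborel (chi :: 'a \<Rightarrow> real) 1" and u: "\<And>t. t \<in> {0..T} \<Longrightarrow> u t \<in> C0"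
    and lim: "\<And>t. t \<in> {0..T} \<Longrightarrow> uniform_limit UNIV u (u t) (at t within {0..T})"
  shows "continuous_on {0..T} (\<lambda>t. LINT x|lborel. u t x * chi x)"
  unfolding continuous_on_iff
proof (intro ballI allI impI)
  fix t e :: real assume t: "t \<in> {0..T}" and e: "e > 0"
  have ic: "integrable lborel (chi :: 'a \<Rightarrow> real)" "(LINT x|lborel. chi (x::'a)) = 1" using chi by (auto simp: has_bochner_integral_iff)
  have int: "integrable lborel (\<lambda>x. u s x * chi x)" if "s \<in> {0..T}" for s
    using C0_bounded[OF u[OF that]] integrable_bounded_chi[OF ic(1) C0_measurable[OF u[OF that]]] by blast
  obtain d where d: "d > 0" "\<And>s x. s \<in> {0..T} \<Longrightarrow> \<bar>s - t\<bar> < d \<Longrightarrow> \<bar>u s x - u t x\<bar> < e / 2"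
    using uniform_path_near[OF lim[OF t], of "e / 2"] e by (metis half_gt_zero)
  show "\<exists>d>0. \<forall>s\<in>{0..T}. dist s t < d \<longrightarrow> dist (LINT x|lborel. u s x * chi x) (LINT x|lborel. u t x * chi x) < e"
  proof (intro exI[of _ d] conjI ballI impI d(1))
    fix s assume s: "s \<in> {0..T}" "dist s t < d"
    have "dist (LINT x|lborel. u s x * chi x) (LINT x|lborel. u t x * chi x) = \<bar>LINT x|lborel. u s x * chi x - u t x * chi x\<bar>"
      using int s t by (simp add: dist_real_def)
    also have "\<bar>LINT x|lborel. u s x * chi x - u t x * chi x\<bar> \<le> (LINT x|lborel. e / 2 * chi (x::'a))"
    proof (rule order_trans[OF integral_abs_bound integral_mono])
      show "integrable lborel (\<lambda>x. \<bar>u s x * chi x - u t x * chi x\<bar>)" using int s t by simp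
      show "integrable lborel (\<lambda>x::'a. e / 2 * chi x)" by (intro integrable_mult_right ic)
      fix x
      have "\<bar>u s x * chi x - u t x * chi x\<bar> = \<bar>u s x - u t x\<bar> * chi x"
        using chi_nonneg[of x] by (simp add: abs_mult left_diff_distrib[symmetric])
      also have "\<dots> \<le> e / 2 * chi x" using d(2)[of s x] s by (intro mult_right_mono chi_nonneg) (auto simp: dist_real_def)
      finally show "\<bar>u s x * chi x - u t x * chi x\<bar> \<le> e / 2 * chi x" .
    qed
    also have "\<dots> = e / 2" using ic by simp
    also have "\<dots> < e" using e by simp
    finally show "dist (LINT x|lborel. u s x * chi x) (LINT x|lborel. u t x * chi x) < e" .
  qed
qed

text \<open>A generic component with a prescribed source \<open>f\<close>, so that u and v are
  treated alike. Nonnegative data and source make it nonnegative; the last estimate is the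
  variation-of-constants formula of the scalar equation with zeroth order term, as an
  inequality.\<close>

lemma mild_component_ge:
  fixes f :: "real \<Rightarrow> 'a::euclidean_space \<Rightarrow> real"
  assumes g: "0 < \<gamma>" "\<gamma> < 1" and meas [measurable]: "(\<lambda>(\<tau>, y). f \<tau> y) \<in> borel_measurable (borel \<Otimes>\<^sub>M borel)"
    and f: "\<And>\<tau> y. 0 \<le> f \<tau> y" "\<And>\<tau> y. f \<tau> y \<le> M" and t: "t \<ge> 0"
    and w0: "w0 \<in> borel_measurable borel" "\<And>y. 0 \<le> w0 y" "\<And>y. w0 y \<le> M0"
    and w: "\<And>x. w x = P_op \<gamma> t w0 x + (LINT \<tau>:{0..t}|lborel. (t - \<tau>) powr (\<gamma> - 1) * S_op \<gamma> (t - \<tau>) (f \<tau>) x)"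
  shows "0 \<le> w x" and "t = 0 \<Longrightarrow> w x = w0 x"
    and "ennreal (resolvent \<gamma> 1 t) * chi_mass w0
       + (\<integral>\<^sup>+\<tau>. ennreal (indicator {0..t} \<tau> * resolvent \<gamma> \<gamma> (t - \<tau>)) * chi_mass (f \<tau>) \<partial>lborel)
      \<le> chi_mass w"
proof -
  define D where "D = (\<lambda>x. LINT \<tau>:{0..t}|lborel. (t - \<tau>) powr (\<gamma> - 1) * S_op \<gamma> (t - \<tau>) (f \<tau>) x)"
  have D0: "0 \<le> D x" for x unfolding D_def by (rule duhamel_chi_ge(2)[OF g meas f t])
  have Dm: "D \<in> borel_measurable borel" unfolding D_def by (rule duhamel_chi_ge(3)[OF g meas f t])
  have D1: "(\<integral>\<^sup>+\<tau>. ennreal (indicator {0..t} \<tau> * resolvent \<gamma> \<gamma> (t - \<tau>)) * chi_mass (f \<tau>) \<partial>lborel)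
      \<le> chi_mass D"
    unfolding D_def by (rule duhamel_chi_ge(1)[OF g meas f t])
  have wD: "w x = frac_avg \<gamma> 0 t w0 x + D x" for x using w by (simp add: D_def P_op_eq)
  have P0: "0 \<le> frac_avg \<gamma> 0 t w0 x" for x by (rule frac_avg_nn(2)[OF g w0])
  show "0 \<le> w x" using P0[of x] D0[of x] by (simp add: wD)
  \<comment> \<open>Here 0 powr \<gamma> = 0, so every heat operator in the average is the identity,
    and the zeroth moment of \<open>mainardi\<close> is 1; the Duhamel integrand vanishes at its
    only point.\<close>
  show "w x = w0 x" if "t = 0"
  proof -
    have "D x = 0" unfolding D_def set_lebesgue_integral_def
      using that by (intro integral_eq_zero_AE AE_I2) (auto simp: indicator_def)
    moreover have "frac_avg \<gamma> 0 t w0 x = w0 x"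
      using has_bochner_integral_integral_eq[OF mainardi_moment[OF g, of 0]] that
      by (simp add: frac_avg_def heat_sg_def)
    ultimately show ?thesis by (simp add: wD)
  qed
  show "ennreal (resolvent \<gamma> 1 t) * chi_mass w0
       + (\<integral>\<^sup>+\<tau>. ennreal (indicator {0..t} \<tau> * resolvent \<gamma> \<gamma> (t - \<tau>)) * chi_mass (f \<tau>) \<partial>lborel)
      \<le> chi_mass w"
  proof -
    have "ennreal (resolvent \<gamma> 1 t) * chi_mass w0 \<le> chi_mass (frac_avg \<gamma> 0 t w0)"
    \<comment> \<open>At t = 0 the resolvent has the default value 0, not the Mittag-Leffler value
      1, so the left side is 0.\<close>
    proof (cases "t = 0")
      case False
      with t have t: "t > 0" by simp
      show ?thesis using resolvent_one_eq[OF g t] by (intro frac_avg_chi_ge[OF g w0 t]) simp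
    qed simp
    with D1 have "ennreal (resolvent \<gamma> 1 t) * chi_mass w0
       + (\<integral>\<^sup>+\<tau>. ennreal (indicator {0..t} \<tau> * resolvent \<gamma> \<gamma> (t - \<tau>)) * chi_mass (f \<tau>) \<partial>lborel)
       \<le> chi_mass (frac_avg \<gamma> 0 t w0) + chi_mass D"
      by (intro add_mono)
    also have "\<dots> = (\<integral>\<^sup>+x. ennreal (frac_avg \<gamma> 0 t w0 x * chi x) + ennreal (D x * chi x) \<partial>lborel)"
    proof (rule nn_integral_add[symmetric])
      have [measurable]: "w0 \<in> borel_measurable borel" "D \<in> borel_measurable borel" using w0 Dm by auto
      show "(\<lambda>x. ennreal (frac_avg \<gamma> 0 t w0 x * chi x)) \<in> borel_measurable lborel" by measurable
      show "(\<lambda>x. ennreal (D x * chi x)) \<in> borel_measurable lborel" by measurable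
    qed
    also have "\<dots> = chi_mass w"
      using P0 D0 by (intro nn_integral_cong) (simp add: wD ring_distribs ennreal_plus chi_nonneg)
    finally show ?thesis .
  qed
qed

text \<open>If the normalising integral did not converge, it would be 0 by default, hence
  \<open>chi\<close> identically 0 through division by 0, and every integral against
  \<open>chi\<close> would vanish. A single nonzero one therefore certifies the
  normalisation.\<close>

lemma has_bochner_integral_chi:
  fixes w :: "'a::euclidean_space \<Rightarrow> real"
  assumes "(LINT x|lborel. w x * chi x) \<noteq> 0"
  shows "has_bochner_integral lborel (chi :: 'a \<Rightarrow> real) 1"
proof -
  define c where "c = (\<integral>(y::'a). exp (- sqrt ((real DIM('a))^2 + (norm y)^2)) \<partial>lborel)"
  have chi: "chi x = exp (- sqrt ((real DIM('a))^2 + (norm x)^2)) / c" for x :: 'a by (simp add: chi_def c_def)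
  have c: "c \<noteq> 0"
  proof
    assume "c = 0"
    hence "chi x = 0" for x :: 'a by (simp add: chi)
    thus False using assms by simp
  qed
  hence "integrable lborel (\<lambda>y::'a. exp (- sqrt ((real DIM('a))^2 + (norm y)^2)))"
    unfolding c_def using not_integrable_integral_eq by blast
  hence "has_bochner_integral lborel (\<lambda>y::'a. exp (- sqrt ((real DIM('a))^2 + (norm y)^2)) / c) (c / c)"
    by (intro has_bochner_integral_divide) (simp_all add: has_bochner_integral_iff c_def)
  thus ?thesis using c by (simp add: chi[abs_def])
qed

text \<open>Applies to an arbitrary mild solution on [0,T]; nonnegativity of u and v is derived
  rather than assumed.\<close>

lemma mild_solution_time_bound:
  fixes \<gamma> p q :: real and u0 v0 :: "'a::euclidean_space \<Rightarrow> real"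
  assumes g: "0 < \<gamma>" "\<gamma> < 1" and p: "1 < p" "p \<le> q"
    and uv0: "u0 \<in> C0" "v0 \<in> C0" "\<And>x. u0 x \<ge> 0" "\<And>x. v0 x \<ge> 0"
  defines "Z0 \<equiv> (\<integral> x. (u0 x + v0 x) * chi x \<partial>lborel)"
  assumes Z0: "Z0 > 2 powr (p / (p - 1))"
    and T: "T \<ge> 0" and mild: "mild_solution \<gamma> p q u0 v0 T u v"
  shows "T \<le> (ln (1 - 2 powr p * Z0 powr (1 - p)) / (2 * (1 - p)) * Gamma (\<gamma> + 1)) powr (1 / \<gamma>)"
proof -
  have "Z0 > 0" using Z0 by (smt (verit) powr_gt_zero)
  hence chi: "has_bochner_integral lborel (chi :: 'a \<Rightarrow> real) 1" unfolding Z0_def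
    by (intro has_bochner_integral_chi[where w = "\<lambda>x. u0 x + v0 x"]) auto
  hence ic: "integrable lborel (chi :: 'a \<Rightarrow> real)" by (simp add: has_bochner_integral_iff)
  have uC: "u t \<in> C0" and vC: "v t \<in> C0" if "t \<in> {0..T}" for t using mild that by (auto simp: mild_solution_def)
  have ul: "uniform_limit UNIV u (u t) (at t within {0..T})" and vl: "uniform_limit UNIV v (v t) (at t within {0..T})"
    if "t \<in> {0..T}" for t using mild that by (auto simp: mild_solution_def)
  obtain Mu where Mu: "\<And>t x. t \<in> {0..T} \<Longrightarrow> \<bar>u t x\<bar> \<le> Mu" using C0_path_bounded[OF uC ul] by blast
  obtain Mv where Mv: "\<And>t x. t \<in> {0..T} \<Longrightarrow> \<bar>v t x\<bar> \<le> Mv" using C0_path_bounded[OF vC vl] by blast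
  obtain M1 where M1: "\<And>x. \<bar>u0 x\<bar> \<le> M1" using C0_bounded[OF uv0(1)] by blast
  obtain M2 where M2: "\<And>x. \<bar>v0 x\<bar> \<le> M2" using C0_bounded[OF uv0(2)] by blast
  have m0 [measurable]: "u0 \<in> borel_measurable borel" "v0 \<in> borel_measurable borel" using uv0 by (auto intro: C0_measurable)
  \<comment> \<open>Clamped time, so that \<open>a\<close> and \<open>b\<close> are bounded and
    nonnegative for all real t and agree with u and v on [0,T].\<close>
  define c where "c = (\<lambda>t::real. max 0 (min T t))"
  have c: "c t \<in> {0..T}" "t \<in> {0..T} \<Longrightarrow> c t = t" for t using T by (auto simp: c_def)
  define a where "a = (\<lambda>t. u (c t))"
  define b where "b = (\<lambda>t. v (c t))"
  have am [measurable]: "(\<lambda>(t, x). a t x) \<in> borel_measurable (borel \<Otimes>\<^sub>M borel)"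
    unfolding a_def c_def by (rule C0_path_measurable[OF T uC ul])
  have bm [measurable]: "(\<lambda>(t, x). b t x) \<in> borel_measurable (borel \<Otimes>\<^sub>M borel)"
    unfolding b_def c_def by (rule C0_path_measurable[OF T vC vl])
  have atm [measurable]: "a t \<in> borel_measurable borel" for t by measurable
  have btm [measurable]: "b t \<in> borel_measurable borel" for t by measurable
  have ab: "\<bar>a t x\<bar> \<le> Mu" and bb: "\<bar>b t x\<bar> \<le> Mv" for t x using Mu[OF c(1)] Mv[OF c(1)] by (auto simp: a_def b_def)
  define f where "f = (\<lambda>t y. \<bar>b t y\<bar> powr p)"
  define h where "h = (\<lambda>t y. \<bar>a t y\<bar> powr q)"
  have fm [measurable]: "(\<lambda>(t, x). f t x) \<in> borel_measurable (borel \<Otimes>\<^sub>M borel)" unfolding f_def by measurable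
  have hm [measurable]: "(\<lambda>(t, x). h t x) \<in> borel_measurable (borel \<Otimes>\<^sub>M borel)" unfolding h_def by measurable
  have f: "0 \<le> f t y" "f t y \<le> Mv powr p" for t y using bb p by (auto simp: f_def intro!: powr_mono2)
  have h: "0 \<le> h t y" "h t y \<le> Mu powr q" for t y using ab p by (auto simp: h_def intro!: powr_mono2)
  have aeq: "a t x = P_op \<gamma> t u0 x + (LINT \<tau>:{0..t}|lborel. (t - \<tau>) powr (\<gamma> - 1) * S_op \<gamma> (t - \<tau>) (f \<tau>) x)" if t: "t \<in> {0..T}" for t x
  proof -
    have "f \<tau> = (\<lambda>y. \<bar>v \<tau> y\<bar> powr p)" if "\<tau> \<in> {0..t}" for \<tau> using that t by (simp add: f_def b_def c)
    hence "(LINT \<tau>:{0..t}|lborel. (t - \<tau>) powr (\<gamma> - 1) * S_op \<gamma> (t - \<tau>) (f \<tau>) x) = (LINT \<tau>:{0..t}|lborel. (t - \<tau>) powr (\<gamma> - 1) * S_op \<gamma> (t - \<tau>) (\<lambda>y. \<bar>v \<tau> y\<bar> powr p) x)"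
      by (intro set_lebesgue_integral_cong) auto
    thus ?thesis using mild t by (simp add: mild_solution_def a_def c)
  qed
  have beq: "b t x = P_op \<gamma> t v0 x + (LINT \<tau>:{0..t}|lborel. (t - \<tau>) powr (\<gamma> - 1) * S_op \<gamma> (t - \<tau>) (h \<tau>) x)" if t: "t \<in> {0..T}" for t x
  proof -
    have "h \<tau> = (\<lambda>y. \<bar>u \<tau> y\<bar> powr q)" if "\<tau> \<in> {0..t}" for \<tau> using that t by (simp add: h_def a_def c)
    hence "(LINT \<tau>:{0..t}|lborel. (t - \<tau>) powr (\<gamma> - 1) * S_op \<gamma> (t - \<tau>) (h \<tau>) x) = (LINT \<tau>:{0..t}|lborel. (t - \<tau>) powr (\<gamma> - 1) * S_op \<gamma> (t - \<tau>) (\<lambda>y. \<bar>u \<tau> y\<bar> powr q) x)"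
      by (intro set_lebesgue_integral_cong) auto
    thus ?thesis using mild t by (simp add: mild_solution_def b_def c)
  qed
  have u0M: "u0 y \<le> M1" and v0M: "v0 y \<le> M2" for y using M1[of y] M2[of y] by auto
  note ca = mild_component_ge[OF g fm f _ m0(1) uv0(3) u0M aeq]
  note cb = mild_component_ge[OF g hm h _ m0(2) uv0(4) v0M beq]
  have cc: "c (c t) = c t" for t using c by blast
  have "0 \<le> a (c t) x" "0 \<le> b (c t) x" for t x
    using c(1)[of t] by (auto intro!: ca(1) cb(1))
  hence a0: "0 \<le> a t x" and b0: "0 \<le> b t x" for t x by (simp_all add: a_def b_def cc)
  define U where "U = (\<lambda>t. LINT x|lborel. a t x * chi x)"
  define V where "V = (\<lambda>t. LINT x|lborel. b t x * chi x)"
  define Z where "Z = (\<lambda>t. U t + V t)"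
  have ia: "integrable lborel (\<lambda>x. a t x * chi x)" and ib: "integrable lborel (\<lambda>x. b t x * chi x)" for t
    using integrable_bounded_chi[OF ic atm ab] integrable_bounded_chi[OF ic btm bb] by auto
  have U0: "U t \<ge> 0" and V0: "V t \<ge> 0" for t
    unfolding U_def V_def by (intro Bochner_Integration.integral_nonneg mult_nonneg_nonneg a0 b0 chi_nonneg)+
  have Zn: "ennreal (Z t) = chi_mass (a t) + chi_mass (b t)" for t
    using ia ib U0 V0 a0 b0 by (subst (1 2) nn_integral_eq_integral) (auto simp: Z_def U_def V_def chi_nonneg intro!: AE_I2)
  have Zm [measurable]: "(\<lambda>t. ennreal (Z t)) \<in> borel_measurable borel" unfolding Zn by measurable
  define G where "G = (\<lambda>t. chi_mass (f t) + chi_mass (h t))"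
  have Gm [measurable]: "G \<in> borel_measurable borel" unfolding G_def by measurable
  \<comment> \<open>Jensen for each component, then the two-power inequality; the two sources
    contribute V^p and U^q.\<close>
  have Gge: "ennreal (2 powr (1 - p) * Z t powr p - 1) \<le> G t" for t
  proof -
    have if': "integrable lborel (\<lambda>x. f t x * chi x)"
      using f by (intro integrable_bounded_chi[OF ic, where M = "Mv powr p"]) auto
    have ih: "integrable lborel (\<lambda>x. h t x * chi x)"
      using h by (intro integrable_bounded_chi[OF ic, where M = "Mu powr q"]) auto
    have "V t powr p \<le> (LINT x|lborel. f t x * chi x)"
      unfolding V_def f_def using b0 bb[of t] p powr_chi_jensen[OF chi btm b0, of t Mv p] by (simp add: abs_le_iff)
    moreover have "U t powr q \<le> (LINT x|lborel. h t x * chi x)"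
      unfolding U_def h_def using a0 ab[of t] p powr_chi_jensen[OF chi atm a0, of t Mu q] by (simp add: abs_le_iff)
    ultimately have "2 powr (1 - p) * Z t powr p - 1 \<le> (LINT x|lborel. f t x * chi x) + (LINT x|lborel. h t x * chi x)"
      using two_powers_ge[OF U0[of t] V0[of t] p] by (simp add: Z_def)
    hence "ennreal (2 powr (1 - p) * Z t powr p - 1) \<le> ennreal ((LINT x|lborel. f t x * chi x) + (LINT x|lborel. h t x * chi x))"
      by (rule ennreal_leI)
    also have "\<dots> = G t" unfolding G_def
      using if' ih f h by (subst (1 2) nn_integral_eq_integral) (auto simp: chi_nonneg intro!: Bochner_Integration.integral_nonneg AE_I2)
    finally show ?thesis .
  qed
  define I0 where "I0 = chi_mass u0 + chi_mass v0"
  have iu: "integrable lborel (\<lambda>x. u0 x * chi x)" and iv: "integrable lborel (\<lambda>x. v0 x * chi x)"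
    using integrable_bounded_chi[OF ic m0(1) M1] integrable_bounded_chi[OF ic m0(2) M2] by auto
  have Z0eq: "Z0 = (LINT x|lborel. u0 x * chi x) + (LINT x|lborel. v0 x * chi x)"
    unfolding Z0_def using iu iv by (simp add: ring_distribs)
  have I0: "I0 = ennreal Z0"
    unfolding I0_def Z0eq using iu iv uv0
    by (subst (1 2) nn_integral_eq_integral) (auto simp: chi_nonneg intro!: Bochner_Integration.integral_nonneg AE_I2)
  \<comment> \<open>Both components carry the same resolvents, so the sum of their masses satisfies
    one inequality with source \<open>G\<close>.\<close>
  have voc: "ennreal (resolvent \<gamma> 1 s) * ennreal Z0 + (\<integral>\<^sup>+r. ennreal (indicator {0..s} r * resolvent \<gamma> \<gamma> (s - r)) * G r \<partial>lborel) \<le> ennreal (Z s)"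
    if "0 \<le> s" "s \<le> T" for s
  proof -
    have s: "s \<in> {0..T}" using that by simp
    have "ennreal (resolvent \<gamma> 1 s) * ennreal Z0 + (\<integral>\<^sup>+r. ennreal (indicator {0..s} r * resolvent \<gamma> \<gamma> (s - r)) * G r \<partial>lborel)
      = (ennreal (resolvent \<gamma> 1 s) * chi_mass u0
       + (\<integral>\<^sup>+r. ennreal (indicator {0..s} r * resolvent \<gamma> \<gamma> (s - r)) * chi_mass (f r) \<partial>lborel))
      + (ennreal (resolvent \<gamma> 1 s) * chi_mass v0
       + (\<integral>\<^sup>+r. ennreal (indicator {0..s} r * resolvent \<gamma> \<gamma> (s - r)) * chi_mass (h r) \<partial>lborel))"
      unfolding I0[symmetric] I0_def G_def distrib_left by (subst nn_integral_add) (auto simp: add_ac)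
    also have "\<dots> \<le> ennreal (Z s)" unfolding Zn by (intro add_mono ca(3) cb(3) s that)
    finally show ?thesis .
  qed
  have Zcont: "continuous_on {0..T} Z"
  proof -
    have "continuous_on {0..T} (\<lambda>t. (LINT x|lborel. u t x * chi x) + (LINT x|lborel. v t x * chi x))"
      by (intro continuous_on_add C0_path_chi_continuous[OF chi] uC vC ul vl)
    thus ?thesis by (rule continuous_on_eq) (simp add: Z_def U_def V_def a_def b_def c)
  qed
  show ?thesis
  proof (rule fractional_blowup_bound[OF g p(1) Z0 Zcont T])
    show "Z 0 \<ge> Z0"
      proof -
      have "a 0 x = u0 x" "b 0 x = v0 x" for x using T by (auto intro!: ca(2) cb(2))
      thus ?thesis by (simp add: Z_def U_def V_def Z0eq)
    qed
    show "Z t \<ge> 0" for t using U0 V0 by (simp add: Z_def)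
    fix t assume t: "0 < t" "t \<le> T" and Z2: "\<And>s. 0 \<le> s \<Longrightarrow> s < t \<Longrightarrow> Z s \<ge> 2"
    have t0: "t \<ge> 0" using t by simp
    have Znn: "Z s \<ge> 0" for s using U0 V0 by (simp add: Z_def)
    have Zc: "continuous_on {0..t} Z" by (rule continuous_on_subset[OF Zcont]) (use t in auto)
    have Hc: "continuous_on {0..t} (\<lambda>s. 2 powr (1 - p) * Z s powr p - Z s)"
      using Znn p by (intro continuous_intros Zc continuous_on_powr') auto
    note iZ = integrable_frac_kernel_mult(1)[OF g(1) t0 Zc]
    note iH = integrable_frac_kernel_mult(1)[OF g(1) t0 Hc]
    have fk: "0 \<le> frac_kernel \<gamma> s" for s by (rule frac_kernel_nonneg[OF g(1)])
    \<comment> \<open>Here -1 has been replaced by -Z. For Z > 0, nonnegativity of 2^(1-p) Z^p - Z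
      amounts to Z >= 2; it is what permits the comparison in \<open>ennreal\<close>.\<close>
    have Hnn: "0 \<le> indicator {0..t} s * (frac_kernel \<gamma> (t - s) * (2 powr (1 - p) * Z s powr p - Z s))"
      and HG: "ennreal (indicator {0..t} s * (frac_kernel \<gamma> (t - s) * (2 powr (1 - p) * Z s powr p - Z s))) \<le> ennreal (indicator {0..t} s * frac_kernel \<gamma> (t - s)) * G s" for s
    proof -
      consider "s < 0 \<or> s > t" | "s = t" | "0 \<le> s" "s < t" by linarith
      hence "0 \<le> indicator {0..t} s * (frac_kernel \<gamma> (t - s) * (2 powr (1 - p) * Z s powr p - Z s)) \<and>
        ennreal (indicator {0..t} s * (frac_kernel \<gamma> (t - s) * (2 powr (1 - p) * Z s powr p - Z s))) \<le> ennreal (indicator {0..t} s * frac_kernel \<gamma> (t - s)) * G s"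
      proof cases
        case 3
        have Z2s: "Z s \<ge> 2" using Z2 3 by simp
        have "Z s = 2 powr (1 - p) * 2 powr (p - 1) * Z s" by (simp flip: powr_add)
        also have "\<dots> \<le> 2 powr (1 - p) * Z s powr (p - 1) * Z s"
          using Z2s p by (intro mult_right_mono mult_left_mono powr_mono2) auto
        also have "\<dots> = 2 powr (1 - p) * Z s powr p" using Z2s by (simp add: powr_diff)
        finally have H0: "0 \<le> 2 powr (1 - p) * Z s powr p - Z s" by simp
        have "ennreal (frac_kernel \<gamma> (t - s) * (2 powr (1 - p) * Z s powr p - Z s)) = ennreal (frac_kernel \<gamma> (t - s)) * ennreal (2 powr (1 - p) * Z s powr p - Z s)"
          using fk H0 by (simp add: ennreal_mult)
        also have "\<dots> \<le> ennreal (frac_kernel \<gamma> (t - s)) * G s"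
          using Z2s by (intro mult_left_mono order_trans[OF ennreal_leI Gge]) auto
        finally show ?thesis using 3 fk[of "t - s"] H0 by simp
      qed auto
      thus "0 \<le> indicator {0..t} s * (frac_kernel \<gamma> (t - s) * (2 powr (1 - p) * Z s powr p - Z s))"
        "ennreal (indicator {0..t} s * (frac_kernel \<gamma> (t - s) * (2 powr (1 - p) * Z s powr p - Z s))) \<le> ennreal (indicator {0..t} s * frac_kernel \<gamma> (t - s)) * G s"
        by auto
    qed
    define LH where "LH = (LINT s|lborel. indicator {0..t} s * (frac_kernel \<gamma> (t - s) * (2 powr (1 - p) * Z s powr p - Z s)))"
    define LZ where "LZ = (LINT s|lborel. indicator {0..t} s * (frac_kernel \<gamma> (t - s) * Z s))"
    have LH0: "LH \<ge> 0" unfolding LH_def by (intro Bochner_Integration.integral_nonneg Hnn)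
    have Znn': "0 \<le> indicator {0..t} s * (frac_kernel \<gamma> (t - s) * Z s)" for s using fk Znn by simp
    have LZ0: "LZ \<ge> 0" unfolding LZ_def by (intro Bochner_Integration.integral_nonneg Znn')
    have "ennreal LH = (\<integral>\<^sup>+s. ennreal (indicator {0..t} s * (frac_kernel \<gamma> (t - s) * (2 powr (1 - p) * Z s powr p - Z s))) \<partial>lborel)"
      unfolding LH_def by (rule nn_integral_eq_integral[symmetric, OF iH]) (intro AE_I2 Hnn)
    also have "\<dots> \<le> (\<integral>\<^sup>+s. ennreal (indicator {0..t} s * frac_kernel \<gamma> (t - s)) * G s \<partial>lborel)"
      by (intro nn_integral_mono HG)
    finally have "ennreal Z0 + ennreal LH \<le> ennreal Z0 + (\<integral>\<^sup>+s. ennreal (indicator {0..t} s * frac_kernel \<gamma> (t - s)) * G s \<partial>lborel)"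
      by (rule add_left_mono)
    also have "\<dots> \<le> ennreal (Z t) + (\<integral>\<^sup>+s. ennreal (indicator {0..t} s * frac_kernel \<gamma> (t - s)) * ennreal (Z s) \<partial>lborel)"
      using t by (intro volterra_inequality[OF g Zm Gm t(1)] voc) auto
    also have "(\<integral>\<^sup>+s. ennreal (indicator {0..t} s * frac_kernel \<gamma> (t - s)) * ennreal (Z s) \<partial>lborel) = (\<integral>\<^sup>+s. ennreal (indicator {0..t} s * (frac_kernel \<gamma> (t - s) * Z s)) \<partial>lborel)"
      using fk Znn by (intro nn_integral_cong) (simp add: ennreal_mult[symmetric] mult.assoc)
    also have "\<dots> = ennreal LZ"
      unfolding LZ_def by (rule nn_integral_eq_integral[OF iZ]) (intro AE_I2 Znn')
    finally have "ennreal (Z0 + LH) \<le> ennreal (Z t + LZ)"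
      using \<open>Z0 > 0\<close> LH0 LZ0 Znn[of t] by (simp add: ennreal_plus)
    hence "Z0 + LH \<le> Z t + LZ" using LZ0 Znn[of t] by (subst (asm) ennreal_le_iff) auto
    \<comment> \<open>The second -Z is the fractional integral of Z from
      \<open>volterra_inequality\<close>, moved across once all integrals are real numbers.\<close>
    moreover have "LH - LZ = (LINT s|lborel. indicator {0..t} s * (frac_kernel \<gamma> (t - s) * (2 powr (1 - p) * Z s powr p - 2 * Z s)))"
      unfolding LH_def LZ_def by (subst Bochner_Integration.integral_diff[symmetric, OF iH iZ]) (simp add: algebra_simps)
    ultimately show "Z t \<ge> Z0 + (LINT s|lborel. indicator {0..t} s * (frac_kernel \<gamma> (t - s) * (2 powr (1 - p) * Z s powr p - 2 * Z s)))"
      by linarith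
  qed
qed

theorem theorem3p7:
  fixes \<gamma> p q :: real and u0 v0 :: "'a::euclidean_space \<Rightarrow> real"
  assumes "0 < \<gamma>" "\<gamma> < 1" "1 < p" "p \<le> q"
    and "u0 \<in> C0" "v0 \<in> C0" "\<forall>x. u0 x \<ge> 0" "\<forall>x. v0 x \<ge> 0"
    and "(\<integral> x. (u0 x + v0 x) * chi x \<partial>lborel) > 2 powr (p / (p - 1))"
  shows "T_max \<gamma> p q u0 v0 < \<infinity> \<and>
         T_max \<gamma> p q u0 v0 \<le>
           ereal ((ln (1 - 2 powr p * (\<integral> x. (u0 x + v0 x) * chi x \<partial>lborel) powr (1 - p))
                   / (2 * (1 - p)) * Gamma (\<gamma> + 1)) powr (1 / \<gamma>))"
proof -
  have le: "T_max \<gamma> p q u0 v0 \<le>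
           ereal ((ln (1 - 2 powr p * (\<integral> x. (u0 x + v0 x) * chi x \<partial>lborel) powr (1 - p))
                   / (2 * (1 - p)) * Gamma (\<gamma> + 1)) powr (1 / \<gamma>))"
    unfolding T_max_def
  \<comment> \<open>\<open>T_max\<close> is a supremum of existence times, so it is enough to bound
    each of them.\<close>
  proof (intro SUP_least, clarify)
    fix T u v assume "T \<ge> 0" "mild_solution \<gamma> p q u0 v0 T u v"
    thus "ereal T \<le> ereal ((ln (1 - 2 powr p * (\<integral> x. (u0 x + v0 x) * chi x \<partial>lborel) powr (1 - p))
                   / (2 * (1 - p)) * Gamma (\<gamma> + 1)) powr (1 / \<gamma>))"
      unfolding ereal_less_eq using assms by (intro mild_solution_time_bound) auto
  qed
  also have "\<dots> < \<infinity>" by simp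
  finally show ?thesis using le by simp
qed

end
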